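(* There is an algorithm which, given a graph $G$ (without any representation) and an integer $k$, runs in time polynomial in $|V(G)|$ and: if $G$ is a string graph with $\mathsf{vc}(G)\le k$, it reports the first case; and if $G$ is a string graph with $\mathsf{vc}(G) > 11k/6$, it reports the second case. (If neither case applies, the algorithm terminates but its output is unspecified.)
   Context: A graph $G$ is a string graph if it is the intersection graph of a family of connected vertex subsets of some planar graph (equivalently, of a family of curves in the plane each homeomorphic to a closed segment). A vertex cover of $G$ is a set $S\subseteq V(G)$ such that $G-S$ has no edges; $\mathsf{vc}(G)$ denotes the minimum size of a vertex cover of $G$. *)

theory Defs
  imports
    "HOL-Analysis.Analysis"
    "HOL-Computational_Algebra.Polynomial"
    "Graph_Theory.Digraph_Component"
begin

section \<open>Graphs\<close>

text \<open>
  Finite simple graphs are \<^locale>\<open>pair_graph\<close>s: every edge is represented by both of its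
  orientations.
\<close>

definition vertex_cover :: "'a pair_pre_digraph \<Rightarrow> 'a set \<Rightarrow> bool" where
  "vertex_cover G S \<longleftrightarrow> S \<subseteq> pverts G \<and> arcs (with_proj G \<restriction> (pverts G - S)) = {}"

definition vc :: "'a pair_pre_digraph \<Rightarrow> nat" where
  "vc G = (LEAST m. \<exists>S. vertex_cover G S \<and> card S = m)"

text \<open>
  A plane drawing: vertices are distinct points of the plane, an edge is a simple curve joining its
  ends and avoiding all other vertices, and two distinct edges meet at most in common ends. The two
  orientations of an edge are drawn on the same curve.
\<close>

definition plane_drawing ::
  "'a pair_pre_digraph \<Rightarrow> ('a \<Rightarrow> complex) \<Rightarrow> ('a \<times> 'a \<Rightarrow> real \<Rightarrow> complex) \<Rightarrow> bool" where
  "plane_drawing G pos \<gamma> \<longleftrightarrow>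
     inj_on pos (pverts G) \<and>
     (\<forall>(u, v) \<in> parcs G.
        arc (\<gamma> (u, v)) \<and> pathstart (\<gamma> (u, v)) = pos u \<and> pathfinish (\<gamma> (u, v)) = pos v \<and>
        \<gamma> (v, u) = reversepath (\<gamma> (u, v)) \<and>
        path_image (\<gamma> (u, v)) \<inter> pos ` pverts G = {pos u, pos v}) \<and>
     (\<forall>(u, v) \<in> parcs G. \<forall>(x, y) \<in> parcs G. {u, v} \<noteq> {x, y} \<longrightarrow>
        path_image (\<gamma> (u, v)) \<inter> path_image (\<gamma> (x, y)) \<subseteq> pos ` ({u, v} \<inter> {x, y}))"

definition planar :: "'a pair_pre_digraph \<Rightarrow> bool" where
  "planar G \<longleftrightarrow> (\<exists>pos \<gamma>. plane_drawing G pos \<gamma>)"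

text \<open>
  The host graph \<open>H\<close> is finite, so taking its vertices to be natural numbers is no restriction.
  \<^const>\<open>Digraph_Component.connected\<close> includes being nonempty.
\<close>

definition string_graph :: "'a pair_pre_digraph \<Rightarrow> bool" where
  "string_graph G \<longleftrightarrow>
     (\<exists>(H :: nat pair_pre_digraph) (S :: 'a \<Rightarrow> nat set).
        pair_graph H \<and> planar H \<and>
        (\<forall>v \<in> pverts G. S v \<subseteq> pverts H \<and>
           Digraph_Component.connected (with_proj H \<restriction> S v)) \<and>
        (\<forall>u \<in> pverts G. \<forall>v \<in> pverts G. u \<noteq> v \<longrightarrow>
           ((u, v) \<in> parcs G \<longleftrightarrow> S u \<inter> S v \<noteq> {})))"

section \<open>Algorithms\<close>

text \<open>
  Algorithms are programs of a random access machine in the style of Cook and Reckhow: integer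
  memory cells, indirect addressing, addition, subtraction and tests for positivity, at unit cost
  per operation, with structured control flow in place of jumps. There is deliberately no
  multiplication: a cell then holds a number of \<open>O(t + log M)\<close> bits after \<open>t\<close> steps on inputs
  bounded by \<open>M\<close>, so this notion of polynomial time agrees with that of Turing machines. The
  program is fixed, independently of the size of the input.
\<close>

type_synonym memory = "int \<Rightarrow> int"

datatype expr =
    Num int
  | Load expr
  | Plus expr expr
  | Minus expr expr

fun expr_val :: "expr \<Rightarrow> memory \<Rightarrow> int" where
  "expr_val (Num c) m = c"
| "expr_val (Load e) m = m (expr_val e m)"
| "expr_val (Plus e1 e2) m = expr_val e1 m + expr_val e2 m"
| "expr_val (Minus e1 e2) m = expr_val e1 m - expr_val e2 m"

fun expr_cost :: "expr \<Rightarrow> nat" where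
  "expr_cost (Num c) = 1"
| "expr_cost (Load e) = expr_cost e + 1"
| "expr_cost (Plus e1 e2) = expr_cost e1 + expr_cost e2 + 1"
| "expr_cost (Minus e1 e2) = expr_cost e1 + expr_cost e2 + 1"

text \<open>
  \<open>Store a e\<close> writes the value of \<open>e\<close> to the cell whose address is the value of \<open>a\<close>. A condition
  holds if the value of the expression is positive.
\<close>

datatype prog =
    Skip
  | Store expr expr
  | Seq prog prog
  | Cond expr prog prog
  | While expr prog

text \<open>
  \<open>exec P m t m'\<close>: started in memory \<open>m\<close>, the program \<open>P\<close> halts after \<open>t\<close> steps in memory \<open>m'\<close>.
\<close>

inductive exec :: "prog \<Rightarrow> memory \<Rightarrow> nat \<Rightarrow> memory \<Rightarrow> bool" where
  Skip: "exec Skip m 1 m"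
| Store: "exec (Store a e) m (expr_cost a + expr_cost e + 1) (m(expr_val a m := expr_val e m))"
| Seq: "exec P m t m' \<Longrightarrow> exec Q m' t' m'' \<Longrightarrow> exec (Seq P Q) m (t + t') m''"
| Cond_True: "expr_val e m > 0 \<Longrightarrow> exec P m t m' \<Longrightarrow>
    exec (Cond e P Q) m (expr_cost e + 1 + t) m'"
| Cond_False: "\<not> expr_val e m > 0 \<Longrightarrow> exec Q m t m' \<Longrightarrow>
    exec (Cond e P Q) m (expr_cost e + 1 + t) m'"
| While_True: "expr_val e m > 0 \<Longrightarrow> exec P m t m' \<Longrightarrow> exec (While e P) m' t' m'' \<Longrightarrow>
    exec (While e P) m (expr_cost e + 1 + t + t') m''"
| While_False: "\<not> expr_val e m > 0 \<Longrightarrow> exec (While e P) m (expr_cost e + 1) m"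

inductive_cases SkipE: "exec Skip m t m'"
inductive_cases StoreE: "exec (Store a e) m t m'"
inductive_cases SeqE: "exec (Seq P Q) m t m'"
inductive_cases CondE: "exec (Cond e P Q) m t m'"
inductive_cases WhileE: "exec (While e P) m t m'"

lemma exec_deterministic:
  assumes "exec P m t1 m1" and "exec P m t2 m2"
  shows "t1 = t2 \<and> m1 = m2"
  using assms
proof (induction arbitrary: t2 m2 rule: exec.induct)
  case Skip
  then show ?case by (auto elim: SkipE)
next
  case Store
  then show ?case by (auto elim: StoreE)
next
  case (Seq P m t m' Q t' m'')
  from Seq.prems show ?case by (rule SeqE) (auto dest: Seq.IH)
next
  case (Cond_True e m P t m' Q)
  from Cond_True.prems show ?case by (rule CondE) (use Cond_True.hyps in \<open>auto dest: Cond_True.IH\<close>)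
next
  case (Cond_False e m Q t m' P)
  from Cond_False.prems show ?case by (rule CondE) (use Cond_False.hyps in \<open>auto dest: Cond_False.IH\<close>)
next
  case (While_True e m P t m' t' m'')
  from While_True.prems show ?case by (rule WhileE) (use While_True.hyps in \<open>auto dest: While_True.IH\<close>)
next
  case (While_False e m P)
  from While_False.prems show ?case by (rule WhileE) (use While_False.hyps in auto)
qed

text \<open>
  Input: a graph on the vertices \<open>0, \<dots>, n - 1\<close> and an integer \<open>k\<close>. Cell \<open>0\<close> holds \<open>n\<close>, cell
  \<open>1\<close> holds \<open>k\<close>, the cells from \<open>2\<close> on hold the adjacency matrix row by row, and all other cells
  are \<open>0\<close>. Output: cell \<open>0\<close>, which is \<open>1\<close> for reporting the first case and \<open>2\<close> for reporting the
  second case.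
\<close>

definition input_memory :: "nat pair_pre_digraph \<Rightarrow> int \<Rightarrow> memory" where
  "input_memory G k a =
     (let n = int (card (pverts G)) in
      if a = 0 then n
      else if a = 1 then k
      else if 2 \<le> a \<and> a < 2 + n * n \<and> (nat ((a - 2) div n), nat ((a - 2) mod n)) \<in> parcs G then 1
      else 0)"

definition reports_first :: "memory \<Rightarrow> bool" where
  "reports_first m \<longleftrightarrow> m 0 = 1"

definition reports_second :: "memory \<Rightarrow> bool" where
  "reports_second m \<longleftrightarrow> m 0 = 2"

end

theory Submission
  imports Defs "HOL-Complex_Analysis.Riemann_Mapping"
begin

text \<open>
  A vertex cover contains at least \<open>(L + 1) / 2\<close> vertices of every cycle of odd length \<open>L\<close>. The
  algorithm repeatedly deletes all vertices of a shortest odd cycle of length at most \<open>11\<close>, which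
  overpays by a factor of at most \<open>11/6\<close>, and computes a half-integral optimal cover of the rest
  from a maximum matching of its bipartite double cover. The number compared with \<open>2k\<close> is the sum
  of \<open>L + 1\<close> over the deleted cycles and the size of the matching; it never exceeds \<open>2 vc(G)\<close>.

  For the other direction, the vertices of value \<open>1/2\<close> induce a string graph without odd closed
  walks of length at most \<open>11\<close>, and it suffices that an independent set contains a twelfth of them,
  as the other \<open>11/12\<close> cost at most \<open>11/6\<close> times their value.
  One parity class of the levels of a breadth first search costs a factor of \<open>2\<close>. For a fixed level,
  contract the union \<open>U\<close> of the strings at least two levels nearer to the root, which is connected, to a
  ground; what lies outside of \<open>U\<close> is a family of strings, some of which touch the ground in a linear
  order. A second breadth first search from the first of these costs another factor of \<open>2\<close>. The
  pairs of adjacent strings in a level of it, each continued to the ground, form fences: a string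
  that reaches the ground under a fence is at a short distance from it, since its path to the root has to
  cross it. So short closed walks control the graph between consecutive fences, and the level loses a factor of
  \<open>3/2\<close> to split it into bipartite parts and a factor of \<open>2\<close> for the larger colour class.
\<close>

section \<open>The order along a connected set in the plane\<close>

text \<open>The string representation is used in the analysis only, and no cover is ever built by
  the program: planarity matters for one inequality, the upper bound on \<open>vc G\<close>. The
  length 11 comes from the colouring near a fence. A string forced to meet a fence is at distance at
  most 3 from it: two steps to a string that touches the fence and one step onto it. One more step
  is allowed for neighbours of such strings. Two walks of length at most 4, at most 3 steps along
  the fence and the edge to be coloured close up to length at most 12, hence at most 11 if odd.
  Contracting the ground in the host graph would require a new plane drawing. Instead the given
  drawing is kept and a face of the ground is embedded in a disc; the order in which edges cross a
  slightly smaller circle replaces the rotation at the contracted vertex. Strings in the level next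
  to the ground overlap it and may fall apart when it is removed. Their pieces become strings in
  their own right, which does no harm because odd closed walks of pieces project to odd closed walks
  of the same length in the original graph.\<close>

lemma norm_inverse_ge:
  fixes z :: complex
  assumes "norm z \<le> B" "z \<noteq> 0"
  shows "1 / B \<le> norm (inverse z)"
  unfolding norm_inverse inverse_eq_divide[of "norm z"] using assms by (intro frac_le) auto

lemma norm_ge_of_inverse_le:
  fixes z :: complex
  assumes "norm (inverse z) \<le> b" "z \<noteq> 0"
  shows "1 / b \<le> norm z"
  using norm_inverse_ge[of "inverse z" b] assms by simp

text \<open>The component \<open>D\<close> may be the outer face of \<open>K\<close>, which need not
  be simply connected in the plane. Inversion at a point \<open>t0\<close> of \<open>K\<close> sends
  \<open>t0\<close> to infinity; connectedness of \<open>K\<close> then makes all components of the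
  complement of the inverted face unbounded, so that the face is homeomorphic to a disc. The last
  property, that \<open>K\<close> is approached only when the norm of \<open>\<phi>\<close> exceeds
  every \<open>r < 1\<close>, replaces an extension of the chart to the boundary.\<close>

lemma disc_chart:
  fixes K :: "complex set" and n0 :: complex
  assumes K: "compact K" "path_connected K" "K \<noteq> {}" and n0: "n0 \<notin> K"
  obtains \<phi> :: "complex \<Rightarrow> complex" where
    "continuous_on (connected_component_set (- K) n0) \<phi>"
    "inj_on \<phi> (connected_component_set (- K) n0)"
    "\<phi> ` connected_component_set (- K) n0 \<subseteq> ball 0 1"
    "\<And>r. r < 1 \<Longrightarrow>
       K \<inter> closure {z \<in> connected_component_set (- K) n0. norm (\<phi> z) \<le> r} = {}"
proof -
  define D where "D = connected_component_set (- K) n0"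
  have DK: "D \<subseteq> - K" by (simp add: D_def connected_component_subset)
  have n0D: "n0 \<in> D" using n0 by (simp add: D_def)
  obtain t0 where t0: "t0 \<in> K" using K by blast
  define \<iota> where "\<iota> z = inverse (z - t0)" for z :: complex
  define C where "C = \<iota> ` (K - {t0})"
  \<comment> \<open>By the convention \<open>inverse 0 = 0\<close> this holds at \<open>t0\<close>
    too, so \<open>\<iota>\<close> is injective on the whole plane. Geometrically the value 0 is the
    image of infinity; it lies outside of \<open>C\<close>.\<close>
  have \<iota>_inv: "t0 + inverse (\<iota> z) = z" for z by (simp add: \<iota>_def)
  have \<iota>_cont: "continuous_on X \<iota>" if "t0 \<notin> X" for X
    unfolding \<iota>_def using that by (intro continuous_intros) auto
  have \<iota>_inj: "\<iota> z = \<iota> z' \<longleftrightarrow> z = z'" for z z' by (metis \<iota>_inv)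
  obtain B where B: "B > 0" "K \<subseteq> cball t0 B"
    using bounded_subset_ballD[OF compact_imp_bounded[OF K(1)], of t0] by (meson ball_subset_cball order_trans)
  have C_eq: "C = {w \<in> {w. 1 / B \<le> norm w}. t0 + inverse w \<in> K}"
  proof (intro set_eqI iffI)
    fix w assume "w \<in> C"
    then obtain z where z: "z \<in> K" "z \<noteq> t0" "w = inverse (z - t0)" by (auto simp: C_def \<iota>_def)
    have "norm (z - t0) \<le> B" using B(2) z(1) by (auto simp: dist_norm norm_minus_commute)
    moreover have "norm (z - t0) > 0" using z by simp
    ultimately have "1 / B \<le> norm w" using norm_inverse_ge z(3) by auto
    then show "w \<in> {w \<in> {w. 1 / B \<le> norm w}. t0 + inverse w \<in> K}" using z by simp
  next
    fix w assume w: "w \<in> {w \<in> {w. 1 / B \<le> norm w}. t0 + inverse w \<in> K}"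
    then have "1 / B \<le> norm w" by simp
    then have "w \<noteq> 0" using B(1) by (metis divide_pos_pos norm_zero not_le zero_less_one)
    then have "w = \<iota> (t0 + inverse w)" "t0 + inverse w \<noteq> t0" by (auto simp: \<iota>_def)
    then show "w \<in> C" using w unfolding C_def by blast
  qed
  have "closed C"
    unfolding C_eq
  proof (rule continuous_closed_preimage[unfolded vimage_def Collect_conj_eq[symmetric] Int_def mem_Collect_eq, of _ "\<lambda>w. t0 + inverse w" K, simplified])
    have "w \<noteq> 0" if "1 / B \<le> norm w" for w :: complex
      using B(1) that by (metis divide_pos_pos norm_zero not_le zero_less_one)
    then show "continuous_on {w::complex. 1 / B \<le> norm w} (\<lambda>w. t0 + inverse w)"
      by (intro continuous_intros) auto
    show "closed {w::complex. 1 / B \<le> norm w}" by (intro closed_Collect_le continuous_intros)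
    show "closed K" by (simp add: K(1) compact_imp_closed)
  qed
  then have openC: "open (- C)" by auto
  have \<iota>C: "\<iota> z \<notin> C" if "z \<notin> K" for z using that by (auto simp: C_def \<iota>_inj)
  define \<Omega> where "\<Omega> = connected_component_set (- C) (\<iota> n0)"
  have \<Omega>: "open \<Omega>" "Topological_Spaces.connected \<Omega>" "\<iota> n0 \<in> \<Omega>" "\<Omega> \<subseteq> - C"
    using openC \<iota>C[OF n0]
    by (simp_all add: \<Omega>_def open_connected_component connected_component_subset)
  \<comment> \<open>A bounded component \<open>Q\<close> would contain a point of \<open>C\<close>.
    From there \<open>K\<close> leads to \<open>t0\<close>, and the inverted path stays in
    \<open>Q\<close> although it runs to infinity.\<close>
  have unb: "\<not> bounded Q" if Q: "Q \<in> components (- \<Omega>)" for Q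
  proof
    assume "bounded Q"
    have "\<exists>c. c \<in> Q \<inter> C"
    proof -
      obtain x where x: "x \<in> Q" using Q in_components_nonempty by blast
      show ?thesis
      proof (cases "x \<in> C")
        case False
        have x\<Omega>: "x \<notin> \<Omega>" using Q x in_components_subset by blast
        \<comment> \<open>Another face of \<open>C\<close>: its closure stays in the component
          \<open>Q\<close>, and its boundary lies on \<open>C\<close>.\<close>
        define P where "P = connected_component_set (- C) x"
        have P: "open P" "Topological_Spaces.connected P" "x \<in> P" "P \<subseteq> - C"
          using openC False by (simp_all add: P_def open_connected_component connected_component_subset)
        have "P \<inter> \<Omega> = {}" using x\<Omega> P(3) unfolding P_def \<Omega>_def
          by (metis connected_component_nonoverlap connected_component_eq_eq disjoint_iff)
        then have "closure P \<inter> \<Omega> = {}" using \<Omega>(1) by (simp add: Int_commute open_Int_closure_eq_empty)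
        then have "closure P \<subseteq> Q"
          using components_maximal[OF Q, of "closure P"] P x closure_subset[of P] connected_imp_connected_closure[OF P(2)]
          by blast
        moreover have "P \<noteq> UNIV" using \<Omega>(3) \<open>P \<inter> \<Omega> = {}\<close> by blast
        then have "frontier P \<noteq> {}" using P by (metis empty_iff frontier_eq_empty)
        moreover have "frontier P \<subseteq> C"
        proof -
          have "P \<in> components (- C)" using False by (simp add: P_def componentsI)
          then have "frontier P \<subseteq> frontier C"
            using frontier_of_components_subset[of P "- C"] by simp
          then show ?thesis using \<open>closed C\<close> frontier_subset_closed by blast
        qed
        ultimately show ?thesis unfolding frontier_def by blast
      qed (use x in blast)
    qed
    then obtain z where z: "z \<in> K" "z \<noteq> t0" "\<iota> z \<in> Q" by (auto simp: C_def)
    obtain g where g: "path g" "path_image g \<subseteq> K" "pathstart g = z" "pathfinish g = t0"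
      using K(2) z(1) t0 unfolding path_connected_def by blast
    define T where "T = {t \<in> {0..1}. g t = t0}"
    have gc: "continuous_on {0..1} g" using g(1) by (simp add: path_def)
    have Tc: "closed T" unfolding T_def
      using continuous_closed_preimage_constant[OF gc, of t0] by simp
    have Tn: "1 \<in> T" using g(4) by (simp add: T_def pathfinish_def)
    have Tb: "bdd_below T" unfolding T_def by (rule bdd_belowI[of _ 0]) auto
    \<comment> \<open>Only the part of the path before its first visit to \<open>t0\<close> can be
      inverted continuously.\<close>
    define s where "s = Inf T"
    have sT: "s \<in> T" unfolding s_def using closed_contains_Inf[OF _ Tb Tc] Tn by blast
    have before: "g t \<noteq> t0" if "0 \<le> t" "t < s" for t
    proof
      assume "g t = t0"
      then have "t \<in> T" using that sT by (auto simp: T_def)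
      then show False using cInf_lower[OF _ Tb, of t] that by (simp add: s_def)
    qed
    have s01: "0 \<le> s" "s \<le> 1" "g s = t0" using sT by (auto simp: T_def)
    have s0: "0 < s" using s01 z(2) g(3) by (cases "s = 0") (auto simp: pathstart_def)
    have sub: "g ` {0..<s} \<subseteq> K - {t0}"
    proof safe
      fix t assume "t \<in> {0..<s}"
      then show "g t \<in> K" using g(2) s01 by (auto simp: path_image_def)
    qed (use before in auto)
    have "Topological_Spaces.connected (\<iota> ` g ` {0..<s})"
    proof (intro connected_continuous_image)
      show "continuous_on (g ` {0..<s}) \<iota>" using sub by (intro \<iota>_cont) blast
      show "continuous_on {0..<s} g" using gc s01 by (rule_tac continuous_on_subset) auto
    qed simp
    moreover have "\<iota> ` g ` {0..<s} \<subseteq> - \<Omega>"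
      using sub \<Omega>(4) unfolding C_def by blast
    moreover have "\<iota> z \<in> \<iota> ` g ` {0..<s}" using g(3) s0 by (force simp: pathstart_def)
    ultimately have "\<iota> ` g ` {0..<s} \<subseteq> Q" using components_maximal[OF Q] z(3) by blast
    then have "bounded (\<iota> ` g ` {0..<s})" using \<open>bounded Q\<close> bounded_subset by blast
    then obtain b where b: "b > 0" "\<And>t. t \<in> {0..<s} \<Longrightarrow> norm (\<iota> (g t)) \<le> b"
      unfolding bounded_pos by blast
    have far: "1 / b \<le> norm (g t - t0)" if "t \<in> {0..<s}" for t
      using b(2)[OF that] before[of t] that
      by (intro norm_ge_of_inverse_le) (auto simp: \<iota>_def)
    have "closed {t \<in> {0..s}. norm (g t - t0) \<in> {1/b..}}"
    proof (intro continuous_closed_preimage[unfolded vimage_def Collect_conj_eq[symmetric] Int_def mem_Collect_eq])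
      show "continuous_on {0..s} (\<lambda>t. norm (g t - t0))"
        using continuous_on_subset[OF gc, of "{0..s}"] s01 by (intro continuous_intros) auto
    qed auto
    moreover have "{0..<s} \<subseteq> {t \<in> {0..s}. norm (g t - t0) \<in> {1/b..}}" using far by auto
    ultimately have "closure {0..<s} \<subseteq> {t \<in> {0..s}. norm (g t - t0) \<in> {1/b..}}"
      by (simp add: closure_minimal)
    moreover have "s \<in> closure {0..<s}" using s0 by (simp add: closure_atLeastLessThan)
    ultimately have "norm (g s - t0) \<ge> 1 / b" by auto
    then show False using s01 b(1) by simp
  qed
  have "simply_connected \<Omega>"
    using simply_connected_eq_unbounded_complement_components[OF \<Omega>(1)] \<Omega>(2) unb by blast
  then have "\<Omega> homeomorphic ball (0::complex) 1"
    using simply_connected_eq_homeomorphic_to_disc[OF \<Omega>(1)] \<Omega>(3) by auto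
  then obtain f g where fg: "homeomorphism \<Omega> (ball (0::complex) 1) f g"
    unfolding homeomorphic_def by blast
  have \<iota>D: "\<iota> ` D \<subseteq> \<Omega>"
  proof -
    have "Topological_Spaces.connected (\<iota> ` D)"
      using DK t0 by (intro connected_continuous_image \<iota>_cont) (auto simp: D_def)
    moreover have "\<iota> ` D \<subseteq> - C" using DK \<iota>C by blast
    ultimately show ?thesis unfolding \<Omega>_def using n0D
      by (intro connected_component_maximal) auto
  qed
  show thesis
  proof (rule that[of "\<lambda>z. f (\<iota> z)"], unfold D_def[symmetric])
    show "continuous_on D (\<lambda>z. f (\<iota> z))"
      using \<iota>D DK t0 homeomorphism_cont1[OF fg]
      by (intro continuous_on_compose2[OF _ \<iota>_cont]) auto
    show "inj_on (\<lambda>z. f (\<iota> z)) D"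
      using homeomorphism_apply1[OF fg] \<iota>D by (intro inj_onI) (metis \<iota>_inj image_subset_iff)
    show "(\<lambda>z. f (\<iota> z)) ` D \<subseteq> ball 0 1"
      using \<iota>D homeomorphism_image1[OF fg] by blast
    fix r :: real assume r: "r < 1"
    define M where "M = g ` cball 0 r"
    have cbr: "cball (0::complex) r \<subseteq> ball 0 1" using r by auto
    have M: "compact M" "M \<subseteq> \<Omega>" unfolding M_def
      using cbr homeomorphism_cont2[OF fg] homeomorphism_image2[OF fg]
      by (auto intro!: compact_continuous_image intro: continuous_on_subset)
    obtain b where b: "b > 0" "\<And>w. w \<in> M \<Longrightarrow> norm w \<le> b"
      using M(1) compact_imp_bounded bounded_pos by metis
    \<comment> \<open>A closed set around the sublevel set that misses \<open>K\<close>. The bound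
      on the distance from \<open>t0\<close> keeps it inside the region where \<open>\<iota>\<close>
      is continuous.\<close>
    define X where "X = {z \<in> {z. 1 / b \<le> norm (z - t0)}. \<iota> z \<in> M}"
    have "closed X" unfolding X_def
    proof (intro continuous_closed_preimage[unfolded vimage_def Collect_conj_eq[symmetric] Int_def mem_Collect_eq] \<iota>_cont)
      show "closed {z. 1 / b \<le> norm (z - t0)}" by (intro closed_Collect_le continuous_intros)
      show "closed M" using M by (simp add: compact_imp_closed)
      show "t0 \<notin> {z. 1 / b \<le> norm (z - t0)}" using b(1) by simp
    qed
    moreover have "{z \<in> D. norm (f (\<iota> z)) \<le> r} \<subseteq> X"
    proof safe
      fix z assume z: "z \<in> D" "norm (f (\<iota> z)) \<le> r"
      have "g (f (\<iota> z)) = \<iota> z" using homeomorphism_apply1[OF fg] \<iota>D z by blast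
      then have zM: "\<iota> z \<in> M" unfolding M_def using z(2) by (metis image_eqI mem_cball_0)
      have "z \<noteq> t0" using z DK t0 by blast
      then have "1 / b \<le> norm (z - t0)" using b(2)[OF zM]
        by (intro norm_ge_of_inverse_le) (auto simp: \<iota>_def)
      then show "z \<in> X" using zM by (simp add: X_def)
    qed
    ultimately have "closure {z \<in> D. norm (f (\<iota> z)) \<le> r} \<subseteq> X" by (rule closure_minimal[rotated])
    moreover have "K \<inter> X = {}"
    proof -
      have "z \<notin> X" if "z \<in> K" for z
      proof (cases "z = t0")
        case True
        then show ?thesis using b(1) by (simp add: X_def)
      next
        case False
        then show ?thesis using that M(2) \<Omega>(4) by (auto simp: X_def C_def)
      qed
      then show ?thesis by blast
    qed
    ultimately show "K \<inter> closure {z \<in> D. norm (f (\<iota> z)) \<le> r} = {}" by blast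
  qed
qed

text \<open>The chart is not controlled at \<open>K\<close> itself, so a curve that runs into
  \<open>K\<close> is cut at an earlier circle. It has to reach this circle, since otherwise its end
  would lie in the closure of the sublevel set, against \<open>esc\<close>.\<close>

lemma first_exit:
  fixes D :: "complex set" and \<phi> :: "complex \<Rightarrow> complex"
  assumes \<phi>: "continuous_on D \<phi>"
    and esc: "K \<inter> closure {z \<in> D. norm (\<phi> z) \<le> r} = {}"
    and \<gamma>: "path \<gamma>" "\<And>t. 0 \<le> t \<Longrightarrow> t < 1 \<Longrightarrow> \<gamma> t \<in> D" "\<gamma> 1 \<in> K" "norm (\<phi> (\<gamma> 0)) < r"
  obtains s where "0 < s" "s < 1" "norm (\<phi> (\<gamma> s)) = r"
    "\<And>t. 0 \<le> t \<Longrightarrow> t < s \<Longrightarrow> norm (\<phi> (\<gamma> t)) < r"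
proof -
  have gc: "continuous_on {0..1} \<gamma>" using \<gamma>(1) by (simp add: path_def)
  have uc: "continuous_on X (\<lambda>t. norm (\<phi> (\<gamma> t)))" if "X \<subseteq> {0..<1}" for X
    using that \<gamma>(2)
    by (intro continuous_on_norm continuous_on_compose2[OF \<phi> continuous_on_subset[OF gc]]) auto
  have "\<exists>t1. 0 \<le> t1 \<and> t1 < 1 \<and> r < norm (\<phi> (\<gamma> t1))"
  proof (rule ccontr)
    assume "\<not> ?thesis"
    then have "\<gamma> ` {0..<1} \<subseteq> {z \<in> D. norm (\<phi> z) \<le> r}" using \<gamma>(2) by force
    then have "closure (\<gamma> ` {0..<1}) \<subseteq> closure {z \<in> D. norm (\<phi> z) \<le> r}" by (rule closure_mono)
    moreover have "\<gamma> ` closure {0..<1} \<subseteq> closure (\<gamma> ` {0..<1})"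
      using gc by (intro image_closure_subset) (auto simp: closure_subset)
    moreover have "\<gamma> 1 \<in> \<gamma> ` closure {0..<1}" by auto
    ultimately show False using \<gamma>(3) esc by blast
  qed
  then obtain t1 where t1: "0 \<le> t1" "t1 < 1" "r < norm (\<phi> (\<gamma> t1))" by blast
  define T where "T = {t \<in> {0..t1}. norm (\<phi> (\<gamma> t)) \<in> {r..}}"
  have Tc: "closed T" unfolding T_def
    using t1 by (intro continuous_closed_preimage[unfolded vimage_def Collect_conj_eq[symmetric] Int_def mem_Collect_eq] uc) auto
  have Tn: "t1 \<in> T" using t1 by (simp add: T_def)
  have Tb: "bdd_below T" unfolding T_def by (rule bdd_belowI[of _ 0]) auto
  define s where "s = Inf T"
  have sT: "s \<in> T" unfolding s_def using closed_contains_Inf[OF _ Tb Tc] Tn by blast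
  have before: "norm (\<phi> (\<gamma> t)) < r" if "0 \<le> t" "t < s" for t
  proof (rule ccontr)
    assume "\<not> ?thesis"
    then have "t \<in> T" using that sT by (auto simp: T_def)
    then show False using cInf_lower[OF _ Tb, of t] that by (simp add: s_def)
  qed
  have s: "0 \<le> s" "s \<le> t1" "r \<le> norm (\<phi> (\<gamma> s))" using sT by (auto simp: T_def)
  have "\<exists>t\<ge>0. t \<le> s \<and> norm (\<phi> (\<gamma> t)) = r"
    using s t1 \<gamma>(4) by (intro IVT' uc) auto
  then have "norm (\<phi> (\<gamma> s)) = r" using before by (metis order_le_less less_irrefl)
  moreover have "0 < s" using \<gamma>(4) s by (metis less_eq_real_def not_less)
  ultimately show thesis using that s t1 before by force
qed

text \<open>This is the crossing theorem for paths in a box, \<open>fashoda_interlace\<close>, for a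
  box whose bottom side lies on the real axis and which is large enough for both paths. Every later
  argument that two connected sets must meet goes back to it.\<close>

lemma half_plane_interlace:
  fixes f g :: "real \<Rightarrow> complex"
  assumes "path f" "path g"
    and "\<And>z. z \<in> path_image f \<union> path_image g \<Longrightarrow> 0 \<le> Im z"
    and "Im (pathstart f) = 0" "Im (pathfinish f) = 0" "Im (pathstart g) = 0" "Im (pathfinish g) = 0"
    and "Re (pathstart f) < Re (pathstart g)" "Re (pathstart g) < Re (pathfinish f)"
    and "Re (pathfinish f) < Re (pathfinish g)"
  shows "path_image f \<inter> path_image g \<noteq> {}"
proof -
  define c :: "complex \<Rightarrow> real^2" where "c z = (\<chi> i. if i = 1 then Re z else Im z)" for z
  have c1: "c z $ 1 = Re z" and c2: "c z $ 2 = Im z" for z by (simp_all add: c_def)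
  have cc: "continuous_on X c" for X
    unfolding c_def
  proof (intro continuous_on_vec_lambda)
    show "continuous_on X (\<lambda>z. if i = 1 then Re z else Im z)" for i :: 2
      by (cases "i = 1") (auto intro!: continuous_intros)
  qed
  have inj: "c z = c w \<longleftrightarrow> z = w" for z w
    by (metis c1 c2 complex_eqI)
  have "bounded (path_image f \<union> path_image g)"
    using assms(1,2) by (simp add: bounded_path_image)
  then obtain B where B: "\<And>z. z \<in> path_image f \<union> path_image g \<Longrightarrow> norm z \<le> B"
    by (auto simp: bounded_iff)
  define a b :: "real^2" where "a = vector [-B, 0]" and "b = vector [B, B]"
  have sub: "c z \<in> cbox a b" if "z \<in> path_image f \<union> path_image g" for z
    using B[OF that] assms(3)[OF that] abs_Re_le_cmod[of z] abs_Im_le_cmod[of z]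
    by (auto simp: mem_box_cart forall_2 c1 c2 a_def b_def)
  have "\<exists>z. z \<in> path_image (c \<circ> f) \<and> z \<in> path_image (c \<circ> g)"
    by (rule fashoda_interlace[of "c \<circ> f" "c \<circ> g" a b])
      (use assms sub in \<open>auto simp: path_continuous_image cc path_image_compose pathstart_compose
        pathfinish_compose c1 c2 a_def\<close>)
  then show ?thesis by (auto simp: path_image_compose inj)
qed

text \<open>Connectedness for a bare edge relation, so that unions and pieces of strings do not have
  to be made into graphs.\<close>

definition linked :: "('v \<times> 'v) set \<Rightarrow> 'v set \<Rightarrow> bool" where
  "linked E S \<longleftrightarrow> S \<noteq> {} \<and> (\<forall>x\<in>S. \<forall>y\<in>S. (x, y) \<in> (E \<inter> S \<times> S)\<^sup>*)"

definition drawn :: "('v \<Rightarrow> complex) \<Rightarrow> ('v \<times> 'v \<Rightarrow> real \<Rightarrow> complex) \<Rightarrow> ('v \<times> 'v) set \<Rightarrow> 'v set \<Rightarrow> complex set"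
  where "drawn pos \<gamma> E S = pos ` S \<union> (\<Union>e \<in> E \<inter> S \<times> S. path_image (\<gamma> e))"

lemma drawn_mono: "S \<subseteq> T \<Longrightarrow> drawn pos \<gamma> E S \<subseteq> drawn pos \<gamma> E T"
  unfolding drawn_def by blast

lemma path_connected_drawn:
  assumes "linked E S"
    and "\<And>u v. (u, v) \<in> E \<Longrightarrow> path (\<gamma> (u, v)) \<and> pathstart (\<gamma> (u, v)) = pos u \<and> pathfinish (\<gamma> (u, v)) = pos v"
  shows "path_connected (drawn pos \<gamma> E S)"
proof -
  let ?X = "drawn pos \<gamma> E S"
  have edge: "path_component ?X (pos u) z"
    if "(u, v) \<in> E \<inter> S \<times> S" "z \<in> path_image (\<gamma> (u, v))" for u v z
  proof -
    have "path_component (path_image (\<gamma> (u, v))) (pos u) z"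
      using assms(2)[of u v] that path_connected_path_image[of "\<gamma> (u, v)"] pathstart_in_path_image[of "\<gamma> (u, v)"]
      by (auto simp: path_connected_component)
    then show ?thesis
      by (rule path_component_of_subset[rotated]) (use that in \<open>auto simp: drawn_def\<close>)
  qed
  have step: "path_component ?X (pos x) (pos y)" if "(x, y) \<in> (E \<inter> S \<times> S)\<^sup>*" "x \<in> S" for x y
    using that
  proof (induction rule: rtrancl_induct)
    case base
    then show ?case by (auto simp: drawn_def path_component_refl)
  next
    case (step y z)
    have "path_component ?X (pos y) (pos z)"
      using edge[OF step(2), of "pos z"] assms(2)[of y z] step(2) pathfinish_in_path_image[of "\<gamma> (y, z)"] by auto
    then show ?case using step path_component_trans by blast
  qed
  obtain x0 where x0: "x0 \<in> S" using assms(1) by (auto simp: linked_def)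
  have all: "path_component ?X (pos x0) z" if "z \<in> ?X" for z
  proof -
    obtain u where u: "u \<in> S" "path_component ?X (pos u) z"
    proof (cases "z \<in> pos ` S")
      case True
      then show ?thesis using that path_component_refl[of z ?X] \<open>z \<in> ?X\<close> by blast
    next
      case False
      then show ?thesis using edge that \<open>z \<in> ?X\<close> unfolding drawn_def by fastforce
    qed
    then show ?thesis
      using step[of x0 u] assms(1) x0 path_component_trans by (metis linked_def)
  qed
  show ?thesis unfolding path_connected_component
    using all path_component_trans path_component_sym by blast
qed

lemma compact_drawn:
  assumes "finite E" "finite S" "\<And>e. e \<in> E \<Longrightarrow> path (\<gamma> e)"
  shows "compact (drawn pos \<gamma> E S)"
proof -
  have "compact (pos ` S)" using assms(2) by (simp add: finite_imp_compact)
  moreover have "compact (\<Union>e \<in> E \<inter> S \<times> S. path_image (\<gamma> e))"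
    using assms(1,3) by (intro compact_UN compact_path_image) auto
  ultimately show ?thesis unfolding drawn_def by (rule compact_Un)
qed

text \<open>The sign of the numerator shows that the Cayley transform with pole \<open>p\<close>
  sends the disc of radius \<open>norm p\<close> to the upper half-plane and its circle, except for
  \<open>p\<close>, to the real axis.\<close>

lemma Im_cayley: "Im (\<i> * (p + w) / (p - w)) = ((norm p)\<^sup>2 - (norm w)\<^sup>2) / (norm (p - w))\<^sup>2"
proof -
  have "\<i> * (p + w) / (p - w) = (\<i> * (p + w)) * cnj (p - w) / of_real ((norm (p - w))\<^sup>2)"
    unfolding complex_div_cnj[of "\<i> * (p + w)" "p - w"] of_real_power ..
  then have "Im (\<i> * (p + w) / (p - w)) = Im ((\<i> * (p + w)) * cnj (p - w)) / (norm (p - w))\<^sup>2"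
    by (simp only: Im_divide_of_real)
  also have "Im ((\<i> * (p + w)) * cnj (p - w)) = (norm p)\<^sup>2 - (norm w)\<^sup>2"
    unfolding cmod_power2 by (simp add: power2_eq_square algebra_simps)
  finally show ?thesis .
qed
lemma cayley_inj: 
  fixes p :: complex
  assumes "\<i> * (p + w) / (p - w) = \<i> * (p + w') / (p - w')" "w \<noteq> p" "w' \<noteq> p" "p \<noteq> 0"
  shows "w = w'"
proof -
  have "p - w \<noteq> 0" "p - w' \<noteq> 0" using assms by auto
  then have "(p + w) * (p - w') = (p + w') * (p - w)"
    using assms(1) unfolding frac_eq_eq[OF \<open>p - w \<noteq> 0\<close> \<open>p - w' \<noteq> 0\<close>] mult.assoc by simp
  then have "2 * (p * w) = 2 * (p * w')" unfolding ring_distribs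
    by (simp add: algebra_simps)
  then show ?thesis using assms(4) by simp
qed
lemma disjoint_of_inj_images:
  assumes "A \<subseteq> F ` X" "B \<subseteq> F ` Y" "inj_on F (X \<union> Y)" "X \<inter> Y = {}"
  shows "A \<inter> B = {}"
proof -
  have "F ` (X \<inter> Y) = F ` X \<inter> F ` Y"
    using inj_on_image_Int[OF assms(3), of X Y] by simp
  moreover have "A \<inter> B \<subseteq> F ` X \<inter> F ` Y" using assms(1,2) by (rule Int_mono)
  ultimately show ?thesis using assms(4) by simp
qed

lemma pair_graphD:
  assumes "pair_graph G"
  shows "finite (pverts G)" "finite (parcs G)" "(u, v) \<in> parcs G \<Longrightarrow> u \<in> pverts G"
    "(u, v) \<in> parcs G \<Longrightarrow> v \<in> pverts G" "(u, v) \<in> parcs G \<Longrightarrow> (v, u) \<in> parcs G"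
    "(u, v) \<in> parcs G \<Longrightarrow> u \<noteq> v"
proof -
  interpret pair_graph G by fact
  show "finite (pverts G)" "finite (parcs G)" by simp_all
  assume uv: "(u, v) \<in> parcs G"
  then show "u \<in> pverts G" by (rule in_arcsD1)
  from uv show "v \<in> pverts G" by (rule in_arcsD2)
  from uv show "(v, u) \<in> parcs G" by (rule arcs_symmetric)
  from uv show "u \<noteq> v" by (rule no_loops')
qed

text \<open>
  The complement of the drawing of \<open>U\<close> is mapped to a disc; every edge leaving \<open>U\<close> is cut where it
  first meets a circle slightly inside the unit circle, and the Cayley transform turns the cyclic
  order of these points on the circle into a linear one.
\<close>

lemma ground_order:
  fixes H :: "'v pair_pre_digraph"
  assumes H: "pair_graph H" "plane_drawing H pos \<gamma>"
    and U: "linked (parcs H) U" "U \<subseteq> pverts H"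
    and W: "linked (parcs H) W" "W \<subseteq> pverts H" "U \<inter> W = {}"
  obtains f :: "'v \<Rightarrow> real" where "inj_on f {k \<in> W. \<exists>h\<in>U. (k, h) \<in> parcs H}"
    "\<And>P Q a b c d. linked (parcs H) P \<Longrightarrow> linked (parcs H) Q \<Longrightarrow> P \<subseteq> W \<Longrightarrow> Q \<subseteq> W \<Longrightarrow> P \<inter> Q = {} \<Longrightarrow>
       a \<in> P \<Longrightarrow> b \<in> Q \<Longrightarrow> c \<in> P \<Longrightarrow> d \<in> Q \<Longrightarrow>
       \<forall>k\<in>{a, b, c, d}. \<exists>h\<in>U. (k, h) \<in> parcs H \<Longrightarrow> f a < f b \<Longrightarrow> f b < f c \<Longrightarrow> f c < f d \<Longrightarrow> False"
proof -
  note HD = pair_graphD[OF H(1)]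
  let ?V = "pverts H" and ?E = "parcs H"
  let ?dr = "drawn pos \<gamma> ?E"
  define B where "B = {k \<in> W. \<exists>h\<in>U. (k, h) \<in> ?E}"
  have inj: "inj_on pos ?V" using H(2) by (simp add: plane_drawing_def)
  have edges: "\<forall>(u, v) \<in> ?E. arc (\<gamma> (u, v)) \<and> pathstart (\<gamma> (u, v)) = pos u \<and>
      pathfinish (\<gamma> (u, v)) = pos v \<and> \<gamma> (v, u) = reversepath (\<gamma> (u, v)) \<and>
      path_image (\<gamma> (u, v)) \<inter> pos ` ?V = {pos u, pos v}"
    and meets: "\<forall>(u, v) \<in> ?E. \<forall>(x, y) \<in> ?E. {u, v} \<noteq> {x, y} \<longrightarrow>
      path_image (\<gamma> (u, v)) \<inter> path_image (\<gamma> (x, y)) \<subseteq> pos ` ({u, v} \<inter> {x, y})"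
    using H(2) unfolding plane_drawing_def by simp_all
  have edge: "arc (\<gamma> (u, v))" "pathstart (\<gamma> (u, v)) = pos u" "pathfinish (\<gamma> (u, v)) = pos v"
      "path_image (\<gamma> (u, v)) \<inter> pos ` ?V = {pos u, pos v}" if "(u, v) \<in> ?E" for u v
    using bspec[OF edges that] by simp_all
  have meet: "path_image (\<gamma> (u, v)) \<inter> path_image (\<gamma> (x, y)) \<subseteq> pos ` ({u, v} \<inter> {x, y})"
    if "(u, v) \<in> ?E" "(x, y) \<in> ?E" "{u, v} \<noteq> {x, y}" for u v x y
    using bspec[OF bspec[OF meets that(1), unfolded split_conv] that(2)] that(3) by simp
  have path: "path (\<gamma> e)" if "e \<in> ?E" for e
    using edge(1)[of "fst e" "snd e"] that by (simp add: arc_imp_path)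
  have finV: "finite S" if "S \<subseteq> ?V" for S using that HD(1) finite_subset by blast
  have pcdr: "path_connected (?dr S)" if "linked ?E S" for S
    using that edge path by (intro path_connected_drawn) auto
  have cpdr: "compact (?dr S)" if "S \<subseteq> ?V" for S
    using finV[OF that] path by (intro compact_drawn) (auto simp: HD(2))
  have pt_edge: "u = x \<or> u = y" if "pos u \<in> path_image (\<gamma> (x, y))" "(x, y) \<in> ?E" "u \<in> ?V" for u x y
  proof -
    have "pos u \<in> {pos x, pos y}" using edge(4)[OF that(2)] that(1,3) by auto
    moreover have "x \<in> ?V" "y \<in> ?V" using that(2) HD(3,4) by blast+
    ultimately show ?thesis using inj that(3) by (auto dest: inj_onD)
  qed
  have avoid: "z \<notin> ?dr S" if "z \<in> path_image (\<gamma> (x, y))" "(x, y) \<in> ?E" "S \<subseteq> ?V" "z \<notin> pos ` ({x, y} \<inter> S)"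
      "\<not> {x, y} \<subseteq> S" for z x y S
  proof
    assume "z \<in> ?dr S"
    then consider u where "u \<in> S" "z = pos u"
      | u v where "(u, v) \<in> ?E" "u \<in> S" "v \<in> S" "z \<in> path_image (\<gamma> (u, v))"
      unfolding drawn_def by auto
    then show False
    proof cases
      case 1
      have "u = x \<or> u = y" using pt_edge[of u x y] that(1,2,3) 1 by auto
      then show False using that(4) 1 by auto
    next
      case 2
      have "{u, v} \<noteq> {x, y}" using 2(2,3) that(5) by auto
      then have "z \<in> pos ` ({u, v} \<inter> {x, y})" using meet[OF 2(1) that(2)] 2(4) that(1) by blast
      then show False using 2(2,3) that(4) by auto
    qed
  qed
  have dr_disj: "?dr S \<inter> ?dr T = {}" if ST: "S \<subseteq> ?V" "T \<subseteq> ?V" "S \<inter> T = {}" for S T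
  proof -
    have "z \<notin> ?dr T" if "z \<in> ?dr S" for z
    proof -
      from that consider u where "u \<in> S" "z = pos u"
        | u v where "(u, v) \<in> ?E" "u \<in> S" "v \<in> S" "z \<in> path_image (\<gamma> (u, v))"
        unfolding drawn_def by auto
      then show ?thesis
      proof cases
        case 1
        then have u: "u \<in> ?V" "u \<notin> T" using ST by auto
        have "pos u \<notin> pos ` T" using inj_on_image_mem_iff[OF inj u(1) ST(2)] u(2) by simp
        moreover have "pos u \<notin> path_image (\<gamma> (x, y))" if "(x, y) \<in> ?E" "x \<in> T" "y \<in> T" for x y
          using pt_edge[OF _ that(1) u(1)] that(2,3) u(2) by auto
        ultimately show ?thesis using 1 unfolding drawn_def by auto
      next
        case 2
        moreover have "u \<notin> T" "v \<notin> T" using 2 ST(3) by auto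
        ultimately show ?thesis using ST(2) by (intro avoid[of z u v T]) auto
      qed
    qed
    then show ?thesis by blast
  qed
  define K where "K = ?dr U"
  obtain w0 where w0: "w0 \<in> W" using W(1) by (auto simp: linked_def)
  define n0 where "n0 = pos w0"
  define D where "D = connected_component_set (- K) n0"
  have KW: "K \<inter> ?dr W = {}" using dr_disj[of U W] U W by (simp add: K_def)
  have n0W: "n0 \<in> ?dr W" using w0 by (simp add: n0_def drawn_def)
  have K: "compact K" "path_connected K" "K \<noteq> {}" "n0 \<notin> K"
    using cpdr[OF U(2)] pcdr[OF U(1)] U(1) KW n0W by (auto simp: K_def drawn_def linked_def)
  obtain \<phi> :: "complex \<Rightarrow> complex" where \<phi>: "continuous_on D \<phi>" "inj_on \<phi> D" "\<phi> ` D \<subseteq> ball 0 1"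
      "\<And>r. r < 1 \<Longrightarrow> K \<inter> closure {z \<in> D. norm (\<phi> z) \<le> r} = {}"
    using disc_chart[OF K] unfolding D_def by blast
  have DK: "D \<subseteq> - K" by (simp add: D_def connected_component_subset)
  have WD: "?dr W \<subseteq> D"
    unfolding D_def using KW n0W pcdr[OF W(1)]
    by (intro connected_component_maximal path_connected_imp_connected) auto
  \<comment> \<open>The drawing of \<open>W\<close> is compact, so its image stays away from the
    unit circle. The annulus beyond it gives room to cut the edges that lead to
    \<open>U\<close>.\<close>
  obtain r where r: "r < 1" "0 < r" "\<And>z. z \<in> ?dr W \<Longrightarrow> norm (\<phi> z) < r"
  proof -
    have "continuous_on (?dr W) (\<lambda>z. norm (\<phi> z))"
      by (rule continuous_on_norm[OF continuous_on_subset[OF \<phi>(1) WD]])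
    then have "\<exists>z\<in>?dr W. \<forall>y\<in>?dr W. norm (\<phi> y) \<le> norm (\<phi> z)"
      using n0W by (intro continuous_attains_sup[OF cpdr[OF W(2)]]) auto
    then obtain z0 where z0: "z0 \<in> ?dr W" "\<And>z. z \<in> ?dr W \<Longrightarrow> norm (\<phi> z) \<le> norm (\<phi> z0)"
      by auto
    have "norm (\<phi> z0) < 1" using subsetD[OF \<phi>(3) imageI[OF subsetD[OF WD z0(1)]]] by simp
    define \<rho> where "\<rho> = (norm (\<phi> z0) + 1) / 2"
    have \<rho>: "0 < \<rho>" "\<rho> < 1" "norm (\<phi> z0) < \<rho>"
      using add_nonneg_pos[OF norm_ge_zero[of "\<phi> z0"] zero_less_one] \<open>norm (\<phi> z0) < 1\<close> unfolding \<rho>_def by (auto simp: field_simps)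
    show thesis using \<rho>(2,1) le_less_trans[OF z0(2) \<rho>(3)] by (rule that)
  qed
  \<comment> \<open>A vertex may have several edges to \<open>U\<close>; one of them is fixed and
    determines its position in the order.\<close>
  define h where "h k = (SOME h. h \<in> U \<and> (k, h) \<in> ?E)" for k
  define \<delta> where "\<delta> k = \<gamma> (k, h k)" for k
  have h: "h k \<in> U" "(k, h k) \<in> ?E" "k \<in> W" "k \<notin> U" "h k \<notin> W" if "k \<in> B" for k
    using that W(3) someI_ex[of "\<lambda>h. h \<in> U \<and> (k, h) \<in> ?E"] by (auto simp: B_def h_def)
  have \<delta>: "path (\<delta> k)" "\<delta> k 0 = pos k" "\<delta> k 1 = pos (h k)" "inj_on (\<delta> k) {0..1}"
    if "k \<in> B" for k
    using edge[OF h(2)[OF that]] by (auto simp: \<delta>_def arc_def pathstart_def pathfinish_def)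
  have \<delta>_not_end: "\<delta> k t \<noteq> pos (h k)" if "k \<in> B" "0 \<le> t" "t < 1" for k t
    using \<delta>[OF that(1)] that by (metis atLeastAtMost_iff inj_onD less_eq_real_def less_irrefl zero_less_one)
  have \<delta>_img: "\<delta> k t \<in> path_image (\<gamma> (k, h k))" if "0 \<le> t" "t \<le> 1" for k t
    using that by (auto simp: \<delta>_def path_image_def)
  have \<delta>K: "\<delta> k t \<notin> K" if k: "k \<in> B" and t: "0 \<le> t" "t < 1" for k t
    unfolding K_def using \<delta>_not_end[OF that] \<delta>_img[of t k] h[OF k] U(2) t
    by (intro avoid) auto
  have \<delta>_sub: "continuous_on {0..s} (\<delta> k)" if "k \<in> B" "s \<le> 1" for k s
    using \<delta>(1)[OF that(1)] that(2) unfolding path_def by (rule_tac continuous_on_subset) auto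
  have \<delta>D: "\<delta> k t \<in> D" if k: "k \<in> B" and t: "0 \<le> t" "t < 1" for k t
  proof -
    have "pos k \<in> D" using h(3)[OF k] WD by (auto simp: drawn_def)
    then have "D = connected_component_set (- K) (\<delta> k 0)"
      using connected_component_eq \<delta>(2)[OF k] unfolding D_def by metis
    moreover have "\<delta> k ` {0..t} \<subseteq> connected_component_set (- K) (\<delta> k 0)"
      using \<delta>K[OF k] t by (intro connected_component_maximal connected_continuous_image \<delta>_sub k) auto
    ultimately show ?thesis using t by (metis atLeastAtMost_iff imageI order_refl subsetD)
  qed
  have "\<exists>s. 0 < s \<and> s < 1 \<and> norm (\<phi> (\<delta> k s)) = r \<and> (\<forall>t. 0 \<le> t \<longrightarrow> t < s \<longrightarrow> norm (\<phi> (\<delta> k t)) < r)"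
    if k: "k \<in> B" for k
  proof -
    have "\<delta> k 1 \<in> K" using \<delta>(3)[OF k] h(1)[OF k] by (simp add: K_def drawn_def)
    moreover have "norm (\<phi> (\<delta> k 0)) < r" using \<delta>(2)[OF k] h(3)[OF k] by (intro r(3)) (auto simp: drawn_def)
    ultimately obtain s where "0 < s" "s < 1" "norm (\<phi> (\<delta> k s)) = r"
      "\<And>t. 0 \<le> t \<Longrightarrow> t < s \<Longrightarrow> norm (\<phi> (\<delta> k t)) < r"
      using first_exit[OF \<phi>(1) \<phi>(4)[OF r(1)] \<delta>(1)[OF k] \<delta>D[OF k]] by blast
    then show ?thesis by blast
  qed
  then obtain s where s: "\<And>k. k \<in> B \<Longrightarrow> 0 < s k" "\<And>k. k \<in> B \<Longrightarrow> s k < 1"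
      "\<And>k. k \<in> B \<Longrightarrow> norm (\<phi> (\<delta> k (s k))) = r"
      "\<And>k t. k \<in> B \<Longrightarrow> 0 \<le> t \<Longrightarrow> t < s k \<Longrightarrow> norm (\<phi> (\<delta> k t)) < r"
    by metis
  define q where "q k = \<phi> (\<delta> k (s k))" for k
  have finB: "finite B" using finV[OF W(2)] by (simp add: B_def)
  \<comment> \<open>The pole of the Cayley transform must lie on the circle and avoid the finitely
    many cut points.\<close>
  have "infinite (sphere (0::complex) r)"
  proof
    assume fin: "finite (sphere (0::complex) r)"
    have "Topological_Spaces.connected (sphere (0::complex) r)" by (simp add: connected_sphere)
    then have "sphere (0::complex) r = {} \<or> (\<exists>x. sphere (0::complex) r = {x})"
      using connected_finite_iff_sing fin by blast
    moreover have "of_real r \<in> sphere (0::complex) r" "- of_real r \<in> sphere (0::complex) r"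
      "of_real r \<noteq> - (of_real r :: complex)"
      using r(2) by (auto simp: complex_eq_iff)
    ultimately show False by (metis empty_iff singletonD)
  qed
  then obtain p where p: "norm p = r" "p \<notin> q ` B"
  proof -
    have "\<not> sphere (0::complex) r \<subseteq> q ` B"
      using \<open>infinite (sphere (0::complex) r)\<close> finite_subset finite_imageI[OF finB, of q] by blast
    then obtain p where "p \<in> sphere (0::complex) r" "p \<notin> q ` B" by blast
    then show thesis using that[of p] by simp
  qed
  define m where "m w = \<i> * (p + w) / (p - w)" for w :: complex
  have Im_m: "Im (m w) = (r\<^sup>2 - (norm w)\<^sup>2) / (norm (p - w))\<^sup>2" for w
    unfolding m_def Im_cayley p(1) ..
  have m_inj: "w = w'" if "m w = m w'" "w \<noteq> p" "w' \<noteq> p" for w w'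
    using cayley_inj[of p w w'] that p(1) r(2) unfolding m_def by fastforce
  define stem where "stem k = \<delta> k ` {0..s k}" for k
  have stemD: "stem k \<subseteq> D" if "k \<in> B" for k
    using \<delta>D[OF that] s(2)[OF that] by (auto simp: stem_def)
  have stem_pc: "path_connected (stem k)" if "k \<in> B" for k
    unfolding stem_def using s(2)[OF that]
    by (intro path_connected_continuous_image \<delta>_sub that) auto
  have stem_le: "norm (\<phi> z) \<le> r \<and> \<phi> z \<noteq> p" if k: "k \<in> B" and z: "z \<in> stem k" for k z
  proof -
    obtain t where t: "z = \<delta> k t" "0 \<le> t" "t \<le> s k" using z by (auto simp: stem_def)
    show ?thesis
    proof (cases "t = s k")
      case True
      then show ?thesis using s(3)[OF k] p(2) k t by (auto simp: q_def)
    next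
      case False
      then have "norm (\<phi> z) < r" using s(4)[OF k t(2)] t by simp
      then show ?thesis using p(1) by auto
    qed
  qed
  \<comment> \<open>The chosen edges of two vertices can share only an end in \<open>U\<close>,
    which lies on \<open>K\<close>, and stems stop before they reach \<open>K\<close>.\<close>
  have stem_disj: "stem k \<inter> stem k' = {}" if k: "k \<in> B" "k' \<in> B" "k \<noteq> k'" for k k'
  proof -
    have False if z: "z \<in> stem k" "z \<in> stem k'" for z
    proof -
      have z1: "z \<in> path_image (\<gamma> (k, h k))" "z \<in> path_image (\<gamma> (k', h k'))"
        using z \<delta>_img[of _ k] \<delta>_img[of _ k'] s(2)[OF k(1)] s(2)[OF k(2)]
        unfolding stem_def by fastforce+
      have "{k, h k} \<noteq> {k', h k'}" using h[OF k(1)] h[OF k(2)] k(3) by (auto simp: doubleton_eq_iff)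
      then have "z \<in> pos ` ({k, h k} \<inter> {k', h k'})"
        using meet[OF h(2)[OF k(1)] h(2)[OF k(2)]] z1 by blast
      then have "z \<in> pos ` U" using h[OF k(1)] h[OF k(2)] k(3) by auto
      then have "z \<in> K" by (simp add: K_def drawn_def)
      then show False using stemD[OF k(1)] z DK by blast
    qed
    then show ?thesis by blast
  qed
  have stem_drawn: "stem k \<inter> ?dr S = {}" if k: "k \<in> B" "k \<notin> S" "S \<subseteq> W" for k S
  proof -
    have "z \<notin> ?dr S" if z: "z \<in> stem k" for z
    proof -
      have "z \<in> path_image (\<gamma> (k, h k))" using z \<delta>_img s(2)[OF k(1)] by (auto simp: stem_def)
      then show ?thesis using avoid[OF _ h(2)[OF k(1)], of z S] h[OF k(1)] k W(2) by blast
    qed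
    then show ?thesis by blast
  qed
  define f where "f k = Re (m (q k))" for k
  have Imq: "Im (m (q k)) = 0" if "k \<in> B" for k using s(3)[OF that] by (simp add: Im_m q_def)
  have q_stem: "\<delta> k (s k) \<in> stem k" "\<delta> k 0 \<in> stem k" if "k \<in> B" for k
    using s(1)[OF that] by (auto simp: stem_def)
  show thesis
  proof (rule that[of f], unfold B_def[symmetric])
    show "inj_on f B"
    proof (rule inj_onI, rule ccontr)
      fix k k' assume k: "k \<in> B" "k' \<in> B" "f k = f k'" "k \<noteq> k'"
      have "m (q k) = m (q k')" using k Imq by (intro complex_eqI) (auto simp: f_def)
      then have "q k = q k'" using m_inj p(2) k by blast
      then have "\<delta> k (s k) = \<delta> k' (s k')"
        using \<phi>(2) q_stem(1) k stemD unfolding q_def by (meson inj_onD subsetD)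
      then show False using stem_disj[OF k(1,2,4)] q_stem(1) k by (metis disjoint_iff)
    qed
    fix P Q a b c d
    assume PQ: "linked ?E P" "linked ?E Q" "P \<subseteq> W" "Q \<subseteq> W" "P \<inter> Q = {}"
      and abcd: "a \<in> P" "b \<in> Q" "c \<in> P" "d \<in> Q"
      and nb: "\<forall>k\<in>{a, b, c, d}. \<exists>h\<in>U. (k, h) \<in> ?E"
      and lt: "f a < f b" "f b < f c" "f c < f d"
    have inB: "a \<in> B" "b \<in> B" "c \<in> B" "d \<in> B" using nb abcd PQ by (auto simp: B_def)
    \<comment> \<open>The drawing of \<open>S\<close> with two stems attached is path connected. Its
      image lies in the closed upper half-plane and contains both cut points on the axis, so
      \<open>half_plane_interlace\<close> becomes applicable to two disjoint such sets.\<close>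
    have *: "\<exists>g. path g \<and> path_image g \<subseteq> (\<lambda>z. m (\<phi> z)) ` (?dr S \<union> stem k \<union> stem k') \<and>
        pathstart g = m (q k) \<and> pathfinish g = m (q k') \<and> (\<forall>z\<in>path_image g. 0 \<le> Im z)"
      and **: "\<forall>z \<in> ?dr S \<union> stem k \<union> stem k'. z \<in> D \<and> \<phi> z \<noteq> p"
      if S: "linked ?E S" "S \<subseteq> W" and k: "k \<in> S" "k' \<in> S" "k \<in> B" "k' \<in> B" for S k k'
    proof -
      let ?X = "?dr S \<union> stem k \<union> stem k'"
      have SW: "?dr S \<subseteq> ?dr W" using S(2) by (rule drawn_mono)
      have XD: "?X \<subseteq> D" using SW WD stemD k by blast
      have X: "norm (\<phi> z) \<le> r \<and> \<phi> z \<noteq> p" if "z \<in> ?X" for z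
      proof (cases "z \<in> ?dr S")
        case True
        then have "norm (\<phi> z) < r" using SW r(3) by blast
        then show ?thesis using p(1) by auto
      next
        case False
        then show ?thesis using that stem_le[OF k(3)] stem_le[OF k(4)] by blast
      qed
      show "\<forall>z \<in> ?X. z \<in> D \<and> \<phi> z \<noteq> p"
      proof (intro ballI conjI)
        fix z assume z: "z \<in> ?X"
        show "z \<in> D" using XD z by (rule subsetD)
        show "\<phi> z \<noteq> p" using X[OF z] by (rule conjunct2)
      qed
      have foot: "pos i \<in> ?dr S" "pos i \<in> stem i" if "i \<in> S" "i \<in> B" for i
        using that(1) q_stem(2)[OF that(2)] unfolding \<delta>(2)[OF that(2)] drawn_def by simp_all
      have pc1: "path_connected (?dr S \<union> stem k)"
        using foot[OF k(1,3)] by (intro path_connected_Un pcdr[OF S(1)] stem_pc[OF k(3)]) (rule notI, simp add: disjoint_iff)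
      have "path_connected ?X"
        using foot[OF k(2,4)] by (intro path_connected_Un[OF pc1] stem_pc[OF k(4)]) (rule notI, simp add: disjoint_iff)
      moreover have "continuous_on ?X (\<lambda>z. m (\<phi> z))"
        unfolding m_def using X continuous_on_subset[OF \<phi>(1) XD] by (intro continuous_intros) auto
      ultimately have pcX: "path_connected ((\<lambda>z. m (\<phi> z)) ` ?X)"
        by (rule path_connected_continuous_image[rotated])
      have mem: "m (q k) \<in> (\<lambda>z. m (\<phi> z)) ` ?X" "m (q k') \<in> (\<lambda>z. m (\<phi> z)) ` ?X"
        using q_stem(1) k unfolding q_def by blast+
      have Im_ge: "0 \<le> Im z" if "z \<in> (\<lambda>z. m (\<phi> z)) ` ?X" for z
        using that X by (auto simp: Im_m intro!: divide_nonneg_nonneg power_mono)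
      from bspec[OF bspec[OF pcX[unfolded path_connected_def] mem(1)] mem(2)]
      obtain g where "path g" "path_image g \<subseteq> (\<lambda>z. m (\<phi> z)) ` ?X"
        "pathstart g = m (q k)" "pathfinish g = m (q k')" by (elim exE conjE)
      then show "\<exists>g. path g \<and> path_image g \<subseteq> (\<lambda>z. m (\<phi> z)) ` ?X \<and>
        pathstart g = m (q k) \<and> pathfinish g = m (q k') \<and> (\<forall>z\<in>path_image g. 0 \<le> Im z)"
        using Im_ge by (intro exI[of _ g] conjI ballI) (auto dest: subsetD)
    qed
    from *[OF PQ(1,3) abcd(1,3) inB(1,3)]
    obtain g where g: "path g" "path_image g \<subseteq> (\<lambda>z. m (\<phi> z)) ` (?dr P \<union> stem a \<union> stem c)"
      "pathstart g = m (q a)" "pathfinish g = m (q c)" "\<forall>z\<in>path_image g. 0 \<le> Im z"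
      by (elim exE conjE)
    from *[OF PQ(2,4) abcd(2,4) inB(2,4)]
    obtain g' where g': "path g'" "path_image g' \<subseteq> (\<lambda>z. m (\<phi> z)) ` (?dr Q \<union> stem b \<union> stem d)"
      "pathstart g' = m (q b)" "pathfinish g' = m (q d)" "\<forall>z\<in>path_image g'. 0 \<le> Im z"
      by (elim exE conjE)
    let ?X = "?dr P \<union> stem a \<union> stem c" and ?Y = "?dr Q \<union> stem b \<union> stem d"
    have "inj_on (\<lambda>z. m (\<phi> z)) (?X \<union> ?Y)"
    proof (rule inj_onI)
      fix x y assume xy: "x \<in> ?X \<union> ?Y" "y \<in> ?X \<union> ?Y" "m (\<phi> x) = m (\<phi> y)"
      have "z \<in> D \<and> \<phi> z \<noteq> p" if "z \<in> ?X \<union> ?Y" for z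
      proof (cases "z \<in> ?X")
        case True
        then show ?thesis by (rule bspec[OF **[OF PQ(1,3) abcd(1,3) inB(1,3)]])
      next
        case False
        then have "z \<in> ?Y" using that by simp
        then show ?thesis by (rule bspec[OF **[OF PQ(2,4) abcd(2,4) inB(2,4)]])
      qed
      then have "x \<in> D" "\<phi> x \<noteq> p" "y \<in> D" "\<phi> y \<noteq> p" using xy(1,2) by blast+
      then show "x = y" using m_inj[OF xy(3)] inj_onD[OF \<phi>(2)] by blast
    qed
    moreover have "?X \<inter> ?Y = {}"
    proof -
      have "a \<notin> Q" "c \<notin> Q" "b \<notin> P" "d \<notin> P" "a \<noteq> b" "a \<noteq> d" "c \<noteq> b" "c \<noteq> d"
        using abcd PQ(5) by blast+
      then have "stem a \<inter> ?dr Q = {}" "stem c \<inter> ?dr Q = {}" "stem b \<inter> ?dr P = {}" "stem d \<inter> ?dr P = {}"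
        "stem a \<inter> stem b = {}" "stem a \<inter> stem d = {}" "stem c \<inter> stem b = {}" "stem c \<inter> stem d = {}"
        using stem_disj stem_drawn inB PQ(3,4) by simp_all
      moreover have "?dr P \<inter> ?dr Q = {}" using dr_disj[of P Q] PQ W(2) by blast
      ultimately show ?thesis by blast
    qed
    ultimately have "path_image g \<inter> path_image g' = {}"
      by (rule disjoint_of_inj_images[OF g(2) g'(2)])
    moreover have "path_image g \<inter> path_image g' \<noteq> {}"
    proof (intro half_plane_interlace[OF g(1) g'(1)])
      show "0 \<le> Im z" if "z \<in> path_image g \<union> path_image g'" for z
        using that g(5) g'(5) by blast
    next
      show "Im (pathstart g) = 0" "Im (pathfinish g) = 0" "Im (pathstart g') = 0" "Im (pathfinish g') = 0"
        unfolding g(3,4) g'(3,4) by (fact Imq[OF inB(1)] Imq[OF inB(2)] Imq[OF inB(3)] Imq[OF inB(4)])+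
      show "Re (pathstart g) < Re (pathstart g')" "Re (pathstart g') < Re (pathfinish g)"
        "Re (pathfinish g) < Re (pathfinish g')"
        unfolding g(3,4) g'(3,4) using lt unfolding f_def .
    qed
    ultimately show False by contradiction
  qed
qed

section \<open>Independent sets in graphs without short odd closed walks\<close>

definition indep :: "('a \<times> 'a) set \<Rightarrow> 'a set \<Rightarrow> bool" where
  "indep R I \<longleftrightarrow> (\<forall>x\<in>I. \<forall>y\<in>I. (x, y) \<notin> R)"

text \<open>\<open>c\<close> is the reciprocal of the guaranteed fraction, so that successive losses
  multiply.\<close>

definition thick :: "('a \<times> 'a) set \<Rightarrow> nat \<Rightarrow> 'a set \<Rightarrow> bool" where
  "thick R c X \<longleftrightarrow> (\<exists>I\<subseteq>X. indep R I \<and> card X \<le> c * card I)"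

text \<open>Closed walks instead of cycles: they arise by concatenation without any care for
  repeated vertices, and homomorphisms preserve them.\<close>

definition no_short_odd :: "nat \<Rightarrow> ('a \<times> 'a) set \<Rightarrow> bool" where
  "no_short_odd N R \<longleftrightarrow> (\<forall>n x. odd n \<longrightarrow> n \<le> N \<longrightarrow> (x, x) \<notin> R ^^ n)"

lemma thick_of_indep: "indep R X \<Longrightarrow> 1 \<le> c \<Longrightarrow> thick R c X"
  unfolding thick_def by (intro exI[of _ X]) auto

lemma thick_two_colours:
  assumes fin: "finite X"
    and col: "\<And>x y. x \<in> X \<Longrightarrow> y \<in> X \<Longrightarrow> (x, y) \<in> R \<Longrightarrow> col x \<noteq> (col y :: bool)"
  shows "thick R 2 X"
proof -
  let ?J = "\<lambda>b. {x \<in> X. col x = b}"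
  have ind: "indep R (?J b)" for b using col by (fastforce simp: indep_def)
  have "card X = card (?J True) + card (?J False)"
    using fin by (subst card_Un_disjoint[symmetric]) (auto intro: arg_cong[where f = card])
  then have "card X \<le> 2 * card (?J True) \<or> card X \<le> 2 * card (?J False)" by linarith
  then obtain b where "card X \<le> 2 * card (?J b)" by (elim disjE)
  then show ?thesis unfolding thick_def using ind[of b] by (intro exI[of _ "?J b"]) simp
qed

text \<open>The fibres will be the levels of a breadth first search, where an edge joins equal or
  consecutive levels. Different fibres of the same parity are not adjacent, so the independent sets
  chosen in them can be united; taking the better parity costs the factor 2.\<close>

lemma thick_fibres:
  assumes fin: "finite X"
    and edges: "\<And>x y. x \<in> X \<Longrightarrow> y \<in> X \<Longrightarrow> (x, y) \<in> R \<Longrightarrow> \<kappa> x = \<kappa> y \<or> par (\<kappa> x) \<noteq> (par (\<kappa> y) :: bool)"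
    and fib: "\<And>b. b \<in> \<kappa> ` X \<Longrightarrow> thick R c {x \<in> X. \<kappa> x = b}"
  shows "thick R (2 * c) X"
proof -
  define I where "I b = (SOME I. I \<subseteq> {x \<in> X. \<kappa> x = b} \<and> indep R I \<and> card {x \<in> X. \<kappa> x = b} \<le> c * card I)" for b
  have I: "I b \<subseteq> {x \<in> X. \<kappa> x = b}" "indep R (I b)" "card {x \<in> X. \<kappa> x = b} \<le> c * card (I b)"
    if "b \<in> \<kappa> ` X" for b
    using someI_ex[OF fib[OF that, unfolded thick_def]] unfolding I_def by blast+
  define K where "K q = {b \<in> \<kappa> ` X. par b = q}" for q
  define J where "J q = (\<Union>b\<in>K q. I b)" for q
  have finK: "finite (K q)" for q using fin by (simp add: K_def)
  have finI: "finite (I b)" if "b \<in> \<kappa> ` X" for b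
    using I(1)[OF that] fin finite_subset by fastforce
  have sub: "J q \<subseteq> X" for q using I(1) unfolding J_def K_def by blast
  have ind: "indep R (J q)" for q
    unfolding indep_def
  proof (intro ballI notI)
    fix x y assume xy: "x \<in> J q" "y \<in> J q" "(x, y) \<in> R"
    obtain b where b: "b \<in> K q" "x \<in> I b" using xy unfolding J_def by blast
    obtain b' where b': "b' \<in> K q" "y \<in> I b'" using xy unfolding J_def by blast
    have bb: "b \<in> \<kappa> ` X" "b' \<in> \<kappa> ` X" "par b = par b'" using b b' by (auto simp: K_def)
    have "x \<in> X" "\<kappa> x = b" "y \<in> X" "\<kappa> y = b'" using I(1)[OF bb(1)] I(1)[OF bb(2)] b b' by auto
    then have "b = b'" using edges[of x y] xy(3) bb(3) by auto
    then show False using I(2)[OF bb(1)] b b' xy(3) by (auto simp: indep_def)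
  qed
  have cJ: "card (J q) = (\<Sum>b\<in>K q. card (I b))" for q
    unfolding J_def
  proof (rule card_UN_disjoint[OF finK])
    show "\<forall>i\<in>K q. finite (I i)" using finI by (auto simp: K_def)
    have "I i \<inter> I j = {}" if "i \<in> \<kappa> ` X" "j \<in> \<kappa> ` X" "i \<noteq> j" for i j
      using I(1)[OF that(1)] I(1)[OF that(2)] that(3) by fastforce
    then show "\<forall>i\<in>K q. \<forall>j\<in>K q. i \<noteq> j \<longrightarrow> I i \<inter> I j = {}" by (auto simp: K_def)
  qed
  have "card X = (\<Sum>b\<in>\<kappa> ` X. card {x \<in> X. \<kappa> x = b})"
    using sum_card_image card_eq_sum sum.image_gen[OF fin, of "\<lambda>_. 1::nat" \<kappa>] by simp
  also have "\<dots> \<le> (\<Sum>b\<in>\<kappa> ` X. c * card (I b))" by (intro sum_mono I(3))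
  also have "\<dots> = c * (\<Sum>b\<in>\<kappa> ` X. card (I b))" by (simp add: sum_distrib_left)
  also have "(\<Sum>b\<in>\<kappa> ` X. card (I b)) = (\<Sum>b\<in>K True \<union> K False. card (I b))"
    by (rule sum.cong) (auto simp: K_def)
  also have "\<dots> = card (J True) + card (J False)"
    unfolding cJ by (rule sum.union_disjoint[OF finK finK]) (auto simp: K_def)
  finally have le: "card X \<le> c * card (J True) + c * card (J False)" by (simp add: distrib_left)
  then have "card X \<le> 2 * c * card (J True) \<or> card X \<le> 2 * c * card (J False)" by linarith
  then obtain q where "card X \<le> 2 * c * card (J q)" by (elim disjE)
  then show ?thesis unfolding thick_def using sub[of q] ind[of q] by (intro exI[of _ "J q"]) simp
qed

section \<open>Walks and breadth first levels\<close>

lemma relpow_sym: "sym R \<Longrightarrow> (x, y) \<in> R ^^ n \<Longrightarrow> (y, x) \<in> R ^^ n"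
proof (induction n arbitrary: y)
  case (Suc n)
  then obtain z where "(x, z) \<in> R ^^ n" "(z, y) \<in> R" by auto
  then have "(z, x) \<in> R ^^ n" "(y, z) \<in> R" using Suc by (auto dest: symD)
  then show ?case by (rule relpow_Suc_I2[rotated])
qed simp

lemma relpow_trans: "(x, y) \<in> R ^^ m \<Longrightarrow> (y, z) \<in> R ^^ n \<Longrightarrow> (x, z) \<in> R ^^ (m + n)"
  by (auto simp: relpow_add)

lemma relpow_map:
  assumes "\<And>s t. (s, t) \<in> Q \<Longrightarrow> (h s, h t) \<in> R" "(s, t) \<in> Q ^^ n"
  shows "(h s, h t) \<in> R ^^ n"
  using assms(2) by (induction n arbitrary: t) (auto intro: assms(1))

lemma no_short_odd_map:
  assumes "no_short_odd N R" "\<And>s t. (s, t) \<in> Q \<Longrightarrow> (h s, h t) \<in> R"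
  shows "no_short_odd N Q"
  using assms(1) relpow_map[of Q h R] assms(2) unfolding no_short_odd_def by blast

lemma breadth_first:
  assumes sym: "sym R"
    and rt: "\<And>x. (rt x, x) \<in> R\<^sup>*" "\<And>x y. (x, y) \<in> R \<Longrightarrow> rt x = rt y"
  obtains d :: "'a \<Rightarrow> nat" where "\<And>x. (rt x, x) \<in> R ^^ d x"
    "\<And>x y. (x, y) \<in> R \<Longrightarrow> d y \<le> Suc (d x)"
    "\<And>x n. d x = Suc n \<Longrightarrow> \<exists>y. (x, y) \<in> R \<and> d y = n"
    "\<And>x. d x = 0 \<Longrightarrow> x = rt x"
proof -
  define d where "d x = (LEAST n. (rt x, x) \<in> R ^^ n)" for x
  have ex: "\<exists>n. (rt x, x) \<in> R ^^ n" for x using rt(1)[of x] by (simp add: rtrancl_power)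
  have d1: "(rt x, x) \<in> R ^^ d x" for x unfolding d_def by (rule LeastI_ex[OF ex])
  have d_le: "d x \<le> n" if "(rt x, x) \<in> R ^^ n" for x n unfolding d_def using that by (rule Least_le)
  have d2: "d y \<le> Suc (d x)" if "(x, y) \<in> R" for x y
    using d1[of x] that rt(2)[OF that] by (intro d_le) auto
  have d3: "\<exists>y. (x, y) \<in> R \<and> d y = n" if n: "d x = Suc n" for x n
  proof -
    obtain y where y: "(rt x, y) \<in> R ^^ n" "(y, x) \<in> R" using d1[of x] n by auto
    then have "d y \<le> n" using rt(2)[OF y(2)] by (intro d_le) simp
    moreover have "Suc n \<le> Suc (d y)" using d2[OF y(2)] n by simp
    ultimately show ?thesis using y(2) sym by (auto dest: symD)
  qed
  have d4: "x = rt x" if "d x = 0" for x using d1[of x] that by simp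
  show thesis using that[of d] d1 d2 d3 d4 by blast
qed

lemma component_eq:
  assumes "sym R" "(x, y) \<in> R"
  shows "{z. (x, z) \<in> R\<^sup>*} = {z. (y, z) \<in> R\<^sup>*}"
  using assms by (auto intro: converse_rtrancl_into_rtrancl dest: symD)

text \<open>
  Blocks of the real line: the next block ends at the far end of the edge that reaches furthest to
  the right out of the blocks already chosen. The pair \<open>u i\<close>, \<open>v i\<close> is that edge, or a single
  vertex if no edge leaves these blocks.
\<close>

lemma chain_blocks:
  fixes \<pi> :: "'a \<Rightarrow> real"
  assumes fin: "finite X"
  obtains \<iota> :: "'a \<Rightarrow> nat" and u v :: "nat \<Rightarrow> 'a" where
    "\<And>x. x \<in> X \<Longrightarrow> u (\<iota> x) \<in> X" "\<And>x. x \<in> X \<Longrightarrow> v (\<iota> x) \<in> X"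
    "\<And>x. x \<in> X \<Longrightarrow> u (\<iota> x) = v (\<iota> x) \<or> (u (\<iota> x), v (\<iota> x)) \<in> R"
    "\<And>x. x \<in> X \<Longrightarrow> \<pi> (u (\<iota> x)) \<le> \<pi> x" "\<And>x. x \<in> X \<Longrightarrow> \<pi> x \<le> \<pi> (v (\<iota> x))"
    "\<And>x. x \<in> X \<Longrightarrow> \<iota> (v (\<iota> x)) = \<iota> x"
    "\<And>x y. x \<in> X \<Longrightarrow> y \<in> X \<Longrightarrow> \<pi> x \<le> \<pi> y \<Longrightarrow> \<iota> x \<le> \<iota> y"
    "\<And>x y. x \<in> X \<Longrightarrow> y \<in> X \<Longrightarrow> (x, y) \<in> R \<Longrightarrow> \<iota> y \<le> Suc (\<iota> x)"
proof -
  define S where "S t = {x \<in> X. t < \<pi> x}" for t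
  \<comment> \<open>The induction is over the part of the line to the right of \<open>t\<close>. The
    last clause, that edges coming from the left of \<open>t\<close> end in block 0, is what bounds
    the difference of block numbers along an edge once a further block is put in front.\<close>
  define good where "good t \<iota> u v \<longleftrightarrow>
      (\<forall>x\<in>S t. u (\<iota> x) \<in> X \<and> v (\<iota> x) \<in> S t \<and> (u (\<iota> x) = v (\<iota> x) \<or> (u (\<iota> x), v (\<iota> x)) \<in> R) \<and>
         \<pi> (u (\<iota> x)) \<le> \<pi> x \<and> \<pi> x \<le> \<pi> (v (\<iota> x)) \<and> \<iota> (v (\<iota> x)) = \<iota> x) \<and>
      (\<forall>x\<in>S t. \<forall>y\<in>S t. \<pi> x \<le> \<pi> y \<longrightarrow> \<iota> x \<le> \<iota> y) \<and>
      (\<forall>x\<in>S t. \<forall>y\<in>S t. (x, y) \<in> R \<longrightarrow> \<iota> y \<le> Suc (\<iota> x)) \<and>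
      (\<forall>x\<in>X. \<forall>y\<in>S t. (x, y) \<in> R \<longrightarrow> \<pi> x \<le> t \<longrightarrow> \<iota> y = 0)"
    for t and \<iota> :: "'a \<Rightarrow> nat" and u v :: "nat \<Rightarrow> 'a"
  have finS: "finite (S t)" for t using fin by (simp add: S_def)
  have "\<exists>\<iota> u v. good t \<iota> u v" for t
  proof (induction "card (S t)" arbitrary: t rule: less_induct)
    case less
    show ?case
    proof (cases "S t = {}")
      case True
      then show ?thesis unfolding good_def by simp
    next
      case False
      \<comment> \<open>The far ends of edges that jump over \<open>t\<close>. The rightmost of them
        closes the block; if there are none, the block consists of the vertices at the least
        remaining position.\<close>
      define C where "C = {y \<in> S t. \<exists>x\<in>X. (x, y) \<in> R \<and> \<pi> x \<le> t}"
      have finC: "finite C" using finS by (simp add: C_def)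
      obtain u0 v0 where uv: "v0 \<in> S t" "u0 \<in> X" "u0 = v0 \<or> (u0, v0) \<in> R"
        "\<And>x. x \<in> S t \<Longrightarrow> \<pi> x \<le> \<pi> v0 \<Longrightarrow> \<pi> u0 \<le> \<pi> x" "\<And>y. y \<in> C \<Longrightarrow> \<pi> y \<le> \<pi> v0"
      proof (cases "C = {}")
        case True
        obtain v0 where v0: "v0 \<in> S t" "\<And>x. x \<in> S t \<Longrightarrow> \<pi> v0 \<le> \<pi> x"
          using arg_min_if_finite[OF finS False, of \<pi>] by (metis linorder_not_le)
        then show thesis using that[of v0 v0] True by (auto simp: S_def)
      next
        case False
        obtain v0 where v0: "v0 \<in> C" "\<And>y. y \<in> C \<Longrightarrow> \<pi> y \<le> \<pi> v0"
        proof -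
          have "Max (\<pi> ` C) \<in> \<pi> ` C" using finC False by simp
          then obtain v0 where "v0 \<in> C" "\<pi> v0 = Max (\<pi> ` C)" by auto
          then show thesis using that[of v0] finC by auto
        qed
        then obtain u0 where "u0 \<in> X" "(u0, v0) \<in> R" "\<pi> u0 \<le> t" by (auto simp: C_def)
        then show thesis using that[of v0 u0] v0 by (force simp: C_def S_def)
      qed
      define s where "s = \<pi> v0"
      have ts: "t < s" using uv(1) by (simp add: S_def s_def)
      have Ss: "S s \<subseteq> S t" using ts by (auto simp: S_def)
      have "v0 \<notin> S s" by (simp add: S_def s_def)
      then have "card (S s) < card (S t)" using uv(1) Ss by (intro psubset_card_mono finS) auto
      then obtain \<iota>' u' v' where IH: "good s \<iota>' u' v'" using less by blast
      define \<iota> where "\<iota> x = (if \<pi> x \<le> s then 0 else Suc (\<iota>' x))" for x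
      define u where "u = case_nat u0 u'"
      define v where "v = case_nat v0 v'"
      have St: "x \<in> S t \<Longrightarrow> \<not> \<pi> x \<le> s \<Longrightarrow> x \<in> S s" for x by (simp add: S_def)
      have "good t \<iota> u v"
        unfolding good_def
      proof (intro conjI)
        show "\<forall>x\<in>S t. u (\<iota> x) \<in> X \<and> v (\<iota> x) \<in> S t \<and> (u (\<iota> x) = v (\<iota> x) \<or> (u (\<iota> x), v (\<iota> x)) \<in> R) \<and>
         \<pi> (u (\<iota> x)) \<le> \<pi> x \<and> \<pi> x \<le> \<pi> (v (\<iota> x)) \<and> \<iota> (v (\<iota> x)) = \<iota> x"
        proof
          fix x assume x: "x \<in> S t"
          show "u (\<iota> x) \<in> X \<and> v (\<iota> x) \<in> S t \<and> (u (\<iota> x) = v (\<iota> x) \<or> (u (\<iota> x), v (\<iota> x)) \<in> R) \<and>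
         \<pi> (u (\<iota> x)) \<le> \<pi> x \<and> \<pi> x \<le> \<pi> (v (\<iota> x)) \<and> \<iota> (v (\<iota> x)) = \<iota> x"
          proof (cases "\<pi> x \<le> s")
            case True
            then show ?thesis using uv x by (simp add: \<iota>_def u_def v_def s_def)
          next
            case False
            then have xs: "x \<in> S s" using x St by blast
            then have *: "u' (\<iota>' x) \<in> X \<and> v' (\<iota>' x) \<in> S s \<and> (u' (\<iota>' x) = v' (\<iota>' x) \<or> (u' (\<iota>' x), v' (\<iota>' x)) \<in> R) \<and>
              \<pi> (u' (\<iota>' x)) \<le> \<pi> x \<and> \<pi> x \<le> \<pi> (v' (\<iota>' x)) \<and> \<iota>' (v' (\<iota>' x)) = \<iota>' x"
              using IH unfolding good_def by blast
            then have "v' (\<iota>' x) \<in> S t" "\<not> \<pi> (v' (\<iota>' x)) \<le> s" using Ss by (auto simp: S_def)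
            then show ?thesis using * False by (simp add: \<iota>_def u_def v_def)
          qed
        qed
        show "\<forall>x\<in>S t. \<forall>y\<in>S t. \<pi> x \<le> \<pi> y \<longrightarrow> \<iota> x \<le> \<iota> y"
          using IH St unfolding good_def \<iota>_def by force
        show "\<forall>x\<in>S t. \<forall>y\<in>S t. (x, y) \<in> R \<longrightarrow> \<iota> y \<le> Suc (\<iota> x)"
        proof (intro ballI impI)
          fix x y assume xy: "x \<in> S t" "y \<in> S t" "(x, y) \<in> R"
          have "x \<in> X" using xy by (simp add: S_def)
          show "\<iota> y \<le> Suc (\<iota> x)"
          proof (cases "\<pi> y \<le> s")
            case False
            then have y: "y \<in> S s" using St xy by blast
            show ?thesis
            proof (cases "\<pi> x \<le> s")
              case True
              then have "\<iota>' y = 0" using IH y xy \<open>x \<in> X\<close> unfolding good_def by blast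
              then show ?thesis by (simp add: \<iota>_def)
            next
              case x: False
              then have "x \<in> S s" using St xy by blast
              then have "\<iota>' y \<le> Suc (\<iota>' x)" using IH y xy unfolding good_def by blast
              then show ?thesis using x by (simp add: \<iota>_def)
            qed
          qed (simp add: \<iota>_def)
        qed
        show "\<forall>x\<in>X. \<forall>y\<in>S t. (x, y) \<in> R \<longrightarrow> \<pi> x \<le> t \<longrightarrow> \<iota> y = 0"
          using uv(5) by (auto simp: C_def \<iota>_def s_def)
      qed
      then show ?thesis by blast
    qed
  qed
  then obtain \<iota> u v where *: "good (Min (\<pi> ` X) - 1) \<iota> u v" by blast
  have "S (Min (\<pi> ` X) - 1) = X"
  proof -
    have "Min (\<pi> ` X) - 1 < \<pi> x" if "x \<in> X" for x
    proof -
      have "Min (\<pi> ` X) \<le> \<pi> x" using fin that by simp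
      then show ?thesis by linarith
    qed
    then show ?thesis by (auto simp: S_def)
  qed
  note * = *[unfolded good_def this]
  show thesis
  proof (rule that[of u \<iota> v])
    fix x assume "x \<in> X"
    then show "u (\<iota> x) \<in> X" "v (\<iota> x) \<in> X" "u (\<iota> x) = v (\<iota> x) \<or> (u (\<iota> x), v (\<iota> x)) \<in> R"
      "\<pi> (u (\<iota> x)) \<le> \<pi> x" "\<pi> x \<le> \<pi> (v (\<iota> x))" "\<iota> (v (\<iota> x)) = \<iota> x"
      using * by blast+
  next
    fix x y assume "x \<in> X" "y \<in> X"
    then show "\<pi> x \<le> \<pi> y \<Longrightarrow> \<iota> x \<le> \<iota> y" "(x, y) \<in> R \<Longrightarrow> \<iota> y \<le> Suc (\<iota> x)"
      using * by blast+
  qed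
qed

text \<open>
  Blocks in every third position are kept in full, together with parts of the two blocks in between
  that are not adjacent to each other. Six choices of these parts cover every vertex four times.
\<close>

lemma thick_three_of_blocks:
  fixes \<iota> :: "'a \<Rightarrow> nat" and con :: "nat \<Rightarrow> 'a \<Rightarrow> bool" and col :: "nat \<Rightarrow> 'a \<Rightarrow> bool"
  assumes fin: "finite X" and sym: "sym R"
    and step: "\<And>x y. x \<in> X \<Longrightarrow> y \<in> X \<Longrightarrow> (x, y) \<in> R \<Longrightarrow> \<iota> y \<le> Suc (\<iota> x)"
    and col: "\<And>i x y. x \<in> X \<Longrightarrow> y \<in> X \<Longrightarrow> (x, y) \<in> R \<Longrightarrow> con i x \<Longrightarrow> con i y \<Longrightarrow> col i x \<noteq> col i y"
    and con0: "\<And>x. x \<in> X \<Longrightarrow> con (\<iota> x) x"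
    and con1: "\<And>x y. x \<in> X \<Longrightarrow> y \<in> X \<Longrightarrow> (x, y) \<in> R \<Longrightarrow> \<iota> x \<noteq> \<iota> y \<Longrightarrow> con (\<iota> x) y"
    and con2: "\<And>x y z. x \<in> X \<Longrightarrow> y \<in> X \<Longrightarrow> z \<in> X \<Longrightarrow> (x, y) \<in> R \<Longrightarrow> (y, z) \<in> R \<Longrightarrow>
      \<iota> x \<noteq> \<iota> y \<Longrightarrow> con (\<iota> x) z"
  shows "thick R 3 X"
proof -
  define L where "L x \<longleftrightarrow> (\<exists>y\<in>X. (x, y) \<in> R \<and> \<iota> x = Suc (\<iota> y))" for x
  define L' where "L' x \<longleftrightarrow> \<not> L x \<and> (\<exists>y\<in>X. (x, y) \<in> R \<and> \<iota> y = \<iota> x \<and> L y)" for x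
  define Q where "Q x \<longleftrightarrow> (\<exists>y\<in>X. (x, y) \<in> R \<and> \<iota> y = Suc (\<iota> x))" for x
  define Q' where "Q' x \<longleftrightarrow> \<not> Q x \<and> (\<exists>y\<in>X. (x, y) \<in> R \<and> \<iota> y = \<iota> x \<and> Q y)" for x
  define r where "r s x = (\<iota> x + s) mod 3" for s x
  \<comment> \<open>Blocks with \<open>r s x = 0\<close> are full. In the block after a full one,
    \<open>b\<close> decides between keeping just the layers \<open>L\<close> and \<open>L'\<close>
    next to it and keeping all except \<open>L'\<close>, whose removal separates \<open>L\<close>
    from the rest. The block before a full one is treated symmetrically with \<open>Q\<close> and
    \<open>Q'\<close>. Dropping \<open>Q\<close> when \<open>r s x = 1\<close> destroys all edges
    between the two partial blocks.\<close>
  define keep where "keep s b x \<longleftrightarrow> r s x = 0 \<or>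
      (r s x = 1 \<and> \<not> Q x \<and> (if b then L x \<or> L' x else \<not> L' x)) \<or>
      (r s x = 2 \<and> (if b then Q x \<or> Q' x else \<not> Q' x))" for s :: nat and b x
  \<comment> \<open>The block whose colouring is applied to \<open>x\<close>: a layer attached to a
    full block is coloured with that block, any other vertex with its own block. Adjacent kept
    vertices always agree on it, which is the content of \<open>same\<close> and
    \<open>next_\<close>.\<close>
  define ctr where "ctr s b x =
      (if r s x = 1 \<and> (L x \<or> b \<and> L' x) then \<iota> x - 1
       else if r s x = 2 \<and> (Q x \<or> b \<and> Q' x) then Suc (\<iota> x) else \<iota> x)" for s :: nat and b x
  define K where "K p = {x \<in> X. keep (fst p) (snd p) x}" for p
  have R_sym: "(y, x) \<in> R" if "(x, y) \<in> R" for x y using sym that by (rule symD)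
  have conL: "con (\<iota> x - 1) x" if x: "x \<in> X" "L x \<or> L' x" for x
    using x(2)
  proof
    assume "L x"
    then obtain y where "y \<in> X" "(x, y) \<in> R" "\<iota> x = Suc (\<iota> y)" by (auto simp: L_def)
    then show ?thesis using con1[of y x] x(1) R_sym by simp
  next
    assume "L' x"
    then obtain y where y: "y \<in> X" "(x, y) \<in> R" "\<iota> y = \<iota> x" "L y" by (auto simp: L'_def)
    then obtain z where "z \<in> X" "(y, z) \<in> R" "\<iota> y = Suc (\<iota> z)" by (auto simp: L_def)
    then show ?thesis using con2[of z y x] x(1) y R_sym by simp
  qed
  have conQ: "con (Suc (\<iota> x)) x" if x: "x \<in> X" "Q x \<or> Q' x" for x
    using x(2)
  proof
    assume "Q x"
    then obtain y where "y \<in> X" "(x, y) \<in> R" "\<iota> y = Suc (\<iota> x)" by (auto simp: Q_def)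
    then show ?thesis using con1[of y x] x(1) R_sym by simp
  next
    assume "Q' x"
    then obtain y where y: "y \<in> X" "(x, y) \<in> R" "\<iota> y = \<iota> x" "Q y" by (auto simp: Q'_def)
    then obtain z where "z \<in> X" "(y, z) \<in> R" "\<iota> z = Suc (\<iota> y)" by (auto simp: Q_def)
    then show ?thesis using con2[of z y x] x(1) y R_sym by simp
  qed
  have con_ctr: "con (ctr s b x) x" if "x \<in> X" for s b x
    using con0[OF that] conL[OF that] conQ[OF that] by (auto simp: ctr_def)
  have same: "ctr s b x = ctr s b y"
    if xy: "x \<in> X" "y \<in> X" "(x, y) \<in> R" "\<iota> x = \<iota> y" and kp: "keep s b x" "keep s b y" for s b x y
  proof -
    have LL: "L x \<Longrightarrow> L y \<or> L' y" "L y \<Longrightarrow> L x \<or> L' x" and QQ: "Q x \<Longrightarrow> Q y \<or> Q' y" "Q y \<Longrightarrow> Q x \<or> Q' x"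
      using xy R_sym[OF xy(3)] unfolding L'_def Q'_def by auto
    have rr: "r s x = r s y" using xy(4) by (simp add: r_def)
    have exc: "L x \<Longrightarrow> \<not> L' x" "L y \<Longrightarrow> \<not> L' y" "Q x \<Longrightarrow> \<not> Q' x" "Q y \<Longrightarrow> \<not> Q' y"
      by (simp_all add: L'_def Q'_def)
    have "(r s x = 1 \<and> (L x \<or> b \<and> L' x)) = (r s y = 1 \<and> (L y \<or> b \<and> L' y))"
      using kp LL rr exc unfolding keep_def by (cases b) auto
    moreover have "(r s x = 2 \<and> (Q x \<or> b \<and> Q' x)) = (r s y = 2 \<and> (Q y \<or> b \<and> Q' y))"
      using kp QQ rr exc unfolding keep_def by (cases b) auto
    ultimately show ?thesis unfolding ctr_def by (simp only: xy(4))
  qed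
  have next_: "ctr s b x = ctr s b y"
    if xy: "x \<in> X" "y \<in> X" "(x, y) \<in> R" "\<iota> y = Suc (\<iota> x)" and kp: "keep s b x" "keep s b y" for s b x y
  proof -
    have LQ: "Q x" "L y" using xy R_sym[OF xy(3)] unfolding Q_def L_def by auto
    have "(r s x = 0 \<and> r s y = 1) \<or> (r s x = 1 \<and> r s y = 2) \<or> (r s x = 2 \<and> r s y = 0)"
      unfolding r_def xy(4) by presburger
    then show ?thesis
    proof (elim disjE)
      assume "r s x = 1 \<and> r s y = 2"
      then show ?thesis using kp LQ unfolding keep_def by auto
    qed (use LQ xy(4) in \<open>simp_all add: ctr_def\<close>)
  qed
  have thK: "thick R 2 (K p)" for p
  proof (rule thick_two_colours[where col = "\<lambda>x. col (ctr (fst p) (snd p) x) x"])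
    show "finite (K p)" using fin by (simp add: K_def)
    fix x y assume xy: "x \<in> K p" "y \<in> K p" "(x, y) \<in> R"
    then have X: "x \<in> X" "y \<in> X" "keep (fst p) (snd p) x" "keep (fst p) (snd p) y" by (auto simp: K_def)
    have "\<iota> y \<le> Suc (\<iota> x)" "\<iota> x \<le> Suc (\<iota> y)" using step X(1,2) xy(3) R_sym by auto
    then consider "\<iota> x = \<iota> y" | "\<iota> y = Suc (\<iota> x)" | "\<iota> x = Suc (\<iota> y)" by linarith
    then have "ctr (fst p) (snd p) x = ctr (fst p) (snd p) y"
    proof cases
      case 1
      then show ?thesis using same X xy(3) by blast
    next
      case 2
      then show ?thesis using next_ X xy(3) by blast
    next
      case 3
      then show ?thesis using next_[of y x] X R_sym[OF xy(3)] by simp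
    qed
    then show "col (ctr (fst p) (snd p) x) x \<noteq> col (ctr (fst p) (snd p) y) y"
      using col[OF X(1,2) xy(3)] con_ctr X(1,2) by metis
  qed
  let ?I = "{0, 1, 2 :: nat} \<times> (UNIV :: bool set)"
  \<comment> \<open>A vertex counts twice for the shift that makes its block full. The other two
    shifts together contribute at least two more: a vertex of \<open>Q\<close> counts twice when its
    residue is 2, and any other vertex counts at least once for each of the two residues.\<close>
  have cover: "4 \<le> (\<Sum>p\<in>?I. of_bool (keep (fst p) (snd p) x) :: nat)" for x
  proof -
    have "(\<Sum>p\<in>?I. of_bool (keep (fst p) (snd p) x) :: nat) =
       (\<Sum>s\<in>{0, 1, 2}. \<Sum>b\<in>UNIV. of_bool (keep s b x))"
      unfolding sum.cartesian_product by (rule sum.cong) auto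
    then have 1: "(\<Sum>p\<in>?I. of_bool (keep (fst p) (snd p) x) :: nat) =
       (\<Sum>s\<in>{0, 1, 2}. of_bool (keep s True x) + of_bool (keep s False x))"
      by (simp only: UNIV_bool) (simp add: add.commute)
    have 2: "of_bool (keep s True x) + of_bool (keep s False x) = (2::nat)" if "r s x = 0" for s
      using that by (simp add: keep_def)
    have 3: "of_bool (keep s True x) + of_bool (keep s False x) + (of_bool (keep s' True x) + of_bool (keep s' False x)) \<ge> (2::nat)"
      if "r s x = 1" "r s' x = 2" for s s'
      using that by (cases "Q x"; cases "L x"; cases "L' x"; cases "Q' x") (simp_all add: keep_def L'_def Q'_def)
    have "\<iota> x mod 3 = 0 \<or> \<iota> x mod 3 = 1 \<or> \<iota> x mod 3 = 2" by auto
    then have "(r 0 x = 0 \<and> r 1 x = 1 \<and> r 2 x = 2) \<or> (r 0 x = 1 \<and> r 1 x = 2 \<and> r 2 x = 0) \<or> (r 0 x = 2 \<and> r 1 x = 0 \<and> r 2 x = 1)"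
      unfolding r_def by presburger
    then show ?thesis unfolding 1
      using 2[of 0] 2[of 1] 2[of 2] 3[of 0 1] 3[of 0 2] 3[of 1 0] 3[of 1 2] 3[of 2 0] 3[of 2 1]
      by (elim disjE conjE) (simp_all add: add.assoc)
  qed
  have "4 * card X = (\<Sum>x\<in>X. 4)" by simp
  also have "\<dots> \<le> (\<Sum>x\<in>X. \<Sum>p\<in>?I. of_bool (keep (fst p) (snd p) x))" by (intro sum_mono cover)
  also have "\<dots> = (\<Sum>p\<in>?I. \<Sum>x\<in>X. of_bool (keep (fst p) (snd p) x))" by (rule sum.swap)
  also have "\<dots> = (\<Sum>p\<in>?I. card (K p))"
    using fin by (intro sum.cong refl) (simp add: K_def sum.If_cases of_bool_def Int_def)
  finally have total: "4 * card X \<le> (\<Sum>p\<in>?I. card (K p))" .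
  \<comment> \<open>By averaging, one of the six choices keeps two thirds of \<open>X\<close>; the
    larger of its two colour classes is then at least a third.\<close>
  have "\<exists>p\<in>?I. 4 * card X \<le> 6 * card (K p)"
  proof (rule ccontr)
    assume "\<not> ?thesis"
    then have lt: "6 * card (K p) < 4 * card X" if "p \<in> ?I" for p using that by (meson not_le)
    have "(\<Sum>p\<in>?I. 6 * card (K p)) < (\<Sum>p\<in>?I. 4 * card X)"
      by (rule sum_strict_mono) (use lt in auto)
    also have "(\<Sum>p\<in>?I. 4 * card X) = 6 * (4 * card X)" by (simp add: card_cartesian_product)
    finally show False using total unfolding sum_distrib_left[symmetric] by linarith
  qed
  then obtain p where p: "4 * card X \<le> 6 * card (K p)" by blast
  obtain I where I: "I \<subseteq> K p" "indep R I" "card (K p) \<le> 2 * card I"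
    using thK[of p] unfolding thick_def by blast
  show ?thesis unfolding thick_def
    using I p by (intro exI[of _ I]) (auto simp: K_def)
qed

text \<open>The colour of \<open>x\<close> is the parity of \<open>k + n\<close> for some walk of
  length \<open>n\<close> from \<open>x\<close> to the vertex number \<open>k\<close> of fence
  \<open>i\<close>. If the ends of an edge had the same colour, their walks, the stretch of the
  fence between them and the edge would form an odd closed walk that is too short. The choice of the
  walk is therefore irrelevant on edges.\<close>

lemma contact_colouring:
  assumes sym: "sym R" and odd: "no_short_odd 11 R"
    and \<omega>: "\<And>i k k'. valid i k \<Longrightarrow> valid i k' \<Longrightarrow> k \<le> k' \<Longrightarrow> k' \<le> k + 3 \<and> (\<omega> i k, \<omega> i k') \<in> R ^^ (k' - k)"
  obtains col :: "nat \<Rightarrow> 'a \<Rightarrow> bool" where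
    "\<And>i x y. (x, y) \<in> R \<Longrightarrow> \<exists>k n. n \<le> 4 \<and> valid i k \<and> (x, \<omega> i k) \<in> R ^^ n \<Longrightarrow>
       \<exists>k n. n \<le> 4 \<and> valid i k \<and> (y, \<omega> i k) \<in> R ^^ n \<Longrightarrow> col i x \<noteq> col i y"
proof -
  define C where "C i x p \<longleftrightarrow> snd p \<le> 4 \<and> valid i (fst p) \<and> (x, \<omega> i (fst p)) \<in> R ^^ snd p" for i x p
  define q where "q i x = (SOME p. C i x p)" for i x
  define col where "col i x = even (fst (q i x) + snd (q i x))" for i x
  have q: "C i x (q i x)" if "\<exists>k n. n \<le> 4 \<and> valid i k \<and> (x, \<omega> i k) \<in> R ^^ n" for i x
    unfolding q_def by (rule someI_ex) (use that in \<open>auto simp: C_def\<close>)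
  have odd_le: "odd N \<Longrightarrow> N \<le> 12 \<Longrightarrow> N \<le> 11" for N :: nat by presburger
  have no: False if xy: "(x, y) \<in> R" and C: "C i x (k, n)" "C i y (k', n')" and le: "k \<le> k'"
    and par: "even (k + n) = even (k' + n')" for i x y k n k' n'
  proof -
    have w: "k' \<le> k + 3" "(\<omega> i k, \<omega> i k') \<in> R ^^ (k' - k)" using \<omega>[of i k k'] C le by (auto simp: C_def)
    have "(x, \<omega> i k) \<in> R ^^ n" "(\<omega> i k', y) \<in> R ^^ n'" "(y, x) \<in> R ^^ 1"
      using C xy sym by (auto simp: C_def intro: relpow_sym dest: symD)
    then have "(x, x) \<in> R ^^ (n + (k' - k) + n' + 1)" using w(2) by (blast intro: relpow_trans)
    moreover have "odd (n + (k' - k) + n' + 1)" using par le by (simp add: even_diff_nat) blast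
    moreover have "n + (k' - k) + n' + 1 \<le> 12" using C w(1) by (auto simp: C_def)
    ultimately have "n + (k' - k) + n' + 1 \<le> 11"
      using odd_le[of "n + (k' - k) + n' + 1"] by blast
    then show False using odd \<open>odd (n + (k' - k) + n' + 1)\<close> \<open>(x, x) \<in> R ^^ (n + (k' - k) + n' + 1)\<close>
      unfolding no_short_odd_def by blast
  qed
  show thesis
  proof (rule that[of col])
    fix i x y assume xy: "(x, y) \<in> R" and ex: "\<exists>k n. n \<le> 4 \<and> valid i k \<and> (x, \<omega> i k) \<in> R ^^ n"
       "\<exists>k n. n \<le> 4 \<and> valid i k \<and> (y, \<omega> i k) \<in> R ^^ n"
    have C: "C i x (fst (q i x), snd (q i x))" "C i y (fst (q i y), snd (q i y))"
      using q[OF ex(1)] q[OF ex(2)] by simp_all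
    have yx: "(y, x) \<in> R" using sym xy by (rule symD)
    show "col i x \<noteq> col i y"
    proof
      assume "col i x = col i y"
      then have par: "even (fst (q i x) + snd (q i x)) = even (fst (q i y) + snd (q i y))" by (simp add: col_def)
      show False
      proof (cases "fst (q i x) \<le> fst (q i y)")
        case True
        then show ?thesis using no[OF xy C(1,2) _ par] by blast
      next
        case False
        then show ?thesis using no[OF yx C(2,1) _ par[symmetric]] by simp
      qed
    qed
  qed
qed

section \<open>String graphs\<close>

lemma linked_UN:
  assumes sym: "sym E" and t0: "t0 \<in> I" and l: "\<And>t. t \<in> I \<Longrightarrow> linked E (F t)"
    and reach: "\<And>t. t \<in> I \<Longrightarrow> (t0, t) \<in> {(s, t). s \<in> I \<and> t \<in> I \<and> F s \<inter> F t \<noteq> {}}\<^sup>*"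
  shows "linked E (\<Union>t\<in>I. F t)"
proof -
  let ?U = "\<Union>t\<in>I. F t"
  let ?E = "E \<inter> ?U \<times> ?U"
  have symE: "sym (?E\<^sup>*)" using sym by (intro sym_rtrancl) (auto simp: sym_def)
  have inside: "(x, y) \<in> ?E\<^sup>*" if "t \<in> I" "x \<in> F t" "y \<in> F t" for t x y
  proof -
    have "(x, y) \<in> (E \<inter> F t \<times> F t)\<^sup>*" using l[OF that(1)] that by (auto simp: linked_def)
    moreover have "E \<inter> F t \<times> F t \<subseteq> ?E" using that(1) by blast
    ultimately show ?thesis using rtrancl_mono by blast
  qed
  obtain x0 where x0: "x0 \<in> F t0" using l[OF t0] by (auto simp: linked_def)
  have all: "\<forall>y\<in>F t. (x0, y) \<in> ?E\<^sup>*" if "t \<in> I" for t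
    using reach[OF that]
  proof (induction rule: rtrancl_induct)
    case base
    then show ?case using inside[OF t0 x0] by blast
  next
    case (step s t)
    then obtain z where z: "z \<in> F s" "z \<in> F t" "t \<in> I" by auto
    show ?case
    proof
      fix y assume "y \<in> F t"
      then have "(z, y) \<in> ?E\<^sup>*" using inside z by blast
      moreover have "(x0, z) \<in> ?E\<^sup>*" using step.IH z(1) by blast
      ultimately show "(x0, y) \<in> ?E\<^sup>*" by (rule rtrancl_trans[rotated])
    qed
  qed
  have "(x, y) \<in> ?E\<^sup>*" if "x \<in> ?U" "y \<in> ?U" for x y
  proof -
    have "(x0, x) \<in> ?E\<^sup>*" "(x0, y) \<in> ?E\<^sup>*" using all that by blast+
    then show ?thesis using symE by (meson rtrancl_trans symD)
  qed
  then show ?thesis using x0 t0 unfolding linked_def by blast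
qed

lemma linked_Un:
  assumes "sym E" "linked E S" "linked E T" "S \<inter> T \<noteq> {}"
  shows "linked E (S \<union> T)"
proof -
  have "linked E (\<Union>b\<in>UNIV. if b then S else T)"
  proof (rule linked_UN[OF assms(1), of True])
    fix t :: bool
    show "linked E (if t then S else T)" using assms(2,3) by simp
    show "(True, t) \<in> {(s, t). s \<in> UNIV \<and> t \<in> UNIV \<and> (if s then S else T) \<inter> (if t then S else T) \<noteq> {}}\<^sup>*"
      using assms(4) by (cases t) (auto intro!: r_into_rtrancl)
  qed simp
  then show ?thesis by (simp add: UNIV_bool Un_commute)
qed

text \<open>
  A connected family of sets \<open>F t\<close>, some of which (those in \<open>A\<close>) touch a common ground. The order in
  which they touch it is given by \<open>f\<close>; disjoint connected unions do not interlace along the ground.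
\<close>

locale grounded_family =
  fixes R :: "('t \<times> 't) set" and E :: "('h \<times> 'h) set" and F :: "'t \<Rightarrow> 'h set" and C A :: "'t set"
    and foot :: "'t \<Rightarrow> 'h" and f :: "'h \<Rightarrow> real" and r0 :: 't and d :: "'t \<Rightarrow> nat"
    and j :: nat and X :: "'t set" and a :: "'t \<Rightarrow> 't"
  assumes sym_R: "sym R" and sym_E: "sym E" and odd: "no_short_odd 11 R"
    and closed: "\<And>s t. s \<in> C \<Longrightarrow> (s, t) \<in> R \<Longrightarrow> t \<in> C"
    and meet: "\<And>s t. s \<in> C \<Longrightarrow> t \<in> C \<Longrightarrow> F s \<inter> F t \<noteq> {} \<Longrightarrow> s = t \<or> (s, t) \<in> R"
    and meet': "\<And>s t. (s, t) \<in> R \<Longrightarrow> F s \<inter> F t \<noteq> {}"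
    and linked_F: "\<And>t. t \<in> C \<Longrightarrow> linked E (F t)"
    and foot: "\<And>t. t \<in> C \<inter> A \<Longrightarrow> foot t \<in> F t"
    and f_inj: "\<And>s t. s \<in> C \<inter> A \<Longrightarrow> t \<in> C \<inter> A \<Longrightarrow> f (foot s) = f (foot t) \<Longrightarrow> foot s = foot t"
    and no_interlace: "\<And>P Q p q p' q'. P \<subseteq> C \<Longrightarrow> Q \<subseteq> C \<Longrightarrow> linked E (\<Union>t\<in>P. F t) \<Longrightarrow> linked E (\<Union>t\<in>Q. F t) \<Longrightarrow>
      (\<Union>t\<in>P. F t) \<inter> (\<Union>t\<in>Q. F t) = {} \<Longrightarrow> p \<in> P \<inter> A \<Longrightarrow> q \<in> Q \<inter> A \<Longrightarrow> p' \<in> P \<inter> A \<Longrightarrow> q' \<in> Q \<inter> A \<Longrightarrow>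
      f (foot p) < f (foot q) \<Longrightarrow> f (foot q) < f (foot p') \<Longrightarrow> f (foot p') < f (foot q') \<Longrightarrow> False"
    and r0: "r0 \<in> C \<inter> A" "\<And>t. t \<in> C \<inter> A \<Longrightarrow> f (foot r0) \<le> f (foot t)"
    and d_step: "\<And>x y. (x, y) \<in> R \<Longrightarrow> d y \<le> Suc (d x)"
    and d_Suc: "\<And>x n. x \<in> C \<Longrightarrow> d x = Suc n \<Longrightarrow> \<exists>y. (x, y) \<in> R \<and> d y = n"
    and d_0: "\<And>x. x \<in> C \<Longrightarrow> d x = 0 \<Longrightarrow> x = r0"
    and X: "finite X" "\<And>x. x \<in> X \<Longrightarrow> x \<in> C" "\<And>x. x \<in> X \<Longrightarrow> d x = j"
    and a: "\<And>x. x \<in> X \<Longrightarrow> (x, a x) \<in> R" "\<And>x. x \<in> X \<Longrightarrow> a x \<in> A"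
begin

text \<open>A member of the level need not touch the ground itself; it takes the position of its
  chosen grounded neighbour.\<close>

definition \<pi> :: "'t \<Rightarrow> real" where "\<pi> x = f (foot (a x))"

definition fence :: "'t \<Rightarrow> 't \<Rightarrow> 't set" where "fence u v = {a u, u, v, a v}"

text \<open>The degenerate case \<open>u = v\<close> belongs to blocks that no edge enters from the
  left.\<close>

definition anchor :: "'t \<Rightarrow> 't \<Rightarrow> bool" where "anchor u v \<longleftrightarrow> u \<in> X \<and> v \<in> X \<and> (u = v \<or> (u, v) \<in> R)"

lemma R_sym: "(x, y) \<in> R \<Longrightarrow> (y, x) \<in> R"
  using sym_R by (rule symD)

lemma aC: "x \<in> X \<Longrightarrow> a x \<in> C \<inter> A"
  using closed[OF X(2) a(1)] a(2) by blast

lemma F_a: "x \<in> X \<Longrightarrow> F (a x) \<inter> F x \<noteq> {}"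
  using meet'[OF a(1)] by (simp add: Int_commute)

lemma fence_sub: "anchor u v \<Longrightarrow> fence u v \<subseteq> C"
  using aC X(2) by (auto simp: fence_def anchor_def)

lemma linked_pair:
  assumes "x \<in> X" shows "linked E (F (a x) \<union> F x)"
  using assms aC[OF assms] X(2)[OF assms] F_a[OF assms] by (intro linked_Un sym_E linked_F) auto

lemma F_edge:
  assumes "u = v \<or> (u, v) \<in> R" "u \<in> C"
  shows "F u \<inter> F v \<noteq> {}"
  using assms meet'[of u v] linked_F[of u] by (auto simp: linked_def)

lemma linked_fence:
  assumes "anchor u v" shows "linked E (\<Union>t\<in>fence u v. F t)"
proof -
  have uv: "u \<in> X" "v \<in> X" "u = v \<or> (u, v) \<in> R" using assms by (auto simp: anchor_def)
  have "linked E ((F (a u) \<union> F u) \<union> (F (a v) \<union> F v))"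
    using F_edge[OF uv(3) X(2)[OF uv(1)]]
    by (intro linked_Un[OF sym_E linked_pair[OF uv(1)] linked_pair[OF uv(2)]]) blast
  moreover have "(\<Union>t\<in>fence u v. F t) = (F (a u) \<union> F u) \<union> (F (a v) \<union> F v)" by (auto simp: fence_def)
  ultimately show ?thesis by simp
qed

lemma fence_level:
  assumes "anchor u v" "w \<in> fence u v" shows "j \<le> Suc (d w)"
proof -
  have "j \<le> Suc (d (a x))" if "x \<in> X" for x
    using d_step[OF R_sym[OF a(1)[OF that]]] X(3)[OF that] by simp
  then show ?thesis using assms X(3) by (auto simp: fence_def anchor_def)
qed

lemma touch:
  assumes "s \<in> C" "t \<in> C" "F s \<inter> F t \<noteq> {}" "(x, s) \<in> R ^^ n" "n \<le> m"
  shows "\<exists>i\<le>Suc m. (x, t) \<in> R ^^ i"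
proof -
  have "(x, t) \<in> R ^^ n \<or> (x, t) \<in> R ^^ Suc n"
    using meet[OF assms(1-3)] assms(4) by (auto intro: relpow_Suc_I)
  then show ?thesis
  proof
    assume "(x, t) \<in> R ^^ n"
    then show ?thesis using assms(5) by (intro exI[of _ n]) simp
  next
    assume "(x, t) \<in> R ^^ Suc n"
    then show ?thesis using assms(5) by (intro exI[of _ "Suc n"]) simp
  qed
qed

text \<open>Read backwards: disjoint strings have feet at different positions. This makes the weak
  inequalities strict where \<open>no_interlace\<close> is applied.\<close>

lemma same_foot:
  assumes "s \<in> C \<inter> A" "t \<in> C \<inter> A" "f (foot s) = f (foot t)"
  shows "F s \<inter> F t \<noteq> {}"
  using f_inj[OF assms] foot[OF assms(1)] foot[OF assms(2)] by auto

lemma ancestors: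
  assumes "x \<in> C"
  obtains g where "g 0 = x" "g (d x) = r0" "\<And>m. m \<le> d x \<Longrightarrow> g m \<in> C \<and> d (g m) = d x - m"
    "\<And>m. m < d x \<Longrightarrow> (g m, g (Suc m)) \<in> R" "\<And>m. m \<le> d x \<Longrightarrow> (x, g m) \<in> R ^^ m"
proof -
  have "\<exists>g. g 0 = x \<and> g (d x) = r0 \<and> (\<forall>m\<le>d x. g m \<in> C \<and> d (g m) = d x - m) \<and>
     (\<forall>m<d x. (g m, g (Suc m)) \<in> R)"
    using assms
  proof (induction "d x" arbitrary: x)
    case 0
    then have "x = r0" using d_0 by simp
    then show ?case using 0 by (intro exI[of _ "\<lambda>_. x"]) auto
  next
    case (Suc n)
    obtain y where y: "(x, y) \<in> R" "d y = n" using d_Suc[OF Suc(3), of n] Suc(2) by auto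
    have yC: "y \<in> C" using closed[OF Suc(3) y(1)] .
    obtain g where g: "g 0 = y" "g (d y) = r0" "\<forall>m\<le>d y. g m \<in> C \<and> d (g m) = d y - m"
      "\<forall>m<d y. (g m, g (Suc m)) \<in> R" using Suc(1)[of y] y(2) yC by blast
    have dx: "d x = Suc (d y)" using Suc(2) y(2) by simp
    show ?case
      by (rule exI[of _ "case_nat x g"], unfold dx)
        (use g y dx Suc(3) in \<open>auto split: nat.splits\<close>)
  qed
  then obtain g where g: "g 0 = x" "g (d x) = r0" "\<forall>m\<le>d x. g m \<in> C \<and> d (g m) = d x - m"
     "\<forall>m<d x. (g m, g (Suc m)) \<in> R" by blast
  have "(x, g m) \<in> R ^^ m" if "m \<le> d x" for m
    using that
  proof (induction m)
    case (Suc m)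
    then show ?case using g(4) by (auto intro: relpow_Suc_I)
  qed (simp add: g(1))
  then show thesis using that[of g] g by blast
qed

text \<open>The path from \<open>x\<close> to \<open>r0\<close> together with \<open>a x\<close> has
  a foot at or left of the fence, because \<open>r0\<close> comes first along the ground, and a foot
  under the fence. If it avoided the fence, the feet of \<open>r0\<close>, \<open>a u\<close>,
  \<open>a x\<close>, \<open>a v\<close> would interlace. As the fence lives in levels from
  \<open>j - 1\<close> on, the path can touch it only within its first two steps.\<close>

lemma contact_under:
  assumes uv: "anchor u v" and x: "x \<in> X" and le: "\<pi> u \<le> \<pi> x" "\<pi> x \<le> \<pi> v"
  shows "\<exists>w\<in>fence u v. \<exists>n\<le>3. (x, w) \<in> R ^^ n"
proof -
  have uvX: "u \<in> X" "v \<in> X" using uv by (auto simp: anchor_def)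
  have xC: "x \<in> C" using X(2)[OF x] .
  obtain g where g: "g 0 = x" "g j = r0" "\<And>m. m \<le> j \<Longrightarrow> g m \<in> C \<and> d (g m) = j - m"
    "\<And>m. m < j \<Longrightarrow> (g m, g (Suc m)) \<in> R" "\<And>m. m \<le> j \<Longrightarrow> (x, g m) \<in> R ^^ m"
    using ancestors[OF xC, unfolded X(3)[OF x]] by blast
  define Q where "Q = insert (a x) (g ` {..j})"
  have QC: "Q \<subseteq> C" using g(3) aC[OF x] by (auto simp: Q_def)
  have "\<exists>w\<in>fence u v. \<exists>z\<in>Q. F z \<inter> F w \<noteq> {}"
  proof (rule ccontr)
    assume "\<not> ?thesis"
    then have disj: "F z \<inter> F w = {}" if "z \<in> Q" "w \<in> fence u v" for z w using that by blast
    have lQ: "linked E (\<Union>t\<in>Q. F t)"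
    proof (rule linked_UN[OF sym_E, of x])
      show xQ: "x \<in> Q" using g(1) by (force simp: Q_def)
      show "linked E (F t)" if "t \<in> Q" for t using linked_F QC that by blast
      let ?S = "{(s, t). s \<in> Q \<and> t \<in> Q \<and> F s \<inter> F t \<noteq> {}}"
      have "(x, g m) \<in> ?S\<^sup>*" if "m \<le> j" for m
        using that
      proof (induction m)
        case (Suc m)
        have "(g m, g (Suc m)) \<in> ?S" using meet'[OF g(4)[of m]] Suc(2) by (auto simp: Q_def)
        then show ?case using Suc by (auto intro: rtrancl_into_rtrancl)
      qed (simp add: g(1))
      moreover have "(x, a x) \<in> ?S" using xQ meet'[OF a(1)[OF x]] by (auto simp: Q_def)
      ultimately show "(x, t) \<in> ?S\<^sup>*" if "t \<in> Q" for t using that by (auto simp: Q_def)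
    qed
    have mem: "r0 \<in> Q \<inter> A" "a x \<in> Q \<inter> A" "a u \<in> fence u v \<inter> A" "a v \<in> fence u v \<inter> A"
      using g(2) r0(1) aC x uvX by (auto simp: Q_def fence_def)
    have ne: "f (foot z) \<noteq> f (foot w)" if "z \<in> Q \<inter> A" "w \<in> fence u v \<inter> A" for z w
      using same_foot[of z w] disj[of z w] that QC fence_sub[OF uv] by blast
    have "f (foot r0) \<le> f (foot (a u))" using r0(2) aC[OF uvX(1)] by blast
    then show False
      using no_interlace[OF QC fence_sub[OF uv] lQ linked_fence[OF uv] _ mem(1,3,2,4)] disj
        ne[OF mem(1,3)] ne[OF mem(2,3)] ne[OF mem(2,4)] le unfolding \<pi>_def by fastforce
  qed
  then obtain w z where wz: "w \<in> fence u v" "z \<in> Q" "F z \<inter> F w \<noteq> {}" by blast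
  have C: "z \<in> C" "w \<in> C" using wz QC fence_sub[OF uv] by auto
  have lev: "j \<le> Suc (d w)" using fence_level[OF uv wz(1)] .
  have "\<exists>n\<le>2. (x, z) \<in> R ^^ n"
  proof (cases "z = a x")
    case True
    then have "(x, z) \<in> R ^^ 1" using a(1)[OF x] by simp
    then show ?thesis by (intro exI[of _ 1]) simp
  next
    case False
    then obtain m where m: "m \<le> j" "z = g m" using wz(2) by (auto simp: Q_def)
    have dz: "d z = j - m" "(x, z) \<in> R ^^ m" using g(3)[OF m(1)] g(5)[OF m(1)] m(2) by auto
    have "z = w \<or> (z, w) \<in> R" using meet[OF C wz(3)] .
    then have "d w \<le> Suc (d z)" using d_step by auto
    then have "m \<le> 2" using lev dz(1) m(1) by linarith
    then show ?thesis using dz(2) by (intro exI[of _ m]) simp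
  qed
  then obtain n where "n \<le> 2" "(x, z) \<in> R ^^ n" by blast
  then have "\<exists>n\<le>Suc 2. (x, w) \<in> R ^^ n" by (intro touch[OF C wz(3)])
  then show ?thesis using wz(1) by (intro bexI[of _ w]) simp_all
qed

text \<open>An edge with the grounded neighbours of its ends is itself a fence. This one has one
  foot under the given fence and one outside, so the two have to touch; every member of the crossing
  fence is within two steps of \<open>y\<close>.\<close>

lemma contact_cross:
  assumes uv: "anchor u v" and xy: "x \<in> X" "y \<in> X" "(x, y) \<in> R"
    and le: "\<pi> u \<le> \<pi> x" "\<pi> x \<le> \<pi> v" and out: "\<pi> v < \<pi> y \<or> \<pi> y < \<pi> u"
  shows "\<exists>w\<in>fence u v. \<exists>n\<le>3. (y, w) \<in> R ^^ n"
proof -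
  have uvX: "u \<in> X" "v \<in> X" using uv by (auto simp: anchor_def)
  have xy': "anchor x y" using xy by (simp add: anchor_def)
  have "\<exists>w\<in>fence u v. \<exists>z\<in>fence x y. F z \<inter> F w \<noteq> {}"
  proof (rule ccontr)
    assume "\<not> ?thesis"
    then have disj: "F z \<inter> F w = {}" if "z \<in> fence x y" "w \<in> fence u v" for z w using that by blast
    have mem: "a x \<in> fence x y \<inter> A" "a y \<in> fence x y \<inter> A" "a u \<in> fence u v \<inter> A" "a v \<in> fence u v \<inter> A"
      using aC xy uvX by (auto simp: fence_def)
    have ne: "f (foot z) \<noteq> f (foot w)" if "z \<in> fence x y \<inter> A" "w \<in> fence u v \<inter> A" for z w
      using same_foot[of z w] disj[of z w] that fence_sub[OF xy'] fence_sub[OF uv] by blast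
    have D: "(\<Union>t\<in>fence x y. F t) \<inter> (\<Union>t\<in>fence u v. F t) = {}" using disj by blast
    show False
      using out
    proof
      assume "\<pi> v < \<pi> y"
      then show False
        using no_interlace[OF fence_sub[OF uv] fence_sub[OF xy'] linked_fence[OF uv] linked_fence[OF xy'] _ mem(3,1,4,2)]
          D ne[OF mem(1,3)] ne[OF mem(1,4)] le unfolding \<pi>_def by fastforce
    next
      assume "\<pi> y < \<pi> u"
      then show False
        using no_interlace[OF fence_sub[OF xy'] fence_sub[OF uv] linked_fence[OF xy'] linked_fence[OF uv] D mem(2,3,1,4)]
          ne[OF mem(1,3)] ne[OF mem(1,4)] le unfolding \<pi>_def by fastforce
    qed
  qed
  then obtain w z where wz: "w \<in> fence u v" "z \<in> fence x y" "F z \<inter> F w \<noteq> {}" by blast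
  have C: "z \<in> C" "w \<in> C" using wz fence_sub[OF xy'] fence_sub[OF uv] by auto
  have yx: "(y, x) \<in> R" using R_sym[OF xy(3)] .
  have "\<exists>n\<le>2. (y, z) \<in> R ^^ n"
  proof -
    have "z = y \<or> z = x \<or> z = a y \<or> z = a x" using wz(2) by (auto simp: fence_def)
    then show ?thesis
    proof (elim disjE)
      assume "z = y"
      then show ?thesis by (intro exI[of _ 0]) simp
    next
      assume "z = x"
      then show ?thesis using yx by (intro exI[of _ 1]) simp
    next
      assume "z = a y"
      then show ?thesis using a(1)[OF xy(2)] by (intro exI[of _ 1]) simp
    next
      assume "z = a x"
      then have "(y, z) \<in> R ^^ 2" using yx a(1)[OF xy(1)] by (auto simp: numeral_2_eq_2)
      then show ?thesis by blast
    qed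
  qed
  then obtain n where "n \<le> 2" "(y, z) \<in> R ^^ n" by blast
  then have "\<exists>n\<le>Suc 2. (y, w) \<in> R ^^ n" by (intro touch[OF C wz(3)])
  then show ?thesis using wz(1) by (intro bexI[of _ w]) simp_all
qed

lemma thick_three: "thick R 3 X"
proof -
  obtain \<iota> u v where ch: "\<And>x. x \<in> X \<Longrightarrow> u (\<iota> x) \<in> X" "\<And>x. x \<in> X \<Longrightarrow> v (\<iota> x) \<in> X"
    "\<And>x. x \<in> X \<Longrightarrow> u (\<iota> x) = v (\<iota> x) \<or> (u (\<iota> x), v (\<iota> x)) \<in> R"
    "\<And>x. x \<in> X \<Longrightarrow> \<pi> (u (\<iota> x)) \<le> \<pi> x" "\<And>x. x \<in> X \<Longrightarrow> \<pi> x \<le> \<pi> (v (\<iota> x))"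
    "\<And>x. x \<in> X \<Longrightarrow> \<iota> (v (\<iota> x)) = \<iota> x"
    "\<And>x y. x \<in> X \<Longrightarrow> y \<in> X \<Longrightarrow> \<pi> x \<le> \<pi> y \<Longrightarrow> \<iota> x \<le> \<iota> y"
    "\<And>x y. x \<in> X \<Longrightarrow> y \<in> X \<Longrightarrow> (x, y) \<in> R \<Longrightarrow> \<iota> y \<le> Suc (\<iota> x)"
    by (rule chain_blocks[OF X(1), where \<pi> = \<pi> and R = R]) (rule that)
  define \<omega> where "\<omega> i k = (if k = 0 then a (u i) else if k = 1 then u i else if k = 2 then v i else a (v i))"
    for i and k :: nat
  \<comment> \<open>A degenerate fence stops at \<open>k = 1\<close>, since from \<open>u i\<close>
    to \<open>v i = u i\<close> there is no step of \<open>R\<close>.\<close>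
  define valid where "valid i k \<longleftrightarrow> anchor (u i) (v i) \<and> k \<le> (if u i = v i then 1 else 3)" for i and k :: nat
  have anch: "anchor (u (\<iota> x)) (v (\<iota> x))" if "x \<in> X" for x
    using ch(1-3)[OF that] by (simp add: anchor_def)
  have \<omega>_step: "(\<omega> i k, \<omega> i (Suc k)) \<in> R" if "valid i (Suc k)" for i k
  proof -
    have *: "u i \<in> X" "v i \<in> X" "u i = v i \<or> (u i, v i) \<in> R" using that by (auto simp: valid_def anchor_def)
    have "k = 0 \<or> (u i \<noteq> v i \<and> (k = 1 \<or> k = 2))" using that by (auto simp: valid_def split: if_splits)
    then consider "k = 0" | "k = 1" "(u i, v i) \<in> R" | "k = 2" using *(3) by auto
    then show ?thesis
    proof cases
      case 1
      then show ?thesis using R_sym[OF a(1)[OF *(1)]] by (simp add: \<omega>_def)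
    next
      case 2
      then show ?thesis by (simp add: \<omega>_def numeral_2_eq_2)
    next
      case 3
      then show ?thesis using a(1)[OF *(2)] by (simp add: \<omega>_def)
    qed
  qed
  have \<omega>: "(\<omega> i k, \<omega> i (k + n)) \<in> R ^^ n" if "valid i (k + n)" for i k n
    using that
  proof (induction n)
    case (Suc n)
    have "valid i (k + n)" using Suc(2) by (auto simp: valid_def split: if_splits)
    then show ?case using Suc \<omega>_step[of i "k + n"] by (auto intro: relpow_Suc_I)
  qed simp
  have valid: "k' \<le> k + 3 \<and> (\<omega> i k, \<omega> i k') \<in> R ^^ (k' - k)" if "valid i k" "valid i k'" "k \<le> k'" for i k k'
    using \<omega>[of i k "k' - k"] that by (auto simp: valid_def split: if_splits)
  \<comment> \<open>Distance 4 rather than 3, so that neighbours of vertices in contact are included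
    as well; the second layers \<open>L'\<close> and \<open>Q'\<close> need this.\<close>
  define con where "con i x \<longleftrightarrow> (\<exists>k n. n \<le> 4 \<and> valid i k \<and> (x, \<omega> i k) \<in> R ^^ n)" for i x
  obtain col where col: "\<And>i x y. (x, y) \<in> R \<Longrightarrow> con i x \<Longrightarrow> con i y \<Longrightarrow> col i x \<noteq> (col i y :: bool)"
    using contact_colouring[OF sym_R odd, of valid \<omega>] valid unfolding con_def by metis
  have fence_\<omega>: "\<exists>k. valid i k \<and> w = \<omega> i k" if w: "w \<in> fence (u i) (v i)" and an: "anchor (u i) (v i)" for i w
  proof -
    consider "w = a (u i)" | "w = u i" | "w = v i" "u i \<noteq> v i" | "w = a (v i)" "u i \<noteq> v i"
      using w by (cases "u i = v i") (auto simp: fence_def)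
    then show ?thesis
    proof cases
      case 1
      then show ?thesis using an by (intro exI[of _ 0]) (simp add: valid_def \<omega>_def)
    next
      case 2
      then show ?thesis using an by (intro exI[of _ 1]) (simp add: valid_def \<omega>_def)
    next
      case 3
      then show ?thesis using an by (intro exI[of _ 2]) (simp add: valid_def \<omega>_def)
    next
      case 4
      then show ?thesis using an by (intro exI[of _ 3]) (simp add: valid_def \<omega>_def)
    qed
  qed
  have conI: "con i y" if an: "anchor (u i) (v i)" and w: "w \<in> fence (u i) (v i)" "n \<le> 4" "(y, w) \<in> R ^^ n" for i y w n
  proof -
    obtain k where "valid i k" "w = \<omega> i k" using fence_\<omega>[OF w(1) an] by blast
    then show ?thesis unfolding con_def using w by (intro exI[of _ k] exI[of _ n]) simp
  qed
  have conI3: "con i y" if an: "anchor (u i) (v i)" and ex: "\<exists>w\<in>fence (u i) (v i). \<exists>n\<le>3. (y, w) \<in> R ^^ n" for i y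
  proof -
    obtain w n where "w \<in> fence (u i) (v i)" "n \<le> 3" "(y, w) \<in> R ^^ n" using ex by blast
    then show ?thesis using conI[OF an, of w n y] by simp
  qed
  \<comment> \<open>If \<open>y\<close> is in a later block, it lies beyond
    \<open>v (\<iota> x)\<close>, which belongs to the block of \<open>x\<close>, so the edge
    crosses the fence. In an earlier block \<open>y\<close> may still lie under the fence, because
    \<open>u (\<iota> x)\<close> can belong to an earlier block; then \<open>contact_under\<close>
    applies.\<close>
  have con1: "\<exists>w\<in>fence (u (\<iota> x)) (v (\<iota> x)). \<exists>n\<le>3. (y, w) \<in> R ^^ n"
    if xy: "x \<in> X" "y \<in> X" "(x, y) \<in> R" "\<iota> x \<noteq> \<iota> y" for x y
  proof (cases "\<iota> x < \<iota> y")
    case True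
    then have "\<not> \<pi> y \<le> \<pi> (v (\<iota> x))" using ch(7)[OF xy(2) ch(2)[OF xy(1)]] ch(6)[OF xy(1)] by linarith
    then show ?thesis using contact_cross[OF anch[OF xy(1)] xy(1-3) ch(4,5)[OF xy(1)]] by simp
  next
    case False
    then have "\<not> \<pi> x \<le> \<pi> y" using ch(7)[OF xy(1,2)] xy(4) by linarith
    then have "\<pi> y \<le> \<pi> (v (\<iota> x))" using ch(5)[OF xy(1)] by linarith
    then show ?thesis
      using contact_cross[OF anch[OF xy(1)] xy(1-3) ch(4,5)[OF xy(1)]] contact_under[OF anch[OF xy(1)] xy(2)]
      by (meson linorder_not_le)
  qed
  show ?thesis
  proof (rule thick_three_of_blocks[where \<iota> = \<iota> and con = con and col = col, OF X(1) sym_R])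
    show "\<iota> y \<le> Suc (\<iota> x)" if "x \<in> X" "y \<in> X" "(x, y) \<in> R" for x y using ch(8)[OF that] .
    show "col i x \<noteq> col i y" if "(x, y) \<in> R" "con i x" "con i y" for i x y using col that by blast
    show "con (\<iota> x) x" if "x \<in> X" for x
      using contact_under[OF anch[OF that] that ch(4,5)[OF that]] by (intro conI3 anch that)
    show "con (\<iota> x) y" if "x \<in> X" "y \<in> X" "(x, y) \<in> R" "\<iota> x \<noteq> \<iota> y" for x y
      using con1[OF that] by (intro conI3 anch that(1))
    show "con (\<iota> x) z" if xyz: "x \<in> X" "y \<in> X" "z \<in> X" "(x, y) \<in> R" "(y, z) \<in> R" "\<iota> x \<noteq> \<iota> y" for x y z
    proof -
      obtain w n where w: "w \<in> fence (u (\<iota> x)) (v (\<iota> x))" "n \<le> 3" "(y, w) \<in> R ^^ n"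
        using con1[OF xyz(1,2,4,6)] by blast
      have zw: "(z, w) \<in> R ^^ Suc n" using R_sym[OF xyz(5)] w(3) by (rule relpow_Suc_I2)
      have "Suc n \<le> 4" using w(2) by simp
      then show ?thesis using zw by (rule conI[OF anch[OF xyz(1)] w(1)])
    qed
  qed
qed

end

text \<open>This is the second breadth first search. Each component of \<open>R\<close> covers a
  connected part of the host graph and hence has its own order along the ground, whose first member
  becomes the root.\<close>

lemma thick_six_of_grounded:
  fixes T :: "'t set" and F :: "'t \<Rightarrow> 'h set" and nb :: "'h \<Rightarrow> bool"
  assumes sym_R: "sym R" and R_T: "R \<subseteq> T \<times> T" and odd: "no_short_odd 11 R" and sym_E: "sym E"
    and fin: "finite T"
    and meet: "\<And>s t. s \<in> T \<Longrightarrow> t \<in> T \<Longrightarrow> F s \<inter> F t \<noteq> {} \<Longrightarrow> s = t \<or> (s, t) \<in> R"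
    and meet': "\<And>s t. (s, t) \<in> R \<Longrightarrow> F s \<inter> F t \<noteq> {}"
    and linked_F: "\<And>t. t \<in> T \<Longrightarrow> linked E (F t)"
    and order: "\<And>W. linked E W \<Longrightarrow> W \<subseteq> (\<Union>t\<in>T. F t) \<Longrightarrow> \<exists>f :: 'h \<Rightarrow> real. inj_on f {k \<in> W. nb k} \<and>
      (\<forall>P Q p q p' q'. linked E P \<longrightarrow> linked E Q \<longrightarrow> P \<subseteq> W \<longrightarrow> Q \<subseteq> W \<longrightarrow> P \<inter> Q = {} \<longrightarrow>
        p \<in> P \<longrightarrow> q \<in> Q \<longrightarrow> p' \<in> P \<longrightarrow> q' \<in> Q \<longrightarrow> nb p \<longrightarrow> nb q \<longrightarrow> nb p' \<longrightarrow> nb q' \<longrightarrow>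
        f p < f q \<longrightarrow> f q < f p' \<longrightarrow> f p' < f q' \<longrightarrow> False)"
    and A: "A \<subseteq> T" "\<And>t. t \<in> A \<Longrightarrow> \<exists>k\<in>F t. nb k"
    and B: "B \<subseteq> T" "\<And>t. t \<in> B \<Longrightarrow> \<exists>s\<in>A. (t, s) \<in> R"
  shows "thick R 6 B"
proof -
  define comp where "comp x = {y. (x, y) \<in> R\<^sup>*}" for x
  have comp_eq: "comp x = comp y" if "(x, y) \<in> R" for x y
    unfolding comp_def by (rule component_eq[OF sym_R that])
  have comp_T: "comp x \<subseteq> T" if "x \<in> T" for x
  proof -
    have "y \<in> T" if "(x, y) \<in> R\<^sup>*" for y using that \<open>x \<in> T\<close> R_T by (induction) auto
    then show ?thesis by (auto simp: comp_def)
  qed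
  define foot where "foot t = (SOME k. k \<in> F t \<and> nb k)" for t
  have foot: "foot t \<in> F t" "nb (foot t)" if "t \<in> A" for t
    using someI_ex[of "\<lambda>k. k \<in> F t \<and> nb k"] A(2)[OF that] by (auto simp: foot_def)
  define W where "W C = (\<Union>t\<in>C. F t)" for C
  define good where "good C r f \<longleftrightarrow> r \<in> C \<inter> A \<and> (\<forall>t\<in>C \<inter> A. f (foot r) \<le> f (foot t)) \<and>
      inj_on f {k \<in> W C. nb k} \<and>
      (\<forall>P Q p q p' q'. linked E P \<longrightarrow> linked E Q \<longrightarrow> P \<subseteq> W C \<longrightarrow> Q \<subseteq> W C \<longrightarrow> P \<inter> Q = {} \<longrightarrow>
        p \<in> P \<longrightarrow> q \<in> Q \<longrightarrow> p' \<in> P \<longrightarrow> q' \<in> Q \<longrightarrow> nb p \<longrightarrow> nb q \<longrightarrow> nb p' \<longrightarrow> nb q' \<longrightarrow>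
        f p < f q \<longrightarrow> f q < f p' \<longrightarrow> f p' < f q' \<longrightarrow> False)"
    for C r and f :: "'h \<Rightarrow> real"
  have linked_W: "linked E (W (comp x))" if x: "x \<in> T" for x
    unfolding W_def
  proof (rule linked_UN[OF sym_E, of x])
    show "x \<in> comp x" by (simp add: comp_def)
    show "linked E (F t)" if "t \<in> comp x" for t using that comp_T[OF x] by (intro linked_F) auto
    let ?S = "{(s, t). s \<in> comp x \<and> t \<in> comp x \<and> F s \<inter> F t \<noteq> {}}"
    fix t assume "t \<in> comp x"
    then have "(x, t) \<in> R\<^sup>*" by (simp add: comp_def)
    then show "(x, t) \<in> ?S\<^sup>*"
    proof (induction rule: rtrancl_induct)
      case (step y z)
      have "(y, z) \<in> ?S" using step(1,2) meet'[OF step(2)] by (auto simp: comp_def)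
      then show ?case using step.IH by (rule rtrancl_into_rtrancl[rotated])
    qed simp
  qed
  have ex_good: "\<exists>r f. good (comp x) r f" if x: "x \<in> T" "comp x \<inter> A \<noteq> {}" for x
  proof -
    have "W (comp x) \<subseteq> (\<Union>t\<in>T. F t)" using comp_T[OF x(1)] by (auto simp: W_def)
    from order[OF linked_W[OF x(1)] this] obtain f :: "'h \<Rightarrow> real" where f: "inj_on f {k \<in> W (comp x). nb k}"
      "\<forall>P Q p q p' q'. linked E P \<longrightarrow> linked E Q \<longrightarrow> P \<subseteq> W (comp x) \<longrightarrow> Q \<subseteq> W (comp x) \<longrightarrow> P \<inter> Q = {} \<longrightarrow>
        p \<in> P \<longrightarrow> q \<in> Q \<longrightarrow> p' \<in> P \<longrightarrow> q' \<in> Q \<longrightarrow> nb p \<longrightarrow> nb q \<longrightarrow> nb p' \<longrightarrow> nb q' \<longrightarrow>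
        f p < f q \<longrightarrow> f q < f p' \<longrightarrow> f p' < f q' \<longrightarrow> False" by (elim exE conjE)
    have fA: "finite (comp x \<inter> A)" using comp_T[OF x(1)] fin finite_subset by blast
    define r where "r = arg_min_on (\<lambda>t. f (foot t)) (comp x \<inter> A)"
    have "r \<in> comp x \<inter> A" "\<forall>t\<in>comp x \<inter> A. f (foot r) \<le> f (foot t)"
      using arg_min_if_finite[OF fA x(2), of "\<lambda>t. f (foot t)"] unfolding r_def by (auto simp: not_less)
    then have "good (comp x) r f" using f unfolding good_def by (intro conjI)
    then show ?thesis by blast
  qed
  \<comment> \<open>The root depends on the component alone, which makes it constant along edges.
    Components for which no suitable order and first member exist get an arbitrary root.\<close>
  define rt0 where "rt0 C = (if \<exists>r f. good C r f then SOME r. \<exists>f. good C r f else SOME r. r \<in> C)" for C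
  define rt where "rt x = rt0 (comp x)" for x
  have good_rt: "\<exists>f. good (comp x) (rt x) f" if x: "x \<in> T" "comp x \<inter> A \<noteq> {}" for x
    using ex_good[OF that] someI_ex[of "\<lambda>r. \<exists>f. good (comp x) r f"] unfolding rt_def rt0_def by simp
  have rt_comp: "rt x \<in> comp x" for x
  proof (cases "\<exists>r f. good (comp x) r f")
    case True
    then have "\<exists>f. good (comp x) (rt x) f"
      using someI_ex[of "\<lambda>r. \<exists>f. good (comp x) r f"] unfolding rt_def rt0_def by simp
    then show ?thesis unfolding good_def by blast
  next
    case False
    have "\<exists>r. r \<in> comp x" by (auto simp: comp_def)
    moreover have "rt x = (SOME r. r \<in> comp x)" unfolding rt_def rt0_def by (rule if_not_P[OF False])
    ultimately show ?thesis using someI_ex[of "\<lambda>r. r \<in> comp x"] by simp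
  qed
  have symR': "sym (R\<^sup>*)" using sym_R by (rule sym_rtrancl)
  have rt1: "(rt x, x) \<in> R\<^sup>*" for x
    using rt_comp[of x] symR' unfolding comp_def by (auto dest: symD)
  have rt2: "rt x = rt y" if "(x, y) \<in> R" for x y using comp_eq[OF that] by (simp add: rt_def)
  obtain d :: "'t \<Rightarrow> nat" where d: "\<And>x. (rt x, x) \<in> R ^^ d x"
    "\<And>x y. (x, y) \<in> R \<Longrightarrow> d y \<le> Suc (d x)"
    "\<And>x n. d x = Suc n \<Longrightarrow> \<exists>y. (x, y) \<in> R \<and> d y = n"
    "\<And>x. d x = 0 \<Longrightarrow> x = rt x"
    by (rule breadth_first[where rt = rt, OF sym_R rt1], erule rt2, rule that)
  have "thick R (2 * 3) B"
  proof (rule thick_fibres[where \<kappa> = "\<lambda>x. (comp x, d x)" and par = "\<lambda>p. even (snd p)"])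
    show finB: "finite B" using B(1) fin finite_subset by blast
    show "(comp x, d x) = (comp y, d y) \<or> even (snd (comp x, d x)) \<noteq> even (snd (comp y, d y))"
      if "(x, y) \<in> R" for x y
    proof -
      have "d y \<le> Suc (d x)" "d x \<le> Suc (d y)" using d(2) that sym_R by (auto dest: symD)
      then have "d x = d y \<or> d y = Suc (d x) \<or> d x = Suc (d y)" by linarith
      then show ?thesis using comp_eq[OF that] by auto
    qed
    fix b assume "b \<in> (\<lambda>x. (comp x, d x)) ` B"
    then obtain x0 where x0: "x0 \<in> B" "b = (comp x0, d x0)" by blast
    let ?X = "{x \<in> B. (comp x, d x) = b}"
    define a where "a x = (SOME s. s \<in> A \<and> (x, s) \<in> R)" for x
    have a: "a x \<in> A" "(x, a x) \<in> R" if "x \<in> B" for x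
      using someI_ex[of "\<lambda>s. s \<in> A \<and> (x, s) \<in> R"] B(2)[OF that] by (auto simp: a_def)
    have xT: "x0 \<in> T" using x0 B(1) by blast
    have "a x0 \<in> comp x0 \<inter> A" using a[OF x0(1)] by (auto simp: comp_def)
    then obtain f where f: "good (comp x0) (rt x0) f" using good_rt[OF xT] by blast
    have rt_in: "rt y = rt x0" if "y \<in> comp x0" for y
    proof -
      have "(x0, y) \<in> R\<^sup>*" using that by (simp add: comp_def)
      then show ?thesis by (induction rule: rtrancl_induct) (auto dest: rt2)
    qed
    have self: "x \<in> comp x" for x by (simp add: comp_def)
    have CT: "comp x0 \<subseteq> T" by (rule comp_T[OF xT])
    interpret grounded_family R E F "comp x0" A foot f "rt x0" d "d x0" ?X a
    proof (unfold_locales, goal_cases)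
      case 1 show ?case by (rule sym_R)
    next
      case 2 show ?case by (rule sym_E)
    next
      case 3 show ?case by (rule odd)
    next
      case (4 s t)
      then show ?case by (auto simp: comp_def intro: rtrancl_into_rtrancl)
    next
      case (5 s t)
      then show ?case using meet[of s t] CT by blast
    next
      case (6 s t)
      then show ?case by (rule meet')
    next
      case (7 t)
      then show ?case using CT by (intro linked_F) blast
    next
      case (8 t)
      then show ?case using foot(1) by blast
    next
      case (9 s t)
      have "foot s \<in> {k \<in> W (comp x0). nb k}" "foot t \<in> {k \<in> W (comp x0). nb k}"
        using 9 foot by (auto simp: W_def)
      then show ?case using f 9(3) unfolding good_def by (auto dest: inj_onD)
    next
      case (10 P Q p q p' q')
      have PQ: "\<Union> (F ` P) \<subseteq> W (comp x0)" "\<Union> (F ` Q) \<subseteq> W (comp x0)" using 10(1,2) by (auto simp: W_def)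
      have "foot p \<in> \<Union> (F ` P)" "foot q \<in> \<Union> (F ` Q)" "foot p' \<in> \<Union> (F ` P)" "foot q' \<in> \<Union> (F ` Q)"
        "nb (foot p)" "nb (foot q)" "nb (foot p')" "nb (foot q')"
        using 10(6-9) foot by blast+
      then show ?case using f PQ 10(3-5,10-12) unfolding good_def by blast
    next
      case 11 show ?case using f by (simp add: good_def)
    next
      case (12 t)
      then show ?case using f by (simp add: good_def)
    next
      case (13 x y)
      then show ?case by (rule d(2))
    next
      case (14 x n)
      then show ?case using d(3) by blast
    next
      case (15 x)
      then show ?case using d(4)[of x] rt_in[of x] by simp
    next
      case 16 show ?case using finB by simp
    next
      case (17 x)
      then show ?case using x0(2) self[of x] by auto
    next
      case (18 x)
      then show ?case using x0(2) by auto
    next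
      case (19 x)
      then show ?case using a(2) by auto
    next
      case (20 x)
      then show ?case using a(1) by auto
    qed
    show "thick R 3 ?X" by (rule thick_three)
  qed
  then show ?thesis by simp
qed

section \<open>Pieces of a string outside the ground\<close>

definition hcomps :: "('h \<times> 'h) set \<Rightarrow> 'h set \<Rightarrow> 'h set set" where
  "hcomps E Y = (\<lambda>x. {y. (x, y) \<in> (E \<inter> Y \<times> Y)\<^sup>*}) ` Y"

lemma hcomps_subset: "Z \<in> hcomps E Y \<Longrightarrow> Z \<subseteq> Y"
  unfolding hcomps_def by (auto elim: rtranclE)

lemma hcomps_cover: "x \<in> Y \<Longrightarrow> \<exists>Z\<in>hcomps E Y. x \<in> Z"
  unfolding hcomps_def by auto

lemma hcomps_whole:
  assumes "linked E Y"
  shows "hcomps E Y = {Y}"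
proof -
  have "{y. (x, y) \<in> (E \<inter> Y \<times> Y)\<^sup>*} = Y" if "x \<in> Y" for x
    using assms that by (auto simp: linked_def elim: rtranclE)
  then show ?thesis using assms unfolding hcomps_def linked_def by auto
qed

lemma hcomps_closed:
  assumes "Z \<in> hcomps E Y" "x \<in> Z" "(x, y) \<in> E" "y \<in> Y"
  shows "y \<in> Z"
proof -
  have "x \<in> Y" using hcomps_subset[OF assms(1)] assms(2) by blast
  then show ?thesis using assms unfolding hcomps_def by (auto intro: rtrancl_into_rtrancl)
qed

lemma hcomps_linked:
  assumes "sym E" "Z \<in> hcomps E Y"
  shows "linked E Z"
proof -
  obtain x where x: "x \<in> Y" "Z = {y. (x, y) \<in> (E \<inter> Y \<times> Y)\<^sup>*}" using assms(2) by (auto simp: hcomps_def)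
  have reach: "(x, y) \<in> (E \<inter> Z \<times> Z)\<^sup>*" if "(x, y) \<in> (E \<inter> Y \<times> Y)\<^sup>*" for y
    using that
  proof (induction rule: rtrancl_induct)
    case (step y z)
    have "y \<in> Z" "z \<in> Z" using step(1,2) x(2) by (auto intro: rtrancl_into_rtrancl)
    then show ?case using step by (auto intro: rtrancl_into_rtrancl)
  qed simp
  have "sym ((E \<inter> Z \<times> Z)\<^sup>*)" using assms(1) by (intro sym_rtrancl) (auto simp: sym_def)
  then have "(y, z) \<in> (E \<inter> Z \<times> Z)\<^sup>*" if "y \<in> Z" "z \<in> Z" for y z
    using reach that x(2) by (metis (mono_tags, lifting) mem_Collect_eq rtrancl_trans symD)
  then show ?thesis using x unfolding linked_def by auto
qed

lemma hcomps_disjoint: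
  assumes "sym E" "Z \<in> hcomps E Y" "Z' \<in> hcomps E Y" "Z \<inter> Z' \<noteq> {}"
  shows "Z = Z'"
proof -
  have *: "Z \<subseteq> Z'" if Z: "Z \<in> hcomps E Y" "Z' \<in> hcomps E Y" "Z \<inter> Z' \<noteq> {}" for Z Z'
  proof
    fix y assume y: "y \<in> Z"
    obtain x where x: "x \<in> Z" "x \<in> Z'" using Z(3) by blast
    have "(x, y) \<in> (E \<inter> Z \<times> Z)\<^sup>*" using hcomps_linked[OF assms(1) Z(1)] x(1) y by (auto simp: linked_def)
    then show "y \<in> Z'"
    proof (induction rule: rtrancl_induct)
      case (step y z)
      then show ?case using hcomps_closed[OF Z(2), of y z] hcomps_subset[OF Z(1)] by blast
    qed (rule x(2))
  qed
  show ?thesis using *[of Z Z'] *[of Z' Z] assms by blast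
qed

text \<open>On a walk inside \<open>S\<close> from \<open>Z\<close> to \<open>U\<close>, the first
  step that leaves \<open>Z\<close> must end in \<open>U\<close>, because a step within
  \<open>S - U\<close> remains in the same piece.\<close>

lemma hcomps_touch:
  assumes "linked E S" "S \<inter> U \<noteq> {}" "Z \<in> hcomps E (S - U)"
  shows "\<exists>k\<in>Z. \<exists>h\<in>U. (k, h) \<in> E"
proof (rule ccontr)
  assume no: "\<not> ?thesis"
  obtain x where x: "x \<in> Z" using assms(3) by (auto simp: hcomps_def)
  obtain y where y: "y \<in> S" "y \<in> U" using assms(2) by blast
  have "x \<in> S" using hcomps_subset[OF assms(3)] x by blast
  then have "(x, y) \<in> (E \<inter> S \<times> S)\<^sup>*" using assms(1) y by (auto simp: linked_def)
  then have "y \<in> Z"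
  proof (induction rule: rtrancl_induct)
    case (step y z)
    then show ?case using no hcomps_closed[OF assms(3), of y z] by blast
  qed (rule x)
  then show False using hcomps_subset[OF assms(3)] y by blast
qed

text \<open>Strings of level \<open>i\<close> are disjoint from \<open>U\<close> and stay whole,
  while those of level \<open>i - 1\<close> meet it and are cut. Since a cut string was connected,
  each of its pieces touches the ground; and each string of level \<open>i\<close> meets such a
  piece, in a point that it shares with its parent. Sending pieces to their strings is a
  homomorphism from \<open>R2\<close> to \<open>R\<close>.\<close>

lemma thick_twelve_of_strings:
  fixes H :: "'h pair_pre_digraph" and S :: "'a \<Rightarrow> 'h set"
  assumes H: "pair_graph H" "planar H" and fin: "finite X"
    and S: "\<And>v. v \<in> X \<Longrightarrow> S v \<subseteq> pverts H" "\<And>v. v \<in> X \<Longrightarrow> linked (parcs H) (S v)"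
    and R: "R = {(u, v). u \<in> X \<and> v \<in> X \<and> u \<noteq> v \<and> S u \<inter> S v \<noteq> {}}"
    and odd: "no_short_odd 11 R"
  shows "thick R 12 X"
proof -
  let ?E = "parcs H"
  note HD = pair_graphD[OF H(1)]
  have sym_E: "sym ?E" using HD(5) by (auto simp: sym_def)
  obtain pos \<gamma> where pl: "plane_drawing H pos \<gamma>" using H(2) by (auto simp: planar_def)
  have sym_R: "sym R" unfolding R by (auto simp: sym_def)
  have RX: "x \<in> X" "y \<in> X" "x \<noteq> y" "S x \<inter> S y \<noteq> {}" if "(x, y) \<in> R" for x y using that by (auto simp: R)
  have RI: "(x, y) \<in> R" if "x \<in> X" "y \<in> X" "x \<noteq> y" "S x \<inter> S y \<noteq> {}" for x y using that by (auto simp: R)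
  have finS: "finite (S v)" if "v \<in> X" for v using S(1)[OF that] HD(1) finite_subset by blast
  define comp where "comp x = {y. (x, y) \<in> R\<^sup>*}" for x
  have comp_eq: "comp x = comp y" if "(x, y) \<in> R" for x y
    unfolding comp_def by (rule component_eq[OF sym_R that])
  define rt where "rt x = (SOME r. r \<in> comp x)" for x
  have "rt x \<in> comp x" for x unfolding rt_def by (rule someI_ex) (auto simp: comp_def)
  then have rt1: "(rt x, x) \<in> R\<^sup>*" for x
    using sym_rtrancl[OF sym_R] unfolding comp_def by (auto dest: symD)
  have rt2: "rt x = rt y" if "(x, y) \<in> R" for x y using comp_eq[OF that] by (simp add: rt_def)
  obtain d :: "'a \<Rightarrow> nat" where d: "\<And>x. (rt x, x) \<in> R ^^ d x"
    "\<And>x y. (x, y) \<in> R \<Longrightarrow> d y \<le> Suc (d x)"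
    "\<And>x n. d x = Suc n \<Longrightarrow> \<exists>y. (x, y) \<in> R \<and> d y = n"
    "\<And>x. d x = 0 \<Longrightarrow> x = rt x"
    by (rule breadth_first[where rt = rt, OF sym_R rt1], erule rt2, rule that)
  have "thick R (2 * 6) X"
  proof (rule thick_fibres[where \<kappa> = "\<lambda>x. (rt x, d x)" and par = "\<lambda>p. even (snd p)", OF fin])
    show "(rt x, d x) = (rt y, d y) \<or> even (snd (rt x, d x)) \<noteq> even (snd (rt y, d y))"
      if "(x, y) \<in> R" for x y
    proof -
      have "d y \<le> Suc (d x)" "d x \<le> Suc (d y)" using d(2) that sym_R by (auto dest: symD)
      then have "d x = d y \<or> d y = Suc (d x) \<or> d x = Suc (d y)" by linarith
      then show ?thesis using rt2[OF that] by auto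
    qed
    fix b assume "b \<in> (\<lambda>x. (rt x, d x)) ` X"
    then obtain r i where b: "b = (r, i)" by force
    define Y where "Y = {x \<in> X. rt x = r \<and> d x = i}"
    have Y_eq: "{x \<in> X. (rt x, d x) = b} = Y" by (auto simp: Y_def b)
    show "thick R 6 {x \<in> X. (rt x, d x) = b}"
      unfolding Y_eq
    proof (cases "i \<le> 1")
      case True
      \<comment> \<open>In levels 0 and 1 an edge and two shortest walks to the root form an odd
        closed walk of length at most 3.\<close>
      have "(x, y) \<notin> R" if "x \<in> Y" "y \<in> Y" for x y
      proof
        assume xy: "(x, y) \<in> R"
        have "(r, x) \<in> R ^^ i" "(y, r) \<in> R ^^ i" "(x, y) \<in> R ^^ 1"
          using that d(1)[of x] d(1)[of y] xy relpow_sym[OF sym_R] by (auto simp: Y_def)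
        then have "(r, r) \<in> R ^^ (i + 1 + i)" by (blast intro: relpow_trans)
        moreover have "odd (i + 1 + i)" "i + 1 + i \<le> 11" using True by auto
        ultimately show False using odd unfolding no_short_odd_def by blast
      qed
      then show "thick R 6 Y" by (intro thick_of_indep) (auto simp: indep_def)
    next
      case False
      then have i2: "2 \<le> i" by simp
      define I0 where "I0 = {w \<in> X. rt w = r \<and> d w \<le> i - 2}"
      define U where "U = (\<Union>w\<in>I0. S w)"
      have parent: "\<exists>y. (x, y) \<in> R \<and> d y = n \<and> rt y = rt x" if "d x = Suc n" for x n
        using d(3)[OF that] rt2 by metis
      have down: "\<exists>x\<in>X. rt x = rt v \<and> d x = m" if "v \<in> X" "m \<le> d v" for v m
        using that
      proof (induction "d v - m" arbitrary: v)
        case 0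
        then show ?case by (intro bexI[of _ v]) auto
      next
        case (Suc k)
        then have "d v = Suc (m + k)" by simp
        then obtain y where y: "(v, y) \<in> R" "d y = m + k" "rt y = rt v" using parent by blast
        then show ?case using Suc(1)[of y] RX(2)[OF y(1)] by auto
      qed
      have IX: "I0 \<subseteq> X" by (auto simp: I0_def)
      \<comment> \<open>A shortest walk to the root passes through lower levels only, so it never
        leaves \<open>I0\<close>.\<close>
      have lU: "linked ?E U" if ne: "I0 \<noteq> {}"
      proof -
        obtain w0 where w0: "w0 \<in> I0" using ne by blast
        let ?S = "{(s, t). s \<in> I0 \<and> t \<in> I0 \<and> S s \<inter> S t \<noteq> {}}"
        have to_root: "r \<in> I0 \<and> (r, w) \<in> ?S\<^sup>*" if "w \<in> I0" for w
          using that
        proof (induction "d w" arbitrary: w)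
          case 0
          then have "w = r" using d(4)[of w] by (auto simp: I0_def)
          then show ?case using 0 by simp
        next
          case (Suc n)
          obtain y where y: "(w, y) \<in> R" "d y = n" "rt y = rt w" using parent[of w n] Suc(2) by auto
          then have yI: "y \<in> I0" using Suc(2,3) RX(2)[OF y(1)] by (auto simp: I0_def)
          then have "r \<in> I0 \<and> (r, y) \<in> ?S\<^sup>*" using Suc(1)[of y] y(2) by simp
          moreover have "(y, w) \<in> ?S" using yI Suc(3) RX(4)[OF y(1)] by auto
          ultimately show ?case by (auto intro: rtrancl_into_rtrancl)
        qed
        show ?thesis unfolding U_def
        proof (rule linked_UN[OF sym_E, of r])
          show "r \<in> I0" using to_root[OF w0] by simp
          show "linked ?E (S t)" if "t \<in> I0" for t using that IX by (intro S(2)) auto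
          show "(r, t) \<in> ?S\<^sup>*" if "t \<in> I0" for t using to_root[OF that] by simp
        qed
      qed
      have US: "U \<subseteq> pverts H" using S(1) IX by (auto simp: U_def)
      have free: "S v \<inter> U = {}" if v: "v \<in> X" "d v = i" for v
      proof (rule ccontr)
        assume "S v \<inter> U \<noteq> {}"
        then obtain w where w: "w \<in> I0" "S v \<inter> S w \<noteq> {}" by (auto simp: U_def)
        have "w \<noteq> v" using w(1) v(2) i2 by (auto simp: I0_def)
        then have "(w, v) \<in> R" using w v(1) IX by (intro RI) auto
        then show False using d(2)[of w v] w(1) v(2) i2 by (auto simp: I0_def)
      qed
      define V where "V = {v \<in> X. rt v = r \<and> (d v = i - 1 \<or> d v = i)}"
      \<comment> \<open>Pieces carry the vertex that they come from, since pieces of different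
        strings may be equal as sets.\<close>
      define T where "T = (SIGMA v:V. hcomps ?E (S v - U))"
      define A where "A = {t \<in> T. d (fst t) = i - 1}"
      define B where "B = (\<lambda>v. (v, S v)) ` Y"
      define R2 where "R2 = {(s, t). s \<in> T \<and> t \<in> T \<and> fst s \<noteq> fst t \<and> snd s \<inter> snd t \<noteq> {}}"
      define nb where "nb k \<longleftrightarrow> (\<exists>h\<in>U. (k, h) \<in> ?E)" for k
      have VX: "V \<subseteq> X" by (auto simp: V_def)
      have T_D: "fst t \<in> V" "snd t \<in> hcomps ?E (S (fst t) - U)" "snd t \<subseteq> S (fst t)" "snd t \<inter> U = {}"
        if "t \<in> T" for t
        using that hcomps_subset[of "snd t" ?E "S (fst t) - U"] by (auto simp: T_def)
      have finT: "finite T"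
        unfolding T_def
      proof (rule finite_SigmaI)
        show "finite V" using VX fin finite_subset by blast
        fix v assume "v \<in> V"
        then have "finite (S v - U)" using finS VX by blast
        then show "finite (hcomps ?E (S v - U))" unfolding hcomps_def by simp
      qed
      have R2R: "(fst s, fst t) \<in> R" if "(s, t) \<in> R2" for s t
        using that T_D[of s] T_D[of t] VX by (intro RI) (auto simp: R2_def)
      have BT: "(v, S v) \<in> T" if "v \<in> Y" for v
      proof -
        have v: "v \<in> X" "rt v = r" "d v = i" using that by (auto simp: Y_def)
        have "S v - U = S v" using free[OF v(1,3)] by blast
        then show ?thesis using v hcomps_whole[OF S(2)[OF v(1)]] by (auto simp: T_def V_def)
      qed
      have thB: "thick R2 6 B"
      proof (rule thick_six_of_grounded[where T = T and F = snd and E = ?E and A = A and nb = nb])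
        show "sym R2" by (auto simp: sym_def R2_def)
        show "R2 \<subseteq> T \<times> T" by (auto simp: R2_def)
        show "no_short_odd 11 R2" using odd R2R by (rule no_short_odd_map)
        show "sym ?E" by (rule sym_E)
        show "finite T" by (rule finT)
        show "s = t \<or> (s, t) \<in> R2" if "s \<in> T" "t \<in> T" "snd s \<inter> snd t \<noteq> {}" for s t
        proof (cases "fst s = fst t")
          case True
          have "snd s = snd t"
            using hcomps_disjoint[OF sym_E T_D(2)[OF that(1)]] T_D(2)[OF that(2)] that(3) True by simp
          then show ?thesis using True by (simp add: prod_eq_iff)
        qed (use that in \<open>simp add: R2_def\<close>)
        show "snd s \<inter> snd t \<noteq> {}" if "(s, t) \<in> R2" for s t using that by (simp add: R2_def)
        show "linked ?E (snd t)" if "t \<in> T" for t by (rule hcomps_linked[OF sym_E T_D(2)[OF that]])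
        show "A \<subseteq> T" by (auto simp: A_def)
        have touchU: "S w \<inter> U \<noteq> {}" if w: "w \<in> X" "rt w = r" "d w = i - 1" for w
        proof -
          have "d w = Suc (i - 2)" using w(3) i2 by simp
          then obtain y where y: "(w, y) \<in> R" "d y = i - 2" "rt y = rt w" using parent by blast
          then have "y \<in> I0" using w(2) RX(2)[OF y(1)] by (auto simp: I0_def)
          then show ?thesis using RX(4)[OF y(1)] by (auto simp: U_def)
        qed
        show "\<exists>k\<in>snd t. nb k" if t: "t \<in> A" for t
        proof -
          have tT: "t \<in> T" "d (fst t) = i - 1" using t by (auto simp: A_def)
          have tX: "fst t \<in> X" "rt (fst t) = r" using T_D(1)[OF tT(1)] by (auto simp: V_def)
          show ?thesis unfolding nb_def
            by (rule hcomps_touch[OF S(2)[OF tX(1)] touchU[OF tX tT(2)] T_D(2)[OF tT(1)]])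
        qed
        show "B \<subseteq> T" using BT by (auto simp: B_def)
        show "\<exists>s\<in>A. (t, s) \<in> R2" if t: "t \<in> B" for t
        proof -
          obtain v where v: "t = (v, S v)" "v \<in> Y" using t by (auto simp: B_def)
          have vX: "v \<in> X" "rt v = r" "d v = i" using v(2) by (auto simp: Y_def)
          have "d v = Suc (i - 1)" using vX(3) i2 by simp
          then obtain w where w: "(v, w) \<in> R" "d w = i - 1" "rt w = rt v" using parent by blast
          obtain p where p: "p \<in> S v" "p \<in> S w" using RX(4)[OF w(1)] by blast
          then have "p \<in> S w - U" using free[OF vX(1,3)] by blast
          then obtain Z where Z: "Z \<in> hcomps ?E (S w - U)" "p \<in> Z" using hcomps_cover by metis
          have "(w, Z) \<in> A" using w vX RX(2)[OF w(1)] Z(1) by (auto simp: A_def T_def V_def)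
          moreover have "(t, (w, Z)) \<in> R2"
            using calculation BT[OF v(2)] v(1) p(1) Z(2) RX(3)[OF w(1)] by (auto simp: R2_def A_def)
          ultimately show ?thesis by blast
        qed
        fix W assume W: "linked ?E W" "W \<subseteq> (\<Union>t\<in>T. snd t)"
        have WU: "U \<inter> W = {}" using W(2) T_D(4) by blast
        have WV: "W \<subseteq> pverts H"
        proof
          fix k assume "k \<in> W"
          then obtain t where t: "t \<in> T" "k \<in> snd t" using W(2) by blast
          then have "k \<in> S (fst t)" "fst t \<in> X" using T_D(1,3)[OF t(1)] VX by auto
          then show "k \<in> pverts H" using S(1) by blast
        qed
        have "I0 \<noteq> {}"
        proof -
          obtain k where "k \<in> W" using W(1) by (auto simp: linked_def)
          then obtain t where "t \<in> T" using W(2) by blast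
          then have v: "fst t \<in> X" "rt (fst t) = r" using T_D(1)[of t] by (auto simp: V_def)
          obtain x where "x \<in> X" "rt x = rt (fst t)" "d x = 0" using down[OF v(1), of 0] by auto
          then have "x \<in> I0" using v(2) by (simp add: I0_def)
          then show ?thesis by blast
        qed
        obtain f :: "'h \<Rightarrow> real" where f: "inj_on f {k \<in> W. \<exists>h\<in>U. (k, h) \<in> ?E}"
          "\<And>P Q a b c d. linked ?E P \<Longrightarrow> linked ?E Q \<Longrightarrow> P \<subseteq> W \<Longrightarrow> Q \<subseteq> W \<Longrightarrow> P \<inter> Q = {} \<Longrightarrow>
             a \<in> P \<Longrightarrow> b \<in> Q \<Longrightarrow> c \<in> P \<Longrightarrow> d \<in> Q \<Longrightarrow>
             \<forall>k\<in>{a, b, c, d}. \<exists>h\<in>U. (k, h) \<in> ?E \<Longrightarrow> f a < f b \<Longrightarrow> f b < f c \<Longrightarrow> f c < f d \<Longrightarrow> False"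
          by (rule ground_order[OF H(1) pl lU[OF \<open>I0 \<noteq> {}\<close>] US W(1) WV WU]) (rule that)
        show "\<exists>f :: 'h \<Rightarrow> real. inj_on f {k \<in> W. nb k} \<and>
          (\<forall>P Q p q p' q'. linked ?E P \<longrightarrow> linked ?E Q \<longrightarrow> P \<subseteq> W \<longrightarrow> Q \<subseteq> W \<longrightarrow> P \<inter> Q = {} \<longrightarrow>
            p \<in> P \<longrightarrow> q \<in> Q \<longrightarrow> p' \<in> P \<longrightarrow> q' \<in> Q \<longrightarrow> nb p \<longrightarrow> nb q \<longrightarrow> nb p' \<longrightarrow> nb q' \<longrightarrow>
            f p < f q \<longrightarrow> f q < f p' \<longrightarrow> f p' < f q' \<longrightarrow> False)"
        proof (intro exI[of _ f] conjI allI impI)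
          show "inj_on f {k \<in> W. nb k}" using f(1) by (simp add: nb_def)
          show False if *: "linked ?E P" "linked ?E Q" "P \<subseteq> W" "Q \<subseteq> W" "P \<inter> Q = {}" "p \<in> P" "q \<in> Q" "p' \<in> P" "q' \<in> Q"
             and nb: "nb p" "nb q" "nb p'" "nb q'" and **: "f p < f q" "f q < f p'" "f p' < f q'" for P Q p q p' q'
          proof -
            have "\<forall>k\<in>{p, q, p', q'}. \<exists>h\<in>U. (k, h) \<in> ?E" using nb by (simp add: nb_def)
            from f(2)[OF * this **] show False .
          qed
        qed
      qed
      obtain I where I: "I \<subseteq> B" "indep R2 I" "card B \<le> 6 * card I" using thB by (auto simp: thick_def)
      have inj: "inj_on fst B" by (auto simp: B_def inj_on_def)
      have "fst ` B = Y" by (auto simp: B_def image_iff)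
      then have "card Y = card B" using card_image[OF inj] by simp
      moreover have "card (fst ` I) = card I" by (rule card_image[OF inj_on_subset[OF inj I(1)]])
      moreover have "indep R (fst ` I)"
        unfolding indep_def
      proof (intro ballI notI)
        fix x y assume xy: "x \<in> fst ` I" "y \<in> fst ` I" "(x, y) \<in> R"
        then have "(x, S x) \<in> I" "(y, S y) \<in> I" using I(1) by (auto simp: B_def)
        moreover have "((x, S x), (y, S y)) \<in> R2"
          using calculation I(1) BT RX[OF xy(3)] by (auto simp: R2_def B_def)
        ultimately show False using I(2) by (auto simp: indep_def)
      qed
      moreover have "fst ` I \<subseteq> Y" using I(1) \<open>fst ` B = Y\<close> by blast
      ultimately show "thick R 6 Y" unfolding thick_def using I(3) by (intro exI[of _ "fst ` I"]) simp
    qed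
  qed
  then show ?thesis by simp
qed

section \<open>Bounds on the vertex cover number\<close>

definition alive :: "('a \<times> 'a) set \<Rightarrow> 'a set \<Rightarrow> ('a \<times> 'a) set" where
  "alive E D = {(u, v) \<in> E. u \<notin> D \<and> v \<notin> D}"

definition cover :: "nat \<Rightarrow> (nat \<times> nat) set \<Rightarrow> nat set \<Rightarrow> bool" where
  "cover n E S \<longleftrightarrow> S \<subseteq> {..<n} \<and> (\<forall>(u, v)\<in>E. u \<in> S \<or> v \<in> S)"

text \<open>The cyclic indexing is the form in which the program tests a tuple of vertices.\<close>

definition closed_walk :: "('a \<times> 'a) set \<Rightarrow> nat \<Rightarrow> (nat \<Rightarrow> 'a) \<Rightarrow> bool" where
  "closed_walk R L y \<longleftrightarrow> (\<forall>t<L. (y t, y (Suc t mod L)) \<in> R)"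

lemma closed_walk_of_relpow:
  assumes "(x, x) \<in> R ^^ L" "0 < L"
  shows "\<exists>y. closed_walk R L y"
proof -
  obtain f where f: "f 0 = x" "f L = x" "\<forall>i<L. (f i, f (Suc i)) \<in> R"
    using assms(1) by (auto simp: relpow_fun_conv)
  have "(f t, f (Suc t mod L)) \<in> R" if "t < L" for t
  proof (cases "Suc t = L")
    case True
    then show ?thesis using f that by (metis mod_self)
  next
    case False
    then show ?thesis using f(3) that by simp
  qed
  then show ?thesis unfolding closed_walk_def by blast
qed

lemma closed_walk_segment:
  assumes cw: "closed_walk R L y" and "a \<le> b" "b < L"
  shows "(y a, y b) \<in> R ^^ (b - a)" "(y b, y a) \<in> R ^^ (L - b + a)"
proof -
  have seg: "(y i, y (i + k)) \<in> R ^^ k" if "i + k < L" for i k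
    using that
  proof (induction k)
    case (Suc k)
    have "(y (i + k), y (Suc (i + k))) \<in> R"
      using cw[unfolded closed_walk_def, rule_format, of "i + k"] Suc(2) by simp
    then show ?case using Suc by (auto intro: relpow_Suc_I)
  qed simp
  show "(y a, y b) \<in> R ^^ (b - a)" using seg[of a "b - a"] assms by simp
  have "(y b, y (L - 1)) \<in> R ^^ (L - 1 - b)" using seg[of b "L - 1 - b"] assms by simp
  moreover have "(y (L - 1), y 0) \<in> R ^^ 1"
    using cw[unfolded closed_walk_def, rule_format, of "L - 1"] assms by simp
  moreover have "(y 0, y a) \<in> R ^^ a" using seg[of 0 a] assms by simp
  ultimately have w: "(y b, y a) \<in> R ^^ (L - 1 - b + 1 + a)" by (blast intro: relpow_trans)
  have "L - 1 - b + 1 + a = L - b + a" using assms by simp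
  from w[unfolded this] show "(y b, y a) \<in> R ^^ (L - b + a)" .
qed

text \<open>A repeated vertex splits the walk into two shorter closed walks whose lengths add up to
  the odd number \<open>L\<close>, so one of them is odd.\<close>

lemma shortest_odd_closed_walk_inj:
  assumes cw: "closed_walk R L y" and "odd L" and no: "\<And>k x. odd k \<Longrightarrow> k < L \<Longrightarrow> (x, x) \<notin> R ^^ k"
  shows "inj_on y {..<L}"
proof -
  have ne: "y a \<noteq> y b" if ab: "a < b" "b < L" for a b
  proof
    assume eq: "y a = y b"
    have w: "(y a, y a) \<in> R ^^ (b - a)" "(y a, y a) \<in> R ^^ (L - b + a)"
      using closed_walk_segment[OF cw, of a b] ab eq by simp_all
    have "(b - a) + (L - b + a) = L" using ab by simp
    then have "odd (b - a) \<or> odd (L - b + a)" using \<open>odd L\<close> by (metis even_add)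
    moreover have "b - a < L" "L - b + a < L" using ab by simp_all
    ultimately show False using no w by blast
  qed
  show ?thesis
  proof (rule inj_onI, rule ccontr)
    fix a b assume "a \<in> {..<L}" "b \<in> {..<L}" "y a = y b" "a \<noteq> b"
    then show False using ne[of a b] ne[of b a] by (cases "a < b") auto
  qed
qed

lemma Suc_mod_bij: "bij_betw (\<lambda>t. Suc t mod L) {..<L} {..<L}"
proof -
  have "inj_on (\<lambda>t. Suc t mod L) {..<L}"
    by (rule inj_onI) (auto simp: mod_Suc split: if_splits)
  moreover have "(\<lambda>t. Suc t mod L) ` {..<L} \<subseteq> {..<L}" by (cases "L = 0") auto
  ultimately show ?thesis unfolding bij_betw_def using endo_inj_surj[of "{..<L}"] by blast
qed

text \<open>Each of the \<open>L\<close> steps has an end in \<open>S\<close>, and each vertex of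
  the cycle is an end of two steps. This gives \<open>L\<close> on the left-hand side, and parity
  improves it by one.\<close>

lemma odd_cycle_cover:
  assumes cw: "closed_walk E L y" and "odd L" and inj: "inj_on y {..<L}"
    and S: "\<forall>(u, v)\<in>E. u \<in> S \<or> v \<in> S"
  shows "L + 1 \<le> 2 * card (S \<inter> y ` {..<L})"
proof -
  let ?s = "\<lambda>t. of_bool (y t \<in> S) :: nat"
  have "L = (\<Sum>t<L. 1)" by simp
  also have "\<dots> \<le> (\<Sum>t<L. ?s t + ?s (Suc t mod L))"
  proof (rule sum_mono)
    fix t assume "t \<in> {..<L}"
    then have "(y t, y (Suc t mod L)) \<in> E" using cw by (simp add: closed_walk_def)
    then have "y t \<in> S \<or> y (Suc t mod L) \<in> S" using S by blast
    then show "1 \<le> ?s t + ?s (Suc t mod L)" by auto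
  qed
  also have "\<dots> = (\<Sum>t<L. ?s t) + (\<Sum>t<L. ?s (Suc t mod L))" by (rule sum.distrib)
  also have "(\<Sum>t<L. ?s (Suc t mod L)) = (\<Sum>t<L. ?s t)"
    by (rule sum.reindex_bij_betw[OF Suc_mod_bij])
  also have "(\<Sum>t<L. ?s t) = card {t \<in> {..<L}. y t \<in> S}" by (simp add: of_bool_def sum.If_cases Int_def)
  also have "card {t \<in> {..<L}. y t \<in> S} = card (y ` {t \<in> {..<L}. y t \<in> S})"
    by (rule card_image[symmetric]) (rule inj_on_subset[OF inj], blast)
  also have "y ` {t \<in> {..<L}. y t \<in> S} = S \<inter> y ` {..<L}" by blast
  finally have "L \<le> 2 * card (S \<inter> y ` {..<L})" by simp
  then show ?thesis using \<open>odd L\<close> by presburger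
qed

text \<open>\<open>c\<close> sums \<open>L + 1\<close> over the deleted cycles. The factors 12 and
  11 fit because \<open>12 * L \<le> 11 * (L + 1)\<close> exactly when \<open>L \<le> 11\<close>.
  The lower bound is charged to \<open>S \<inter> D\<close>, so that it can be added to the bound
  for \<open>S - D\<close> obtained from the matching.\<close>

definition packed :: "nat \<Rightarrow> (nat \<times> nat) set \<Rightarrow> nat set \<Rightarrow> nat \<Rightarrow> bool" where
  "packed n E D c \<longleftrightarrow> D \<subseteq> {..<n} \<and> 12 * card D \<le> 11 * c \<and>
     (\<forall>S. cover n E S \<longrightarrow> c \<le> 2 * card (S \<inter> D))"

lemma packed_empty: "packed n E {} 0"
  by (simp add: packed_def)

lemma packed_step:
  assumes pk: "packed n E D c" and cw: "closed_walk (alive E D) L y" and L: "odd L" "L \<le> 11"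
    and y: "\<And>t. t < L \<Longrightarrow> y t < n"
    and no: "\<And>k x. odd k \<Longrightarrow> k < L \<Longrightarrow> (x, x) \<notin> alive E D ^^ k"
  shows "packed n E (D \<union> y ` {..<L}) (c + (L + 1))"
proof -
  have inj: "inj_on y {..<L}" by (rule shortest_odd_closed_walk_inj[OF cw L(1) no])
  have disj: "D \<inter> y ` {..<L} = {}" using cw by (auto simp: closed_walk_def alive_def)
  have finD: "finite D" using pk finite_subset by (auto simp: packed_def)
  have cwE: "closed_walk E L y" using cw by (auto simp: closed_walk_def alive_def)
  show ?thesis unfolding packed_def
  proof (intro conjI allI impI)
    show "D \<union> y ` {..<L} \<subseteq> {..<n}" using pk y by (auto simp: packed_def)
    have "card (D \<union> y ` {..<L}) = card D + L"
      using card_Un_disjoint[OF finD _ disj] card_image[OF inj] by simp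
    then show "12 * card (D \<union> y ` {..<L}) \<le> 11 * (c + (L + 1))" using pk L(2) by (simp add: packed_def)
    fix S assume S: "cover n E S"
    have "finite S" using S finite_subset by (auto simp: cover_def)
    then have "card (S \<inter> (D \<union> y ` {..<L})) = card (S \<inter> D) + card (S \<inter> y ` {..<L})"
      using disj by (subst card_Un_disjoint[symmetric]) (auto intro: arg_cong[where f = card])
    moreover have "L + 1 \<le> 2 * card (S \<inter> y ` {..<L})"
      using S by (intro odd_cycle_cover[OF cwE L(1) inj]) (simp add: cover_def)
    moreover have "c \<le> 2 * card (S \<inter> D)" using pk S by (simp add: packed_def)
    ultimately show "c + (L + 1) \<le> 2 * card (S \<inter> (D \<union> y ` {..<L}))" by simp
  qed
qed

text \<open>
  The auction: \<open>p j\<close> is the price of \<open>j\<close> and \<open>ow j\<close> its owner, shifted by one so that \<open>0\<close> means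
  that \<open>j\<close> has no owner. A bidder pays one more than the least price among its neighbours.
\<close>

definition auction :: "nat \<Rightarrow> (nat \<times> nat) set \<Rightarrow> (nat \<Rightarrow> nat) \<Rightarrow> (nat \<Rightarrow> nat) \<Rightarrow> bool" where
  "auction n R p ow \<longleftrightarrow>
     (\<forall>j<n. p j \<le> n + 1 \<and> (p j = 0 \<longleftrightarrow> ow j = 0)) \<and>
     (\<forall>j<n. \<forall>i. ow j = Suc i \<longrightarrow> (i, j) \<in> R \<and> (\<forall>j'<n. (i, j') \<in> R \<longrightarrow> p j \<le> Suc (p j'))) \<and>
     (\<forall>j<n. \<forall>j'<n. ow j = ow j' \<longrightarrow> 0 < ow j \<longrightarrow> j = j')"

definition happy :: "nat \<Rightarrow> (nat \<times> nat) set \<Rightarrow> (nat \<Rightarrow> nat) \<Rightarrow> (nat \<Rightarrow> nat) \<Rightarrow> nat \<Rightarrow> bool" where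
  "happy n R p ow i \<longleftrightarrow> (\<exists>j<n. ow j = Suc i) \<or> (\<forall>j<n. (i, j) \<in> R \<longrightarrow> n + 1 \<le> p j)"

lemma auctionD:
  assumes "auction n R p ow"
  shows "j < n \<Longrightarrow> p j \<le> n + 1" "j < n \<Longrightarrow> p j = 0 \<longleftrightarrow> ow j = 0"
    and "j < n \<Longrightarrow> ow j = Suc i \<Longrightarrow> (i, j) \<in> R"
    and "j < n \<Longrightarrow> ow j = Suc i \<Longrightarrow> j' < n \<Longrightarrow> (i, j') \<in> R \<Longrightarrow> p j \<le> Suc (p j')"
    and "j < n \<Longrightarrow> j' < n \<Longrightarrow> ow j = ow j' \<Longrightarrow> 0 < ow j \<Longrightarrow> j = j'"
proof -
  note 1 = assms[unfolded auction_def, THEN conjunct1, rule_format]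
  note 2 = assms[unfolded auction_def, THEN conjunct2, THEN conjunct1, rule_format]
  note 3 = assms[unfolded auction_def, THEN conjunct2, THEN conjunct2, rule_format]
  show "j < n \<Longrightarrow> p j \<le> n + 1" "j < n \<Longrightarrow> p j = 0 \<longleftrightarrow> ow j = 0" using 1 by simp_all
  show "j < n \<Longrightarrow> ow j = Suc i \<Longrightarrow> (i, j) \<in> R" using 2 by simp
  show "j < n \<Longrightarrow> ow j = Suc i \<Longrightarrow> j' < n \<Longrightarrow> (i, j') \<in> R \<Longrightarrow> p j \<le> Suc (p j')" using 2 by simp
  show "j < n \<Longrightarrow> j' < n \<Longrightarrow> ow j = ow j' \<Longrightarrow> 0 < ow j \<Longrightarrow> j = j'" by (rule 3)
qed

lemma auction_start: "auction n R (\<lambda>_. 0) (\<lambda>_. 0)"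
  by (simp add: auction_def)

text \<open>Prices only rise, and only that of \<open>b\<close>: owners of other goods find their
  alternatives no cheaper than before, and the new owner pays one more than the least price. A
  former owner of \<open>b\<close> loses it and becomes a bidder again.\<close>

lemma auction_step:
  assumes au: "auction n R p ow" and un: "\<And>j. j < n \<Longrightarrow> ow j \<noteq> Suc i"
    and b: "b < n" "(i, b) \<in> R" "\<And>j. j < n \<Longrightarrow> (i, j) \<in> R \<Longrightarrow> p b \<le> p j" "p b \<le> n"
  shows "auction n R (p(b := Suc (p b))) (ow(b := Suc i))"
proof -
  note au = auctionD[OF au]
  show ?thesis
    unfolding auction_def
  proof (intro conjI allI impI)
    fix j assume "j < n"
    then show "(p(b := Suc (p b))) j \<le> n + 1" "((p(b := Suc (p b))) j = 0) = ((ow(b := Suc i)) j = 0)"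
      using au(1)[of j] au(2)[of j] b(4) by auto
  next
    fix j i' assume j: "j < n" "(ow(b := Suc i)) j = Suc i'"
    show "(i', j) \<in> R" using au(3)[OF j(1), of i'] j(2) b(2) by (cases "j = b") auto
    fix j' assume j': "j' < n" "(i', j') \<in> R"
    show "(p(b := Suc (p b))) j \<le> Suc ((p(b := Suc (p b))) j')"
    proof (cases "j = b")
      case True
      then show ?thesis using j(2) b(3)[OF j'(1)] j'(2) by auto
    next
      case False
      then have "p j \<le> Suc (p j')" using au(4)[OF j(1), of i' j'] j(2) j' by simp
      then show ?thesis using False by (auto simp: le_SucI)
    qed
  next
    fix j j' assume *: "j < n" "j' < n" "(ow(b := Suc i)) j = (ow(b := Suc i)) j'" "0 < (ow(b := Suc i)) j"
    show "j = j'"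
      using * un[of j] un[of j'] au(5)[of j j'] by (auto split: if_splits)
  qed
qed

definition matched :: "nat \<Rightarrow> (nat \<Rightarrow> nat) \<Rightarrow> nat" where
  "matched n p = card {j \<in> {..<n}. 0 < p j}"

text \<open>The pairs of owner and good form a matching in the bipartite double cover. Two copies of
  \<open>S - D\<close>, one on each side, cover it, and each copied vertex covers at most one
  pair.\<close>

lemma auction_lower:
  assumes au: "auction n (alive E D) p ow" and S: "cover n E S"
  shows "matched n p \<le> 2 * card (S - D)"
proof -
  let ?M = "{j \<in> {..<n}. 0 < p j}"
  have finS: "finite (S - D)" using S finite_subset by (auto simp: cover_def)
  define g where "g j = ow j - 1" for j
  have M: "(g j, j) \<in> alive E D" "ow j = Suc (g j)" if "j \<in> ?M" for j
  proof -
    have "ow j \<noteq> 0" using that auctionD(2)[OF au, of j] by auto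
    then show "ow j = Suc (g j)" by (simp add: g_def)
    then show "(g j, j) \<in> alive E D" using that auctionD(3)[OF au] by auto
  qed
  have inj: "inj_on g {j \<in> ?M. g j \<in> S}"
  proof (rule inj_onI)
    fix j j' assume *: "j \<in> {j \<in> ?M. g j \<in> S}" "j' \<in> {j \<in> ?M. g j \<in> S}" "g j = g j'"
    then have "ow j = ow j'" "0 < ow j" using M(2)[of j] M(2)[of j'] by auto
    then show "j = j'" using auctionD(5)[OF au, of j j'] *(1,2) by simp
  qed
  have "?M \<subseteq> {j \<in> ?M. j \<in> S} \<union> {j \<in> ?M. g j \<in> S}"
    using M(1) S unfolding cover_def alive_def by blast
  then have "card ?M \<le> card ({j \<in> ?M. j \<in> S} \<union> {j \<in> ?M. g j \<in> S})" by (intro card_mono) auto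
  also have "\<dots> \<le> card {j \<in> ?M. j \<in> S} + card {j \<in> ?M. g j \<in> S}" by (rule card_Un_le)
  also have "card {j \<in> ?M. j \<in> S} \<le> card (S - D)"
    using M(1) by (intro card_mono[OF finS]) (auto simp: alive_def)
  also have "card {j \<in> ?M. g j \<in> S} \<le> card (S - D)"
  proof (rule card_inj_on_le[OF inj _ finS])
    show "g ` {j \<in> ?M. g j \<in> S} \<subseteq> S - D" using M(1) by (auto simp: alive_def)
  qed
  finally show ?thesis by (simp add: matched_def)
qed

text \<open>
  Some price level \<open>t\<close> is not taken. The goods above \<open>t\<close> and the owners of the goods below \<open>t\<close> cover
  all edges of the bipartite double cover.
\<close>

lemma auction_upper:
  assumes au: "auction n R p ow" and stable: "\<And>i. i < n \<Longrightarrow> happy n R p ow i" and R: "R \<subseteq> {..<n} \<times> {..<n}"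
  obtains X Y where "X \<subseteq> {..<n}" "Y \<subseteq> {..<n}" "card X + card Y = matched n p"
    "\<And>i j. (i, j) \<in> R \<Longrightarrow> i \<in> X \<or> j \<in> Y" "X \<subseteq> Field R" "Y \<subseteq> Field R"
proof -
  note au1 = auctionD(2)[OF au] and au2 = auctionD(3)[OF au] and au3 = auctionD(4)[OF au] and au4 = auctionD(5)[OF au]
  \<comment> \<open>Pigeonhole: \<open>n\<close> goods cannot take \<open>n + 1\<close> positive
    prices, which is why prices are allowed up to \<open>n + 1\<close>.\<close>
  have "\<not> {1..n + 1} \<subseteq> p ` {..<n}"
  proof
    assume "{1..n + 1} \<subseteq> p ` {..<n}"
    then have "card {1..n + 1} \<le> card (p ` {..<n})" by (intro card_mono) auto
    also have "\<dots> \<le> n" using card_image_le[of "{..<n}" p] by simp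
    finally show False by simp
  qed
  then obtain t where "t \<in> {1..n + 1}" and t3: "t \<notin> p ` {..<n}" by blast
  then have t: "1 \<le> t" "t \<le> n + 1" "t \<notin> p ` {..<n}" by simp_all
  define g where "g j = ow j - 1" for j
  define J where "J = {j \<in> {..<n}. 0 < p j \<and> p j < t}"
  define Y where "Y = {j \<in> {..<n}. t < p j}"
  have g: "ow j = Suc (g j)" if "j < n" "0 < p j" for j
    using au1[OF that(1)] that(2) by (cases "ow j") (auto simp: g_def)
  have gR: "(g j, j) \<in> R" if "j < n" "0 < p j" for j using au2[OF that(1) g[OF that]] .
  have inj: "inj_on g J"
  proof (rule inj_onI)
    fix j j' assume *: "j \<in> J" "j' \<in> J" "g j = g j'"
    then have "j < n" "j' < n" "0 < p j" "0 < p j'" by (auto simp: J_def)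
    then show "j = j'" using g[of j] g[of j'] *(3) au4[of j j'] by simp
  qed
  show thesis
  proof (rule that[of "g ` J" Y])
    show "g ` J \<subseteq> {..<n}" using gR R by (auto simp: J_def)
    show "Y \<subseteq> {..<n}" by (auto simp: Y_def)
    have "card (g ` J) + card Y = card (J \<union> Y)"
      unfolding card_image[OF inj] by (rule card_Un_disjoint[symmetric]) (auto simp: J_def Y_def)
    also have "J \<union> Y = {j \<in> {..<n}. 0 < p j}"
    proof (intro set_eqI iffI)
      fix j assume "j \<in> {j \<in> {..<n}. 0 < p j}"
      moreover have "p j \<noteq> t" if "j < n" using t(3) that by blast
      ultimately show "j \<in> J \<union> Y" by (auto simp: J_def Y_def)
    qed (use t(1) in \<open>auto simp: J_def Y_def\<close>)
    finally show "card (g ` J) + card Y = matched n p" by (simp add: matched_def)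
    show "g ` J \<subseteq> Field R" using gR by (auto simp: J_def Field_def)
    show "Y \<subseteq> Field R" using gR by (force simp: Y_def Field_def)
    fix i j assume ij: "(i, j) \<in> R"
    then have n: "i < n" "j < n" using R by auto
    show "i \<in> g ` J \<or> j \<in> Y"
    proof (rule ccontr)
      assume no: "\<not> ?thesis"
      have "p j \<noteq> t" using t(3) n(2) by blast
      then have pj: "p j < t" using no n(2) by (auto simp: Y_def)
      from stable[OF n(1)] show False unfolding happy_def
      proof
        assume "\<exists>j<n. ow j = Suc i"
        then obtain j' where j': "j' < n" "ow j' = Suc i" by blast
        \<comment> \<open>The owner paid at most one more than the price of \<open>j\<close>, hence
          at most \<open>t\<close>. As the price \<open>t\<close> does not occur, its good costs
          less than \<open>t\<close>, and the owner has been put into the cover.\<close>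
        have le: "p j' \<le> Suc (p j)" by (rule au3[OF j' n(2) ij])
        have "p j' \<noteq> t" using t(3) j'(1) by blast
        moreover have "p j' \<noteq> 0" using au1[OF j'(1)] j'(2) by simp
        ultimately have "j' \<in> J" using le pj j'(1) by (auto simp: J_def)
        moreover have "i = g j'" using j'(2) by (simp add: g_def)
        ultimately show False using no by blast
      next
        assume "\<forall>j<n. (i, j) \<in> R \<longrightarrow> n + 1 \<le> p j"
        then show False using ij n(2) pj t(2) by force
      qed
    qed
  qed
qed

text \<open>
  Vertices in \<open>X \<inter> Y\<close> have value \<open>1\<close>, those in exactly one of \<open>X\<close> and \<open>Y\<close> have value \<open>1/2\<close>. Rounding
  puts all of them into the cover except for a large independent set of vertices of value \<open>1/2\<close>.
\<close>

lemma half_integral_cover: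
  assumes pk: "packed n E D c" and sym: "sym E" and E: "E \<subseteq> {..<n} \<times> {..<n}"
    and au: "auction n (alive E D) p ow" and stable: "\<And>i. i < n \<Longrightarrow> happy n (alive E D) p ow i"
    and th: "\<And>X. X \<subseteq> {..<n} - D \<Longrightarrow> thick (E \<inter> X \<times> X) 12 X"
  obtains S where "cover n E S" "12 * card S \<le> 11 * (c + matched n p)"
proof -
  have R: "alive E D \<subseteq> {..<n} \<times> {..<n}" using E by (auto simp: alive_def)
  have F: "Field (alive E D) \<subseteq> {..<n} - D" using E by (auto simp: alive_def Field_def)
  obtain X Y where XY: "X \<subseteq> {..<n}" "Y \<subseteq> {..<n}" "card X + card Y = matched n p"
    "\<And>i j. (i, j) \<in> alive E D \<Longrightarrow> i \<in> X \<or> j \<in> Y" "X \<subseteq> Field (alive E D)" "Y \<subseteq> Field (alive E D)"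
    by (rule auction_upper[OF au stable R]) (assumption, rule that)
  define Z where "Z = (X \<union> Y) - (X \<inter> Y)"
  have ZD: "Z \<subseteq> {..<n} - D" using XY(5,6) F by (auto simp: Z_def)
  obtain I where I: "I \<subseteq> Z" "indep (E \<inter> Z \<times> Z) I" "card Z \<le> 12 * card I"
    using th[OF ZD] by (auto simp: thick_def)
  have fin: "finite X" "finite Y" "finite D" "finite Z" "finite I"
    using XY(1,2) pk ZD I(1) finite_subset[of _ "{..<n}"] by (auto simp: packed_def dest: finite_subset)
  define S where "S = D \<union> (X \<inter> Y) \<union> (Z - I)"
  have "cover n E S"
    unfolding cover_def
  proof
    show "S \<subseteq> {..<n}" using pk XY(1,2) ZD by (auto simp: S_def packed_def)
    have "u \<in> S \<or> v \<in> S" if uv: "(u, v) \<in> E" for u v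
    proof (rule ccontr)
      assume no: "\<not> ?thesis"
      have vu: "(v, u) \<in> E" using sym uv by (rule symD)
      have "(u, v) \<in> alive E D" "(v, u) \<in> alive E D" using no uv vu by (auto simp: alive_def S_def)
      \<comment> \<open>Both orientations of the edge occur in the double cover. Neither end is in
        \<open>X\<close> and \<open>Y\<close> at once, so both ends belong to \<open>X\<close> alone
        or both to \<open>Y\<close> alone.\<close>
      then have "u \<in> X \<or> v \<in> Y" "v \<in> X \<or> u \<in> Y" using XY(4) by blast+
      then have "u \<in> Z" "v \<in> Z" using no by (auto simp: Z_def S_def)
      moreover have "u \<in> I" "v \<in> I" using calculation no by (auto simp: S_def)
      ultimately show False using I(2)[unfolded indep_def, rule_format, of u v] uv by simp
    qed
    then show "\<forall>(u, v)\<in>E. u \<in> S \<or> v \<in> S" by blast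
  qed
  moreover have "12 * card S \<le> 11 * (c + matched n p)"
  proof -
    have "card S \<le> card D + card (X \<inter> Y) + card (Z - I)"
      unfolding S_def by (meson card_Un_le add_le_mono le_refl order_trans)
    moreover have "card (Z - I) + card I = card Z"
      using card_Diff_subset[OF fin(5) I(1)] card_mono[OF fin(4) I(1)] by simp
    moreover have "card X + card Y = card (X \<inter> Y) + card (X \<inter> Y) + card Z"
    proof -
      have "card X + card Y = card (X \<union> Y) + card (X \<inter> Y)" by (rule card_Un_Int[OF fin(1,2)])
      moreover have "card (X \<union> Y) = card (X \<inter> Y) + card Z"
        unfolding Z_def using fin(1,2) by (subst card_Un_disjoint[symmetric]) (auto intro: arg_cong[where f = card])
      ultimately show ?thesis by simp
    qed
    moreover have "12 * card D \<le> 11 * c" using pk by (simp add: packed_def)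
    \<comment> \<open>Twice the half-integral value is \<open>2 * v + z\<close>, for
      \<open>v\<close> vertices of value 1 and \<open>z\<close> of value 1/2. In the scaled count
      the former cost \<open>12 * v \<le> 22 * v\<close>, and the latter cost at most
      \<open>11 * z\<close> after a twelfth of them has been left out.\<close>
    moreover have "12 * s \<le> 11 * (c + m)"
      if "s \<le> d + v + w" "w + i = z" "x = v + v + z" "12 * d \<le> 11 * c" "z \<le> 12 * i" "x = m" for s d v w i z x m :: nat
    proof -
      have "12 * w \<le> 11 * z" "12 * s \<le> 12 * d + 12 * v + 12 * w" using that by linarith+
      then have "12 * s \<le> 11 * c + 12 * v + 11 * z" using that(4) by linarith
      moreover have "11 * (c + m) = 11 * c + 22 * v + 11 * z" using that(3,6) by simp
      ultimately show ?thesis by linarith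
    qed
    ultimately show ?thesis using I(3) XY(3) by metis
  qed
  ultimately show thesis by (rule that)
qed

section \<open>The program and its running time\<close>

lemma fold_fun_upd [simp]: "(\<lambda>a. if a = i then v else f a) = f(i := v)"
  by (simp add: fun_upd_def)

section \<open>A calculus of running times and the program text\<close>

definition runs :: "prog \<Rightarrow> memory \<Rightarrow> nat \<Rightarrow> (memory \<Rightarrow> bool) \<Rightarrow> bool" where
  "runs P m T Q \<longleftrightarrow> (\<exists>t m'. exec P m t m' \<and> t \<le> T \<and> Q m')"

lemma runs_mono:
  assumes "runs P m T Q" "T \<le> T'" "\<And>m. Q m \<Longrightarrow> Q' m"
  shows "runs P m T' Q'"
  using assms unfolding runs_def by (meson order_trans)

lemma runs_Seq:
  assumes "runs P m T Q" "\<And>m'. Q m' \<Longrightarrow> runs P' m' T' Q'"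
  shows "runs (Seq P P') m (T + T') Q'"
proof -
  obtain t m1 where 1: "exec P m t m1" "t \<le> T" "Q m1" using assms(1) by (auto simp: runs_def)
  obtain t' m2 where 2: "exec P' m1 t' m2" "t' \<le> T'" "Q' m2" using assms(2)[OF 1(3)] by (auto simp: runs_def)
  show ?thesis unfolding runs_def
    using exec.Seq[OF 1(1) 2(1)] 1(2) 2(2,3) by (intro exI[of _ "t + t'"] exI[of _ m2]) simp
qed

fun straight :: "prog \<Rightarrow> bool" where
  "straight Skip = True"
| "straight (Store a e) = True"
| "straight (Seq P Q) = (straight P \<and> straight Q)"
| "straight (Cond e P Q) = (straight P \<and> straight Q)"
| "straight (While e P) = False"

fun effect :: "prog \<Rightarrow> memory \<Rightarrow> memory" where
  "effect Skip m = m"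
| "effect (Store a e) m = m(expr_val a m := expr_val e m)"
| "effect (Seq P Q) m = effect Q (effect P m)"
| "effect (Cond e P Q) m = (if 0 < expr_val e m then effect P m else effect Q m)"
| "effect (While e P) m = m"

fun max_cost :: "prog \<Rightarrow> nat" where
  "max_cost Skip = 1"
| "max_cost (Store a e) = expr_cost a + expr_cost e + 1"
| "max_cost (Seq P Q) = max_cost P + max_cost Q"
| "max_cost (Cond e P Q) = expr_cost e + 1 + max (max_cost P) (max_cost Q)"
| "max_cost (While e P) = 0"

lemma exec_straight: "straight P \<Longrightarrow> \<exists>t\<le>max_cost P. exec P m t (effect P m)"
proof (induction P arbitrary: m)
  case (Seq P Q)
  obtain t where t: "t \<le> max_cost P" "exec P m t (effect P m)" using Seq by auto
  obtain t' where t': "t' \<le> max_cost Q" "exec Q (effect P m) t' (effect Q (effect P m))" using Seq by auto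
  show ?case using exec.Seq[OF t(2) t'(2)] t(1) t'(1) by (intro exI[of _ "t + t'"]) simp
next
  case (Cond e P Q)
  show ?case
  proof (cases "0 < expr_val e m")
    case True
    obtain t where t: "t \<le> max_cost P" "exec P m t (effect P m)" using Cond by auto
    show ?thesis using exec.Cond_True[OF True t(2), of Q] t(1) True
      by (intro exI[of _ "expr_cost e + 1 + t"]) simp
  next
    case False
    obtain t where t: "t \<le> max_cost Q" "exec Q m t (effect Q m)" using Cond by auto
    show ?thesis using exec.Cond_False[OF False t(2), of P] t(1) False
      by (intro exI[of _ "expr_cost e + 1 + t"]) simp
  qed
next
  case Skip
  show ?case using exec.Skip[of m] by (intro exI[of _ 1]) simp
next
  case (Store a e)
  show ?case using exec.Store[of a e m] by (intro exI[of _ "expr_cost a + expr_cost e + 1"]) simp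
qed simp

lemma runs_straight: "straight P \<Longrightarrow> Q (effect P m) \<Longrightarrow> runs P m (max_cost P) Q"
  using exec_straight[of P m] unfolding runs_def by blast

text \<open>
  Negative addresses hold sixteen interleaved arrays. Array \<open>0\<close> holds the scalar variables, array \<open>1\<close>
  the addresses of the rows of the adjacency matrix (there is no multiplication), array \<open>2\<close> marks
  deleted vertices, arrays \<open>3\<close> and \<open>4\<close> are the prices and owners of the auction. Variables up to
  \<open>10\<close> are loop counters, variable \<open>11\<close> is the lower bound on \<open>2 vc(G)\<close>.
\<close>

definition cell :: "int \<Rightarrow> int \<Rightarrow> int" where
  "cell q x = - 1 - q - 16 * x"

lemma cell_eq [simp]:
  assumes "0 \<le> q" "q < 16" "0 \<le> q'" "q' < 16"
  shows "cell q x = cell q' y \<longleftrightarrow> q = q' \<and> x = y"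
proof -
  have *: "(i + 16 * j) div 16 = j" if "0 \<le> i" "i < 16" for i j :: int
    using that by simp
  have "x = y" if "q + 16 * x = q' + 16 * y"
    using *[of q x] *[of q' y] assms that by simp
  then show ?thesis unfolding cell_def by auto
qed

lemma cell_neg: "0 \<le> q \<Longrightarrow> 0 \<le> x \<Longrightarrow> cell q x < 0"
  unfolding cell_def by simp

definition dbl :: "expr \<Rightarrow> expr" where "dbl e = Plus e e"

text \<open>Four doublings give the stride 16 of the interleaved arrays without
  multiplication.\<close>

definition addr :: "int \<Rightarrow> expr \<Rightarrow> expr" where
  "addr q e = Minus (Num (- 1 - q)) (dbl (dbl (dbl (dbl e))))"

definition var :: "nat \<Rightarrow> expr" where "var j = Load (Num (cell 0 (int j)))"

definition assign :: "nat \<Rightarrow> expr \<Rightarrow> prog" where "assign j e = Store (Num (cell 0 (int j))) e"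

lemma expr_val_addr [simp]: "expr_val (addr q e) m = cell q (expr_val e m)"
  by (simp add: addr_def dbl_def cell_def)

lemma expr_val_var [simp]: "expr_val (var j) m = m (cell 0 (int j))"
  by (simp add: var_def)

lemma effect_assign [simp]: "effect (assign j e) m = m(cell 0 (int j) := expr_val e m)"
  and straight_assign [simp]: "straight (assign j e)"
  by (simp_all add: assign_def)

definition guard :: "expr list \<Rightarrow> prog \<Rightarrow> prog" where
  "guard es P = foldr (\<lambda>e P. Cond e P Skip) es P"

lemma straight_guard [simp]: "straight (guard es P) = straight P"
  unfolding guard_def by (induction es) auto

lemma effect_guard [simp]:
  "effect (guard es P) m = (if \<forall>e\<in>set es. 0 < expr_val e m then effect P m else m)"
  unfolding guard_def by (induction es) auto

definition loop :: "nat \<Rightarrow> expr \<Rightarrow> prog \<Rightarrow> prog" where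
  "loop j e P = Seq (assign j (Num 0)) (While (Minus e (var j)) (Seq P (assign j (Plus (var j) (Num 1)))))"

text \<open>The initial assignment takes 3 steps, each test \<open>expr_cost e + 4\<close>,
  including the last one that fails, and each increment 6.\<close>

definition loop_cost :: "expr \<Rightarrow> nat \<Rightarrow> nat \<Rightarrow> nat" where
  "loop_cost e N T = expr_cost e + 7 + N * (expr_cost e + 10 + T)"

text \<open>The invariant is stated for the memory after the update of the counter, so that it may
  or may not speak about the counter. The body has to leave the counter as it was, and since the
  bound \<open>e\<close> is evaluated anew in every round, the invariant has to fix its
  value.\<close>

lemma runs_loop:
  assumes start: "I 0 (m(cell 0 (int j) := 0))"
    and step: "\<And>i m. i < N \<Longrightarrow> I i m \<Longrightarrow> m (cell 0 (int j)) = int i \<Longrightarrow>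
      runs P m T (\<lambda>m'. m' (cell 0 (int j)) = int i \<and> I (Suc i) (m'(cell 0 (int j) := int (Suc i))))"
    and bound: "\<And>i m. i \<le> N \<Longrightarrow> I i m \<Longrightarrow> expr_val e m = int N"
    and final: "\<And>m. I N m \<Longrightarrow> Q m"
  shows "runs (loop j e P) m (loop_cost e N T) Q"
proof -
  let ?B = "Seq P (assign j (Plus (var j) (Num 1)))"
  let ?W = "While (Minus e (var j)) ?B"
  have W: "runs ?W m (expr_cost e + 4 + (N - i) * (expr_cost e + 10 + T)) Q"
    if "i \<le> N" "I i m" "m (cell 0 (int j)) = int i" for i m
    using that
  proof (induction "N - i" arbitrary: i m)
    case 0
    then have "i = N" by simp
    then have "\<not> 0 < expr_val (Minus e (var j)) m" using bound[OF 0(2,3)] 0(4) by simp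
    from exec.While_False[OF this, of ?B] show ?case
      unfolding runs_def using final[of m] 0(3) \<open>i = N\<close> by (intro exI conjI) (auto simp: var_def)
  next
    case (Suc d)
    have i: "i < N" using Suc(2) by simp
    have pos: "0 < expr_val (Minus e (var j)) m" using bound[OF Suc(3,4)] Suc(5) i by simp
    obtain t1 m1 where 1: "exec P m t1 m1" "t1 \<le> T" "m1 (cell 0 (int j)) = int i"
      "I (Suc i) (m1(cell 0 (int j) := int (Suc i)))"
      using step[OF i Suc(4,5)] unfolding runs_def by blast
    let ?m2 = "m1(cell 0 (int j) := int (Suc i))"
    have 2: "exec (assign j (Plus (var j) (Num 1))) m1 6 ?m2"
      using exec.Store[of "Num (cell 0 (int j))" "Plus (var j) (Num 1)" m1] 1(3)
      by (simp add: assign_def var_def add.commute eval_nat_numeral)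
    have "runs ?W ?m2 (expr_cost e + 4 + (N - Suc i) * (expr_cost e + 10 + T)) Q"
      using Suc(2) i 1(4) by (intro Suc(1)) auto
    then obtain t3 m3 where 3: "exec ?W ?m2 t3 m3" "t3 \<le> expr_cost e + 4 + (N - Suc i) * (expr_cost e + 10 + T)" "Q m3"
      unfolding runs_def by blast
    have "exec ?W m (expr_cost (Minus e (var j)) + 1 + (t1 + 6) + t3) m3"
      using exec.While_True[OF pos exec.Seq[OF 1(1) 2] 3(1)] .
    moreover have "expr_cost (Minus e (var j)) + 1 + (t1 + 6) + t3 \<le> expr_cost e + 4 + (N - i) * (expr_cost e + 10 + T)"
    proof -
      have "N - i = Suc (N - Suc i)" using i by simp
      then show ?thesis using 1(2) 3(2) by (simp add: var_def)
    qed
    ultimately show ?case unfolding runs_def using 3(3) by blast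
  qed
  have "runs (assign j (Num 0)) m 3 (\<lambda>m'. m' = m(cell 0 (int j) := 0))"
    unfolding runs_def using exec.Store[of "Num (cell 0 (int j))" "Num 0" m]
    by (intro exI conjI) (auto simp: assign_def)
  then have "runs (loop j e P) m (3 + (expr_cost e + 4 + (N - 0) * (expr_cost e + 10 + T))) Q"
    unfolding loop_def by (rule runs_Seq) (rule W, use start in auto)
  moreover have "3 + (expr_cost e + 4 + (N - 0) * (expr_cost e + 10 + T)) = loop_cost e N T"
    by (simp add: loop_cost_def)
  ultimately show ?thesis by simp
qed

definition adjE :: "expr \<Rightarrow> expr \<Rightarrow> expr" where "adjE a b = Load (Plus (Load (addr 1 a)) b)"

definition kill :: "nat \<Rightarrow> prog" where
  "kill L = foldr (\<lambda>t. Seq (Store (addr 2 (var t)) (Num 1))) [0..<L] (assign 11 (Plus (var 11) (Num (int L + 1))))"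

text \<open>The \<open>L\<close> entries are not compared with each other: at the time of the test
  no shorter odd closed walk survives, and this makes them distinct. Testing for deleted vertices
  skips tuples that share a vertex with a cycle removed before.\<close>

definition remove_cycle :: "nat \<Rightarrow> prog" where
  "remove_cycle L = guard (map (\<lambda>t. Minus (Num 1) (Load (addr 2 (var t)))) [0..<L] @
     map (\<lambda>t. adjE (var t) (var (Suc t mod L))) [0..<L]) (kill L)"

text \<open>One loop for each vertex of the tuple. The depth is at most 11, so there are
  polynomially many tuples, and the counters 0 to 10 stay clear of variable 11.\<close>

primrec nest :: "nat \<Rightarrow> prog \<Rightarrow> prog" where
  "nest 0 P = P"
| "nest (Suc d) P = loop d (Load (Num 0)) (nest d P)"

primrec nest_cost :: "nat \<Rightarrow> nat \<Rightarrow> nat \<Rightarrow> nat" where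
  "nest_cost n 0 T = T"
| "nest_cost n (Suc d) T = loop_cost (Load (Num 0)) n (nest_cost n d T)"

definition stage :: "nat \<Rightarrow> prog" where "stage L = nest L (remove_cycle L)"

text \<open>
  For the bidder in variable \<open>2\<close>, variable \<open>12\<close> tells whether it already owns something, and variable
  \<open>13\<close> is its cheapest neighbour so far plus one, or \<open>0\<close>.
\<close>

definition scan :: prog where
  "scan = Seq
    (guard [Minus (Load (addr 4 (var 3))) (var 2), Minus (Plus (var 2) (Num 2)) (Load (addr 4 (var 3)))] (assign 12 (Num 1)))
    (guard [Minus (Num 1) (Load (addr 2 (var 2))), Minus (Num 1) (Load (addr 2 (var 3))), adjE (var 2) (var 3)]
      (Cond (var 13)
        (guard [Minus (Load (addr 3 (Minus (var 13) (Num 1)))) (Load (addr 3 (var 3)))] (assign 13 (Plus (var 3) (Num 1))))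
        (assign 13 (Plus (var 3) (Num 1)))))"

definition act :: prog where
  "act = guard [Minus (Num 1) (var 12), var 13, Minus (Plus (Load (Num 0)) (Num 1)) (Load (addr 3 (Minus (var 13) (Num 1))))]
    (Seq (Store (addr 4 (Minus (var 13) (Num 1))) (Plus (var 2) (Num 1)))
      (Store (addr 3 (Minus (var 13) (Num 1))) (Plus (Load (addr 3 (Minus (var 13) (Num 1)))) (Num 1))))"

definition bid :: prog where
  "bid = Seq (Seq (assign 12 (Num 0)) (assign 13 (Num 0))) (Seq (loop 3 (Load (Num 0)) scan) act)"

text \<open>
  A pass without a sale leaves everybody happy, and the sum of the prices bounds the number of sales
  by \<open>n (n + 1)\<close>; hence \<open>(n + 1)\<^sup>2\<close> passes suffice.
\<close>

definition auction_prog :: prog where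
  "auction_prog = loop 0 (Plus (Load (Num 0)) (Num 1)) (loop 1 (Plus (Load (Num 0)) (Num 1))
     (loop 2 (Load (Num 0)) bid))"

definition init :: prog where
  "init = Seq (assign 12 (Num 2)) (loop 0 (Load (Num 0))
     (Seq (Store (addr 1 (var 0)) (var 12)) (assign 12 (Plus (var 12) (Load (Num 0))))))"

definition finish :: prog where
  "finish = Seq (loop 0 (Load (Num 0)) (guard [Load (addr 3 (var 0))] (assign 11 (Plus (var 11) (Num 1)))))
    (Cond (Minus (Plus (Plus (Load (Num 1)) (Load (Num 1))) (Num 1)) (var 11)) (Store (Num 0) (Num 1)) (Store (Num 0) (Num 2)))"

definition main :: prog where
  "main = Seq init (Seq (stage 3) (Seq (stage 5) (Seq (stage 7) (Seq (stage 9) (Seq (stage 11)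
     (Seq auction_prog finish))))))"

section \<open>The memory invariant and the removal of short odd cycles\<close>

locale machine =
  fixes n :: nat and E :: "(nat \<times> nat) set" and k :: int
  assumes E_sub: "E \<subseteq> {..<n} \<times> {..<n}" and irrefl: "no_short_odd 1 E"
begin

text \<open>Apart from variable 11 the scalar variables are left open, so that counters and scratch
  variables can be written without disturbing the invariant.\<close>

definition rep :: "nat set \<Rightarrow> (nat \<Rightarrow> nat) \<Rightarrow> (nat \<Rightarrow> nat) \<Rightarrow> nat \<Rightarrow> memory \<Rightarrow> bool" where
  "rep D p ow c m \<longleftrightarrow> m 0 = int n \<and> m 1 = k \<and>
     (\<forall>u<n. \<forall>v<n. m (2 + int u * int n + int v) = of_bool ((u, v) \<in> E)) \<and>
     (\<forall>u<n. m (cell 1 (int u)) = 2 + int u * int n) \<and>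
     (\<forall>v<n. m (cell 2 (int v)) = of_bool (v \<in> D)) \<and>
     (\<forall>v<n. m (cell 3 (int v)) = int (p v)) \<and>
     (\<forall>v<n. m (cell 4 (int v)) = int (ow v)) \<and>
     m (cell 0 11) = int c"

lemma repD:
  assumes "rep D p ow c m"
  shows "m 0 = int n" "m 1 = k" "u < n \<Longrightarrow> v < n \<Longrightarrow> m (2 + int u * int n + int v) = of_bool ((u, v) \<in> E)"
    "u < n \<Longrightarrow> m (cell 1 (int u)) = 2 + int u * int n" "v < n \<Longrightarrow> m (cell 2 (int v)) = of_bool (v \<in> D)"
    "v < n \<Longrightarrow> m (cell 3 (int v)) = int (p v)" "v < n \<Longrightarrow> m (cell 4 (int v)) = int (ow v)" "m (cell 0 11) = int c"
  using assms unfolding rep_def by simp_all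

lemma cell_ne [simp]:
  "0 \<le> q \<Longrightarrow> 0 \<le> x \<Longrightarrow> cell q x \<noteq> 0" "0 \<le> q \<Longrightarrow> 0 \<le> x \<Longrightarrow> cell q x \<noteq> 1"
  "0 \<le> q \<Longrightarrow> 0 \<le> x \<Longrightarrow> cell q x \<noteq> 2 + int u * int v + int w"
  "0 \<le> q \<Longrightarrow> 0 \<le> x \<Longrightarrow> 0 \<noteq> cell q x" "0 \<le> q \<Longrightarrow> 0 \<le> x \<Longrightarrow> 1 \<noteq> cell q x"
  "0 \<le> q \<Longrightarrow> 0 \<le> x \<Longrightarrow> 2 + int u * int v + int w \<noteq> cell q x"
proof -
  assume *: "0 \<le> q" "0 \<le> x"
  have "cell q x < 0" using * by (rule cell_neg)
  moreover have "0 \<le> 2 + int u * int v + int w" by simp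
  ultimately show "cell q x \<noteq> 0" "cell q x \<noteq> 1" "cell q x \<noteq> 2 + int u * int v + int w"
    "0 \<noteq> cell q x" "1 \<noteq> cell q x" "2 + int u * int v + int w \<noteq> cell q x" by linarith+
qed

lemma rep_scalar [simp]:
  assumes "j \<noteq> 11" "0 \<le> j"
  shows "rep D p ow c (m(cell 0 j := x)) = rep D p ow c m"
  unfolding rep_def using assms by simp

lemma rep_dead:
  assumes "rep D p ow c m" "u < n" shows "rep (insert u D) p ow c (m(cell 2 (int u) := 1))"
  using assms unfolding rep_def by simp

lemma rep_count:
  assumes "rep D p ow c m" "x = int c'" shows "rep D p ow c' (m(cell 0 11 := x))"
  using assms unfolding rep_def by simp

lemma rep_sell:
  assumes "rep D p ow c m" "b < n"
  shows "rep D (p(b := x)) (ow(b := y)) c (m(cell 4 (int b) := int y, cell 3 (int b) := int x))"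
  using assms unfolding rep_def by simp

lemma adjE_val:
  assumes "rep D p ow c m" "expr_val a m = int u" "expr_val b m = int v" "u < n" "v < n"
  shows "expr_val (adjE a b) m = of_bool ((u, v) \<in> E)"
  using assms(2-) repD[OF assms(1)] by (simp add: adjE_def)

end

lemma alive_mono: "D \<subseteq> D' \<Longrightarrow> alive E D' \<subseteq> alive E D"
  by (auto simp: alive_def)

lemma closed_walk_mono: "closed_walk R L y \<Longrightarrow> R \<subseteq> R' \<Longrightarrow> closed_walk R' L y"
  by (auto simp: closed_walk_def)

lemma no_short_odd_mono: "no_short_odd N R \<Longrightarrow> R' \<subseteq> R \<Longrightarrow> no_short_odd N R'"
  by (erule no_short_odd_map[where h = "\<lambda>x. x"]) blast

context machine
begin

lemma effect_kill:
  assumes L: "L \<le> 11" and m: "rep D p ow c m" "\<And>t. t < L \<Longrightarrow> m (cell 0 (int t)) = int (x t)"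
    and x: "\<And>t. t < L \<Longrightarrow> x t < n"
  shows "rep (D \<union> x ` {..<L}) p ow (c + (L + 1)) (effect (kill L) m) \<and>
    (\<forall>t<L. effect (kill L) m (cell 0 (int t)) = int (x t))"
proof -
  have "rep (D \<union> x ` set ts) p ow (c + (L + 1))
      (effect (foldr (\<lambda>t. Seq (Store (addr 2 (var t)) (Num 1))) ts (assign 11 (Plus (var 11) (Num (int L + 1))))) m) \<and>
    (\<forall>t<L. effect (foldr (\<lambda>t. Seq (Store (addr 2 (var t)) (Num 1))) ts (assign 11 (Plus (var 11) (Num (int L + 1))))) m
       (cell 0 (int t)) = int (x t))"
    if "set ts \<subseteq> {..<L}" "rep D p ow c m" "\<And>t. t < L \<Longrightarrow> m (cell 0 (int t)) = int (x t)" for ts D m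
    using that
  proof (induction ts arbitrary: D m)
    case Nil
    have "rep D p ow (c + (L + 1)) (m(cell 0 11 := m (cell 0 11) + (int L + 1)))"
      using repD(8)[OF Nil(2)] by (intro rep_count[OF Nil(2)]) simp
    then show ?case using Nil(3) L by simp
  next
    case (Cons t ts)
    have t: "t < L" using Cons(2) by simp
    let ?m = "m(cell 2 (int (x t)) := 1)"
    have "rep (insert (x t) D) p ow c ?m" by (rule rep_dead[OF Cons(3) x[OF t]])
    moreover have "?m (cell 0 (int s)) = int (x s)" if "s < L" for s using Cons(4)[OF that] by simp
    ultimately show ?case using Cons(1)[of "insert (x t) D" ?m] Cons(2) Cons(4)[OF t] by simp
  qed
  from this[of "[0..<L]" D m] m show ?thesis by (simp add: kill_def atLeast0LessThan)
qed

lemma effect_remove_cycle: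
  assumes L: "L \<le> 11" and m: "rep D p ow c m" "\<And>t. t < L \<Longrightarrow> m (cell 0 (int t)) = int (x t)"
    and x: "\<And>t. t < L \<Longrightarrow> x t < n"
  shows "effect (remove_cycle L) m = (if closed_walk (alive E D) L x then effect (kill L) m else m)"
proof -
  have *: "Suc t mod L < L" if "t < L" for t using that by simp
  have 1: "0 < expr_val (Minus (Num 1) (Load (addr 2 (var t)))) m \<longleftrightarrow> x t \<notin> D" if "t < L" for t
    using repD(5)[OF m(1) x[OF that]] m(2)[OF that] by simp
  have 2: "0 < expr_val (adjE (var t) (var (Suc t mod L))) m \<longleftrightarrow> (x t, x (Suc t mod L)) \<in> E" if "t < L" for t
  proof -
    have "expr_val (adjE (var t) (var (Suc t mod L))) m = of_bool ((x t, x (Suc t mod L)) \<in> E)"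
      by (rule adjE_val[OF m(1)]) (use m(2)[OF that] m(2)[OF *[OF that]] x[OF that] x[OF *[OF that]] in simp_all)
    then show ?thesis by simp
  qed
  have "(\<forall>t<L. x t \<notin> D) \<and> (\<forall>t<L. (x t, x (Suc t mod L)) \<in> E) \<longleftrightarrow> closed_walk (alive E D) L x"
    using * unfolding closed_walk_def alive_def by auto
  moreover have "(\<forall>e\<in>set (map (\<lambda>t. Minus (Num 1) (Load (addr 2 (var t)))) [0..<L] @
       map (\<lambda>t. adjE (var t) (var (Suc t mod L))) [0..<L]). 0 < expr_val e m) \<longleftrightarrow>
     (\<forall>t<L. x t \<notin> D) \<and> (\<forall>t<L. (x t, x (Suc t mod L)) \<in> E)"
    using 1 2 by (simp only: set_append set_map ball_Un ball_simps set_upt atLeast0LessThan Ball_def lessThan_iff) blast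
  ultimately show ?thesis unfolding remove_cycle_def effect_guard by simp
qed

lemma straight_remove_cycle: "straight (remove_cycle L)"
proof -
  have "straight (foldr (\<lambda>t. Seq (Store (addr 2 (var t)) (Num 1))) ts (assign 11 e))" for ts e
    by (induction ts) auto
  then show ?thesis by (simp add: remove_cycle_def kill_def)
qed

text \<open>The induction fixes the counters from \<open>d\<close> on to the values of
  \<open>x\<close>; afterwards no closed walk that agrees with them survives. Tuples processed
  earlier need not be revisited, because further deletions only shrink \<open>alive E D\<close>. The
  hypothesis for \<open>L - 2\<close> makes any closed walk that is found a shortest odd one, as
  \<open>packed_step\<close> requires.\<close>

lemma nest_correct:
  assumes L: "odd L" "L \<le> 11"
  shows "d \<le> L \<Longrightarrow> rep D p ow c m \<Longrightarrow> packed n E D c \<Longrightarrow> no_short_odd (L - 2) (alive E D) \<Longrightarrow>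
    (\<And>t. d \<le> t \<Longrightarrow> t < L \<Longrightarrow> m (cell 0 (int t)) = int (x t) \<and> x t < n) \<Longrightarrow>
    runs (nest d (remove_cycle L)) m (nest_cost n d (max_cost (remove_cycle L)))
      (\<lambda>m'. \<exists>D' c'. rep D' p ow c' m' \<and> D \<subseteq> D' \<and> packed n E D' c' \<and>
        (\<forall>t. d \<le> t \<and> t < L \<longrightarrow> m' (cell 0 (int t)) = int (x t)) \<and>
        (\<forall>y. (\<forall>t<d. y t < n) \<longrightarrow> (\<forall>t. d \<le> t \<and> t < L \<longrightarrow> y t = x t) \<longrightarrow> \<not> closed_walk (alive E D') L y))"
proof (induction d arbitrary: D c m x)
  case 0
  have x: "\<And>t. t < L \<Longrightarrow> m (cell 0 (int t)) = int (x t)" "\<And>t. t < L \<Longrightarrow> x t < n" using 0(5) by auto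
  let ?m = "effect (remove_cycle L) m"
  have same: "closed_walk (alive E D') L y \<longleftrightarrow> closed_walk (alive E D') L x"
    if "\<forall>t. 0 \<le> t \<and> t < L \<longrightarrow> y t = x t" for y D'
  proof -
    have "Suc t mod L < L" if "t < L" for t using that by simp
    then show ?thesis using that unfolding closed_walk_def by simp
  qed
  show ?case unfolding nest.simps nest_cost.simps
  proof (rule runs_straight[OF straight_remove_cycle])
    show "\<exists>D' c'. rep D' p ow c' ?m \<and> D \<subseteq> D' \<and> packed n E D' c' \<and>
        (\<forall>t. 0 \<le> t \<and> t < L \<longrightarrow> ?m (cell 0 (int t)) = int (x t)) \<and>
        (\<forall>y. (\<forall>t<0. y t < n) \<longrightarrow> (\<forall>t. 0 \<le> t \<and> t < L \<longrightarrow> y t = x t) \<longrightarrow> \<not> closed_walk (alive E D') L y)"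
    proof (cases "closed_walk (alive E D) L x")
      case True
      have eff: "?m = effect (kill L) m" using effect_remove_cycle[OF L(2) 0(2) x] True by simp
      have K: "rep (D \<union> x ` {..<L}) p ow (c + (L + 1)) ?m" "\<forall>t<L. ?m (cell 0 (int t)) = int (x t)"
        using effect_kill[OF L(2) 0(2) x] unfolding eff by simp_all
      have no: "(z, z) \<notin> alive E D ^^ j" if "odd j" "j < L" for j z
      proof -
        have "j \<le> L - 2" using that L(1) by presburger
        then show ?thesis using 0(4) that(1) unfolding no_short_odd_def by blast
      qed
      have pk: "packed n E (D \<union> x ` {..<L}) (c + (L + 1))"
        by (rule packed_step[OF 0(3) True L x(2) no])
      have "0 < L" using L(1) by (cases L) auto
      then have dead: "\<not> closed_walk (alive E (D \<union> x ` {..<L})) L x"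
        unfolding closed_walk_def alive_def by auto
      show ?thesis
      proof (intro exI conjI)
        show "\<forall>y. (\<forall>t<0. y t < n) \<longrightarrow> (\<forall>t. 0 \<le> t \<and> t < L \<longrightarrow> y t = x t) \<longrightarrow>
          \<not> closed_walk (alive E (D \<union> x ` {..<L})) L y"
        proof (intro allI impI)
          fix y assume *: "\<forall>t. 0 \<le> t \<and> t < L \<longrightarrow> y t = x t"
          show "\<not> closed_walk (alive E (D \<union> x ` {..<L})) L y" unfolding same[OF *] by (rule dead)
        qed
      qed (use K pk in simp_all)
    next
      case False
      have eff: "?m = m" using effect_remove_cycle[OF L(2) 0(2) x] False by simp
      show ?thesis unfolding eff
      proof (intro exI conjI)
        show "\<forall>y. (\<forall>t<0. y t < n) \<longrightarrow> (\<forall>t. 0 \<le> t \<and> t < L \<longrightarrow> y t = x t) \<longrightarrow> \<not> closed_walk (alive E D) L y"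
        proof (intro allI impI)
          fix y assume *: "\<forall>t. 0 \<le> t \<and> t < L \<longrightarrow> y t = x t"
          show "\<not> closed_walk (alive E D) L y" unfolding same[OF *] by (rule False)
        qed
      qed (use 0 x in simp_all)
    qed
  qed
next
  case (Suc d)
  define I where "I i m \<longleftrightarrow> (\<exists>D' c'. rep D' p ow c' m \<and> D \<subseteq> D' \<and> packed n E D' c' \<and>
        (\<forall>t. Suc d \<le> t \<and> t < L \<longrightarrow> m (cell 0 (int t)) = int (x t)) \<and>
        (\<forall>y. (\<forall>t<d. y t < n) \<longrightarrow> y d < i \<longrightarrow> (\<forall>t. Suc d \<le> t \<and> t < L \<longrightarrow> y t = x t) \<longrightarrow>
           \<not> closed_walk (alive E D') L y))" for i m
  have d: "d < L" "int d \<noteq> 11" "d \<le> L" using Suc(2) L(2) by auto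
  show ?case unfolding nest.simps nest_cost.simps
  proof (rule runs_loop[where I = I])
    show "I 0 (m(cell 0 (int d) := 0))"
      unfolding I_def using Suc(3,4,6) d by (intro exI[of _ D] exI[of _ c]) auto
    show "expr_val (Load (Num 0)) m = int n" if "I i m" for i m
      using that repD(1) by (auto simp: I_def)
    fix m assume "I n m"
    then obtain D' c' where *: "rep D' p ow c' m" "D \<subseteq> D'" "packed n E D' c'"
        "\<forall>t. Suc d \<le> t \<and> t < L \<longrightarrow> m (cell 0 (int t)) = int (x t)"
        "\<forall>y. (\<forall>t<d. y t < n) \<longrightarrow> y d < n \<longrightarrow> (\<forall>t. Suc d \<le> t \<and> t < L \<longrightarrow> y t = x t) \<longrightarrow>
           \<not> closed_walk (alive E D') L y" unfolding I_def by blast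
    have "\<forall>y. (\<forall>t<Suc d. y t < n) \<longrightarrow> (\<forall>t. Suc d \<le> t \<and> t < L \<longrightarrow> y t = x t) \<longrightarrow> \<not> closed_walk (alive E D') L y"
      using *(5) by (simp add: less_Suc_eq)
    then show "\<exists>D' c'. rep D' p ow c' m \<and> D \<subseteq> D' \<and> packed n E D' c' \<and>
        (\<forall>t. Suc d \<le> t \<and> t < L \<longrightarrow> m (cell 0 (int t)) = int (x t)) \<and>
        (\<forall>y. (\<forall>t<Suc d. y t < n) \<longrightarrow> (\<forall>t. Suc d \<le> t \<and> t < L \<longrightarrow> y t = x t) \<longrightarrow> \<not> closed_walk (alive E D') L y)"
      using *(1-4) by blast
  next
    fix i m assume i: "i < n" and Im: "I i m" and mi: "m (cell 0 (int d)) = int i"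
    obtain D1 c1 where 1: "rep D1 p ow c1 m" "D \<subseteq> D1" "packed n E D1 c1"
        "\<forall>t. Suc d \<le> t \<and> t < L \<longrightarrow> m (cell 0 (int t)) = int (x t)"
        "\<forall>y. (\<forall>t<d. y t < n) \<longrightarrow> y d < i \<longrightarrow> (\<forall>t. Suc d \<le> t \<and> t < L \<longrightarrow> y t = x t) \<longrightarrow>
           \<not> closed_walk (alive E D1) L y" using Im unfolding I_def by blast
    have no1: "no_short_odd (L - 2) (alive E D1)"
      by (rule no_short_odd_mono[OF Suc(5) alive_mono[OF 1(2)]])
    have "runs (nest d (remove_cycle L)) m (nest_cost n d (max_cost (remove_cycle L)))
      (\<lambda>m'. \<exists>D' c'. rep D' p ow c' m' \<and> D1 \<subseteq> D' \<and> packed n E D' c' \<and>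
        (\<forall>t. d \<le> t \<and> t < L \<longrightarrow> m' (cell 0 (int t)) = int ((x(d := i)) t)) \<and>
        (\<forall>y. (\<forall>t<d. y t < n) \<longrightarrow> (\<forall>t. d \<le> t \<and> t < L \<longrightarrow> y t = (x(d := i)) t) \<longrightarrow>
          \<not> closed_walk (alive E D') L y))"
    proof (rule Suc(1)[OF d(3) 1(1,3) no1])
      fix t assume "d \<le> t" "t < L"
      then show "m (cell 0 (int t)) = int ((x(d := i)) t) \<and> (x(d := i)) t < n"
        using mi i 1(4) Suc(6)[of t] by (cases "t = d") simp_all
    qed
    then show "runs (nest d (remove_cycle L)) m (nest_cost n d (max_cost (remove_cycle L)))
      (\<lambda>m'. m' (cell 0 (int d)) = int i \<and> I (Suc i) (m'(cell 0 (int d) := int (Suc i))))"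
    proof (rule runs_mono[OF _ order_refl], elim exE conjE)
      fix m' D2 c2
      assume 2: "rep D2 p ow c2 m'" "D1 \<subseteq> D2" "packed n E D2 c2"
        and vars: "\<forall>t. d \<le> t \<and> t < L \<longrightarrow> m' (cell 0 (int t)) = int ((x(d := i)) t)"
        and none: "\<forall>y. (\<forall>t<d. y t < n) \<longrightarrow> (\<forall>t. d \<le> t \<and> t < L \<longrightarrow> y t = (x(d := i)) t) \<longrightarrow>
          \<not> closed_walk (alive E D2) L y"
      have "m' (cell 0 (int d)) = int i" using vars d(1) by auto
      moreover have "I (Suc i) (m'(cell 0 (int d) := int (Suc i)))"
        unfolding I_def
      proof (intro exI[of _ D2] exI[of _ c2] conjI)
        show "rep D2 p ow c2 (m'(cell 0 (int d) := int (Suc i)))" using 2(1) d(2) by simp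
        show "D \<subseteq> D2" using 1(2) 2(2) by blast
        show "packed n E D2 c2" by fact
        show "\<forall>t. Suc d \<le> t \<and> t < L \<longrightarrow> (m'(cell 0 (int d) := int (Suc i))) (cell 0 (int t)) = int (x t)"
          using vars by simp
        show "\<forall>y. (\<forall>t<d. y t < n) \<longrightarrow> y d < Suc i \<longrightarrow> (\<forall>t. Suc d \<le> t \<and> t < L \<longrightarrow> y t = x t) \<longrightarrow>
           \<not> closed_walk (alive E D2) L y"
        proof (intro allI impI)
          fix y assume y: "\<forall>t<d. y t < n" "y d < Suc i" "\<forall>t. Suc d \<le> t \<and> t < L \<longrightarrow> y t = x t"
          show "\<not> closed_walk (alive E D2) L y"
          proof (cases "y d = i")
            case True
            have "\<forall>t. d \<le> t \<and> t < L \<longrightarrow> y t = (x(d := i)) t" using y(3) True by (auto simp: Suc_le_eq)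
            then show ?thesis using none y(1) by blast
          next
            case False
            then have "\<not> closed_walk (alive E D1) L y" using 1(5) y by simp
            then show ?thesis using closed_walk_mono[OF _ alive_mono[OF 2(2)]] by blast
          qed
        qed
      qed
      ultimately show "m' (cell 0 (int d)) = int i \<and> I (Suc i) (m'(cell 0 (int d) := int (Suc i)))" ..
    qed
  qed
qed

definition stage_cost :: "nat \<Rightarrow> nat" where
  "stage_cost L = nest_cost n L (max_cost (remove_cycle L))"

text \<open>A surviving closed walk of length \<open>L\<close> would be one of the enumerated
  tuples. Odd lengths below \<open>L\<close> are at most \<open>L - 2\<close>, and their absence is
  inherited from the earlier stages.\<close>

lemma stage_correct:
  assumes L: "odd L" "L \<le> 11" "2 \<le> L" and m: "rep D p ow c m" "packed n E D c" "no_short_odd (L - 2) (alive E D)"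
  shows "runs (stage L) m (stage_cost L)
    (\<lambda>m'. \<exists>D' c'. rep D' p ow c' m' \<and> packed n E D' c' \<and> no_short_odd L (alive E D'))"
  unfolding stage_def stage_cost_def
proof (rule runs_mono[OF nest_correct[OF L(1,2) order_refl m, where x = "\<lambda>_. 0"] order_refl])
  fix m' assume "\<exists>D' c'. rep D' p ow c' m' \<and> D \<subseteq> D' \<and> packed n E D' c' \<and>
        (\<forall>t. L \<le> t \<and> t < L \<longrightarrow> m' (cell 0 (int t)) = int 0) \<and>
        (\<forall>y. (\<forall>t<L. y t < n) \<longrightarrow> (\<forall>t. L \<le> t \<and> t < L \<longrightarrow> y t = 0) \<longrightarrow> \<not> closed_walk (alive E D') L y)"
  then obtain D' c' where *: "rep D' p ow c' m'" "D \<subseteq> D'" "packed n E D' c'"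
    "\<And>y. \<forall>t<L. y t < n \<Longrightarrow> \<not> closed_walk (alive E D') L y" by auto
  have "no_short_odd L (alive E D')"
    unfolding no_short_odd_def
  proof (intro allI impI notI)
    fix j x assume j: "odd j" "j \<le> L" "(x, x) \<in> alive E D' ^^ j"
    show False
    proof (cases "j = L")
      case True
      then obtain y where y: "closed_walk (alive E D') L y" using closed_walk_of_relpow j L(3) by fastforce
      have "y t < n" if "t < L" for t using y that E_sub by (auto simp: closed_walk_def alive_def)
      then show False using *(4) y by blast
    next
      case False
      then have "j \<le> L - 2" using j L(1) by presburger
      then show False
        using no_short_odd_mono[OF m(3) alive_mono[OF *(2)]] j unfolding no_short_odd_def by blast
    qed
  qed
  then show "\<exists>D' c'. rep D' p ow c' m' \<and> packed n E D' c' \<and> no_short_odd L (alive E D')"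
    using * by blast
qed simp

end

section \<open>The auction as carried out by the program\<close>

definition best :: "(nat \<times> nat) set \<Rightarrow> nat \<Rightarrow> (nat \<Rightarrow> nat) \<Rightarrow> nat \<Rightarrow> nat \<Rightarrow> bool" where
  "best R i p j b \<longleftrightarrow> (if b = 0 then \<forall>j'<j. (i, j') \<notin> R
     else b - 1 < j \<and> (i, b - 1) \<in> R \<and> (\<forall>j'<j. (i, j') \<in> R \<longrightarrow> p (b - 1) \<le> p j'))"

lemma best_Suc:
  assumes "best R i p j b"
  shows "best R i p (Suc j) (if (i, j) \<in> R \<and> (b = 0 \<or> p j < p (b - 1)) then Suc j else b)"
  using assms unfolding best_def by (auto simp: less_Suc_eq split: if_splits dest: less_imp_le)

context machine
begin

lemma effect_scan:
  assumes m: "rep D p ow c m" "m (cell 0 2) = int i" "m (cell 0 3) = int j" "m (cell 0 13) = int b"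
    and n: "i < n" "j < n" "b \<noteq> 0 \<Longrightarrow> b - 1 < n"
  shows "effect scan m =
    (let m' = if ow j = Suc i then m(cell 0 12 := 1) else m in
     if (i, j) \<in> alive E D \<and> (b = 0 \<or> p j < p (b - 1)) then m'(cell 0 13 := int (Suc j)) else m')"
proof -
  define m' where "m' = (if ow j = Suc i then m(cell 0 12 := 1) else m)"
  have rep': "rep D p ow c m'" using m(1) by (simp add: m'_def)
  have m': "m' (cell 0 2) = int i" "m' (cell 0 3) = int j" "m' (cell 0 13) = int b"
    using m by (simp_all add: m'_def)
  \<comment> \<open>Over the integers the two positivity tests, \<open>ow j > i\<close> and
    \<open>ow j < i + 2\<close>, express the equation \<open>ow j = i + 1\<close>.\<close>
  have 1: "effect (guard [Minus (Load (addr 4 (var 3))) (var 2), Minus (Plus (var 2) (Num 2)) (Load (addr 4 (var 3)))] (assign 12 (Num 1))) m = m'"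
    using m n repD(7)[OF m(1) n(2)] by (auto simp: m'_def)
  have g1: "expr_val (Minus (Num 1) (Load (addr 2 (var 2)))) m' = (if i \<in> D then 0 else 1)"
    using m'(1) repD(5)[OF rep' n(1)] by simp
  have g2: "expr_val (Minus (Num 1) (Load (addr 2 (var 3)))) m' = (if j \<in> D then 0 else 1)"
    using m'(2) repD(5)[OF rep' n(2)] by simp
  have g3: "expr_val (adjE (var 2) (var 3)) m' = of_bool ((i, j) \<in> E)"
    by (rule adjE_val[OF rep']) (use m' n in simp_all)
  have al: "(\<forall>e\<in>set [Minus (Num 1) (Load (addr 2 (var 2))), Minus (Num 1) (Load (addr 2 (var 3))), adjE (var 2) (var 3)]. 0 < expr_val e m')
     \<longleftrightarrow> (i, j) \<in> alive E D"
    by (simp only: list.set ball_simps g1 g2 g3) (auto simp: alive_def)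
  have c1: "expr_val (var 13) m' = int b" "expr_val (var 3) m' = int j" using m' by simp_all
  have c2: "expr_val (Minus (Load (addr 3 (Minus (var 13) (Num 1)))) (Load (addr 3 (var 3)))) m' = int (p (b - 1)) - int (p j)"
    if b0: "b \<noteq> 0"
  proof -
    obtain b' where b': "b = Suc b'" using b0 by (cases b) auto
    show ?thesis using repD(6)[OF rep' n(3)[OF b0]] repD(6)[OF rep' n(2)] m' unfolding b' by simp
  qed
  have 2: "effect (Cond (var 13)
        (guard [Minus (Load (addr 3 (Minus (var 13) (Num 1)))) (Load (addr 3 (var 3)))] (assign 13 (Plus (var 3) (Num 1))))
        (assign 13 (Plus (var 3) (Num 1)))) m' =
     (if b = 0 \<or> p j < p (b - 1) then m'(cell 0 13 := int (Suc j)) else m')"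
  proof (cases "b = 0")
    case True
    then show ?thesis using m' by (simp add: add.commute)
  next
    case False
    have "(0 < int (p (b - 1)) - int (p j)) = (p j < p (b - 1))" by auto
    then show ?thesis using False c2[OF False] m'
      by (simp only: effect.simps effect_guard list.set ball_simps c1) (simp add: add.commute)
  qed
  show ?thesis
    unfolding scan_def effect.simps(3) 1 effect_guard[of "[Minus (Num 1) (Load (addr 2 (var 2))), _, _]"] al 2 Let_def m'_def[symmetric]
    by simp
qed

lemma straight_scan: "straight scan" by (simp add: scan_def)

lemma straight_act: "straight act" by (simp add: act_def)

lemma effect_act:
  assumes m: "rep D p ow c m" "m (cell 0 2) = int i" "m (cell 0 12) = of_bool f" "m (cell 0 13) = int b"
    and n: "b \<noteq> 0 \<Longrightarrow> b - 1 < n"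
  shows "effect act m = (if \<not> f \<and> b \<noteq> 0 \<and> p (b - 1) \<le> n
     then m(cell 4 (int (b - 1)) := int (Suc i), cell 3 (int (b - 1)) := int (Suc (p (b - 1)))) else m)"
proof (cases "b = 0")
  case True
  then show ?thesis using m(4) by (simp add: act_def)
next
  case False
  then obtain b' where b': "b = Suc b'" by (cases b) auto
  have bn: "b' < n" using n[OF False] b' by simp
  have "(\<forall>e\<in>set [Minus (Num 1) (var 12), var 13, Minus (Plus (Load (Num 0)) (Num 1)) (Load (addr 3 (Minus (var 13) (Num 1))))]. 0 < expr_val e m)
     \<longleftrightarrow> \<not> f \<and> p b' \<le> n"
    using repD(1)[OF m(1)] repD(6)[OF m(1) bn] m(3,4) unfolding b' by (cases f) auto
  then show ?thesis
    unfolding act_def effect_guard using repD(6)[OF m(1) bn] m(2,4) unfolding b' by (simp add: add.commute)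
qed

definition total :: "(nat \<Rightarrow> nat) \<Rightarrow> nat" where "total p = (\<Sum>j<n. p j)"

lemma total_upd: "b < n \<Longrightarrow> total (p(b := Suc (p b))) = Suc (total p)"
proof -
  assume "b < n"
  then have "sum f {..<n} = f b + sum f ({..<n} - {b})" for f :: "nat \<Rightarrow> nat"
    by (intro sum.remove) auto
  moreover have "sum (p(b := Suc (p b))) ({..<n} - {b}) = sum p ({..<n} - {b})"
    by (rule sum.cong) auto
  ultimately show ?thesis by (simp add: total_def)
qed

definition bid_cost :: nat where
  "bid_cost = max_cost (Seq (assign 12 (Num 0)) (assign 13 (Num 0))) +
     (loop_cost (Load (Num 0)) n (max_cost scan) + max_cost act)"

text \<open>The final disjunction measures progress: a happy bidder leaves prices and owners as they
  are, and an unhappy one makes a purchase, which raises the sum of the prices by one.\<close>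

lemma bid_correct:
  assumes m: "rep D p ow c m" "m (cell 0 0) = x" "m (cell 0 1) = y" "m (cell 0 2) = int i"
    and i: "i < n" and au: "auction n (alive E D) p ow"
  shows "runs bid m bid_cost (\<lambda>m'. \<exists>p' ow'. rep D p' ow' c m' \<and> auction n (alive E D) p' ow' \<and>
    m' (cell 0 0) = x \<and> m' (cell 0 1) = y \<and> m' (cell 0 2) = int i \<and>
    ((p' = p \<and> ow' = ow \<and> happy n (alive E D) p ow i) \<or>
     (\<not> happy n (alive E D) p ow i \<and> total p' = Suc (total p))))"
proof -
  let ?R = "alive E D"
  define J where "J j m \<longleftrightarrow> rep D p ow c m \<and> m (cell 0 0) = x \<and> m (cell 0 1) = y \<and> m (cell 0 2) = int i \<and>
    m (cell 0 12) = of_bool (\<exists>j'<j. ow j' = Suc i) \<and> (\<exists>b. m (cell 0 13) = int b \<and> best ?R i p j b)"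
    for j and m :: memory
  define Q where "Q m' \<longleftrightarrow> (\<exists>p' ow'. rep D p' ow' c m' \<and> auction n (alive E D) p' ow' \<and>
    m' (cell 0 0) = x \<and> m' (cell 0 1) = y \<and> m' (cell 0 2) = int i \<and>
    ((p' = p \<and> ow' = ow \<and> happy n (alive E D) p ow i) \<or>
     (\<not> happy n (alive E D) p ow i \<and> total p' = Suc (total p))))" for m'
  have "runs (Seq (assign 12 (Num 0)) (assign 13 (Num 0))) m
      (max_cost (Seq (assign 12 (Num 0)) (assign 13 (Num 0)))) (\<lambda>m'. J 0 (m'(cell 0 3 := 0)))"
    by (rule runs_straight) (use m in \<open>auto simp: J_def best_def\<close>)
  moreover have "runs (loop 3 (Load (Num 0)) scan) m' (loop_cost (Load (Num 0)) n (max_cost scan)) (J n)"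
    if "J 0 (m'(cell 0 3 := 0))" for m'
  proof (rule runs_loop[where I = J])
    show "J 0 (m'(cell 0 (int 3) := 0))" using that by simp
    show "expr_val (Load (Num 0)) m = int n" if "J i m" for i m
      using that repD(1) by (auto simp: J_def)
    fix j m assume j: "j < n" and Jm: "J j m" and mj: "m (cell 0 (int 3)) = int j"
    then obtain b where b: "m (cell 0 13) = int b" "best ?R i p j b" by (auto simp: J_def)
    have bn: "b \<noteq> 0 \<Longrightarrow> b - 1 < n" using b(2) j by (auto simp: best_def)
    have eff: "effect scan m = (let m' = if ow j = Suc i then m(cell 0 12 := 1) else m in
     if (i, j) \<in> ?R \<and> (b = 0 \<or> p j < p (b - 1)) then m'(cell 0 13 := int (Suc j)) else m')"
    proof (rule effect_scan[where i = i and j = j])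
      show "rep D p ow c m" "m (cell 0 2) = int i" using Jm by (simp_all add: J_def)
      show "m (cell 0 3) = int j" using mj by simp
    qed (fact b(1) i j bn)+
    have nb: "best ?R i p (Suc j) (if (i, j) \<in> ?R \<and> (b = 0 \<or> p j < p (b - 1)) then Suc j else b)"
      by (rule best_Suc[OF b(2)])
    have ex: "(\<exists>j'<Suc j. ow j' = Suc i) \<longleftrightarrow> ow j = Suc i \<or> (\<exists>j'<j. ow j' = Suc i)"
      by (auto simp: less_Suc_eq)
    show "runs scan m (max_cost scan) (\<lambda>m'. m' (cell 0 (int 3)) = int j \<and> J (Suc j) (m'(cell 0 (int 3) := int (Suc j))))"
    proof (rule runs_straight[OF straight_scan], unfold eff Let_def)
      let ?m' = "if ow j = Suc i then m(cell 0 12 := 1) else m"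
      let ?b = "if (i, j) \<in> ?R \<and> (b = 0 \<or> p j < p (b - 1)) then Suc j else b"
      let ?e = "if (i, j) \<in> ?R \<and> (b = 0 \<or> p j < p (b - 1)) then ?m'(cell 0 13 := int (Suc j)) else ?m'"
      have "rep D p ow c ?e" "?e (cell 0 0) = x" "?e (cell 0 1) = y" "?e (cell 0 2) = int i"
        "?e (cell 0 3) = int j" "?e (cell 0 12) = of_bool (\<exists>j'<Suc j. ow j' = Suc i)" "?e (cell 0 13) = int ?b"
        using Jm mj b(1) unfolding J_def ex by auto
      then show "?e (cell 0 (int 3)) = int j \<and> J (Suc j) (?e(cell 0 (int 3) := int (Suc j)))"
        using nb unfolding J_def by (intro conjI exI[of _ ?b]) simp_all
    qed
  qed
  moreover have "runs act m' (max_cost act) Q" if Jn: "J n m'" for m'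
  proof (rule runs_straight[OF straight_act])
    let ?f = "\<exists>j'<n. ow j' = Suc i"
    obtain b where b: "m' (cell 0 13) = int b" "best ?R i p n b" using Jn by (auto simp: J_def)
    have J: "rep D p ow c m'" "m' (cell 0 0) = x" "m' (cell 0 1) = y" "m' (cell 0 2) = int i" "m' (cell 0 12) = of_bool ?f"
      using Jn by (auto simp: J_def)
    have bn: "b \<noteq> 0 \<Longrightarrow> b - 1 < n" using b(2) by (auto simp: best_def)
    have eff: "effect act m' = (if \<not> ?f \<and> b \<noteq> 0 \<and> p (b - 1) \<le> n
     then m'(cell 4 (int (b - 1)) := int (Suc i), cell 3 (int (b - 1)) := int (Suc (p (b - 1)))) else m')"
      by (rule effect_act[OF J(1,4,5) b(1) bn])
    show "Q (effect act m')"
    proof (cases "\<not> ?f \<and> b \<noteq> 0 \<and> p (b - 1) \<le> n")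
      case True
      let ?b = "b - 1"
      have bR: "?b < n" "(i, ?b) \<in> ?R" "\<And>j. j < n \<Longrightarrow> (i, j) \<in> ?R \<Longrightarrow> p ?b \<le> p j"
        using b(2) True by (auto simp: best_def)
      have "auction n ?R (p(?b := Suc (p ?b))) (ow(?b := Suc i))"
        using True by (intro auction_step[OF au _ bR]) auto
      moreover have "rep D (p(?b := Suc (p ?b))) (ow(?b := Suc i)) c (effect act m')"
        unfolding eff if_P[OF True] by (rule rep_sell[OF J(1) bR(1)])
      moreover have "\<not> happy n ?R p ow i"
        unfolding happy_def using True bR(1,2) by (auto simp: not_le)
      moreover have "effect act m' (cell 0 0) = x" "effect act m' (cell 0 1) = y" "effect act m' (cell 0 2) = int i"
        unfolding eff if_P[OF True] using J by simp_all
      ultimately show ?thesis unfolding Q_def using total_upd[OF bR(1)] by blast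
    next
      case False
      have "happy n ?R p ow i"
      proof (cases ?f)
        case True
        then show ?thesis by (simp add: happy_def)
      next
        case nf: False
        show ?thesis
        proof (cases "b = 0")
          case True
          then show ?thesis using b(2) by (auto simp: happy_def best_def)
        next
          case nb: False
          then have "n + 1 \<le> p (b - 1)" using False nf by auto
          then show ?thesis using b(2) nb unfolding happy_def best_def by (auto intro: order_trans)
        qed
      qed
      then show ?thesis unfolding Q_def eff if_not_P[OF False] using J(1-4) au by blast
    qed
  qed
  ultimately have "runs bid m bid_cost Q"
    unfolding bid_def bid_cost_def by (intro runs_Seq[where Q = "\<lambda>m'. J 0 (m'(cell 0 3 := 0))"] runs_Seq[where Q = "J n"])
  then show ?thesis unfolding Q_def .
qed


definition pass_cost :: nat where "pass_cost = loop_cost (Load (Num 0)) n bid_cost"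

text \<open>A later sale in the same pass can make an earlier bidder unhappy again by taking its
  good. Hence only a pass without any sale certifies that all bidders are happy at the same time;
  any other pass increases the sum of the prices.\<close>

lemma pass_correct:
  assumes m: "rep D p ow c m" "m (cell 0 0) = x" "m (cell 0 1) = y" and au: "auction n (alive E D) p ow"
  shows "runs (loop 2 (Load (Num 0)) bid) m pass_cost (\<lambda>m'. \<exists>p' ow'. rep D p' ow' c m' \<and>
    auction n (alive E D) p' ow' \<and> m' (cell 0 0) = x \<and> m' (cell 0 1) = y \<and>
    ((p' = p \<and> ow' = ow \<and> (\<forall>i<n. happy n (alive E D) p ow i)) \<or>
     ((\<exists>i<n. \<not> happy n (alive E D) p ow i) \<and> total p < total p')))"
proof -
  define I where "I i m' \<longleftrightarrow> (\<exists>p' ow'. rep D p' ow' c m' \<and>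
    auction n (alive E D) p' ow' \<and> m' (cell 0 0) = x \<and> m' (cell 0 1) = y \<and>
    ((p' = p \<and> ow' = ow \<and> (\<forall>i'<i. happy n (alive E D) p ow i')) \<or>
     ((\<exists>i<n. \<not> happy n (alive E D) p ow i) \<and> total p < total p')))" for i and m' :: memory
  show ?thesis unfolding pass_cost_def
  proof (rule runs_loop[where I = I])
    show "I 0 (m(cell 0 (int 2) := 0))"
      unfolding I_def using m au by (intro exI[of _ p] exI[of _ ow]) simp
    show "expr_val (Load (Num 0)) m = int n" if "I i m" for i m
      using that repD(1) by (auto simp: I_def)
    show "\<exists>p' ow'. rep D p' ow' c m' \<and>
      auction n (alive E D) p' ow' \<and> m' (cell 0 0) = x \<and> m' (cell 0 1) = y \<and>
      ((p' = p \<and> ow' = ow \<and> (\<forall>i<n. happy n (alive E D) p ow i)) \<or>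
       ((\<exists>i<n. \<not> happy n (alive E D) p ow i) \<and> total p < total p'))" if "I n m'" for m'
      using that unfolding I_def .
    fix i m assume i: "i < n" and Im: "I i m" and mi: "m (cell 0 (int 2)) = int i"
    obtain p1 ow1 where 1: "rep D p1 ow1 c m" "auction n (alive E D) p1 ow1" "m (cell 0 0) = x" "m (cell 0 1) = y"
      "(p1 = p \<and> ow1 = ow \<and> (\<forall>i'<i. happy n (alive E D) p ow i')) \<or>
       ((\<exists>i<n. \<not> happy n (alive E D) p ow i) \<and> total p < total p1)"
      using Im unfolding I_def by blast
    have mi': "m (cell 0 2) = int i" using mi by simp
    show "runs bid m bid_cost (\<lambda>m'. m' (cell 0 (int 2)) = int i \<and> I (Suc i) (m'(cell 0 (int 2) := int (Suc i))))"
    proof (rule runs_mono[OF bid_correct[OF 1(1,3,4) mi' i 1(2)] order_refl], elim exE conjE)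
      fix m' p2 ow2
      assume 2: "rep D p2 ow2 c m'" "auction n (alive E D) p2 ow2" "m' (cell 0 0) = x" "m' (cell 0 1) = y" "m' (cell 0 2) = int i"
        and cs: "p2 = p1 \<and> ow2 = ow1 \<and> happy n (alive E D) p1 ow1 i \<or>
          \<not> happy n (alive E D) p1 ow1 i \<and> total p2 = Suc (total p1)"
      have "(p2 = p \<and> ow2 = ow \<and> (\<forall>i'<Suc i. happy n (alive E D) p ow i')) \<or>
       ((\<exists>i<n. \<not> happy n (alive E D) p ow i) \<and> total p < total p2)"
        using 1(5)
      proof
        assume a: "p1 = p \<and> ow1 = ow \<and> (\<forall>i'<i. happy n (alive E D) p ow i')"
        show ?thesis using cs
        proof
          assume "p2 = p1 \<and> ow2 = ow1 \<and> happy n (alive E D) p1 ow1 i"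
          then show ?thesis using a by (simp add: less_Suc_eq)
        next
          assume "\<not> happy n (alive E D) p1 ow1 i \<and> total p2 = Suc (total p1)"
          then have "\<not> happy n (alive E D) p ow i" "total p < total p2" using a by simp_all
          then show ?thesis using i by blast
        qed
      next
        assume "(\<exists>i<n. \<not> happy n (alive E D) p ow i) \<and> total p < total p1"
        then show ?thesis using cs by auto
      qed
      then show "m' (cell 0 (int 2)) = int i \<and> I (Suc i) (m'(cell 0 (int 2) := int (Suc i)))"
        unfolding I_def using 2 by (intro conjI exI[of _ p2] exI[of _ ow2]) simp_all
    qed
  qed
qed

lemma total_le: "auction n R p ow \<Longrightarrow> total p \<le> n * (n + 1)"
  using sum_bounded_above[of "{..<n}" p "n + 1"] auctionD(1)[of n R p ow] by (simp add: total_def)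

definition auction_cost :: nat where
  "auction_cost = loop_cost (Plus (Load (Num 0)) (Num 1)) (n + 1)
     (loop_cost (Plus (Load (Num 0)) (Num 1)) (n + 1) pass_cost)"

lemma auction_correct:
  assumes m: "rep D (\<lambda>_. 0) (\<lambda>_. 0) c m"
  shows "runs auction_prog m auction_cost (\<lambda>m'. \<exists>p ow. rep D p ow c m' \<and>
    auction n (alive E D) p ow \<and> (\<forall>i<n. happy n (alive E D) p ow i))"
proof -
  \<comment> \<open>After \<open>t\<close> passes either the auction is stable, and then it remains
    so because further passes change nothing, or every pass has raised the sum of the
    prices.\<close>
  define G where "G t m' \<longleftrightarrow> (\<exists>p ow. rep D p ow c m' \<and> auction n (alive E D) p ow \<and>
     ((\<forall>i<n. happy n (alive E D) p ow i) \<or> t \<le> total p))" for t and m' :: memory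
  have G_upd: "G t (m'(cell 0 j := v)) = G t m'" if "j \<noteq> 11" "0 \<le> j" for t m' j v
    using that unfolding G_def by simp
  have bound: "expr_val (Plus (Load (Num 0)) (Num 1)) m = int (n + 1)" if "G t m" for t m
    using that repD(1) by (auto simp: G_def)
  have pass: "runs (loop 2 (Load (Num 0)) bid) m pass_cost
      (\<lambda>m'. G (Suc t) m' \<and> m' (cell 0 0) = m (cell 0 0) \<and> m' (cell 0 1) = m (cell 0 1))" if Gt: "G t m" for t m
  proof -
    obtain p ow where *: "rep D p ow c m" "auction n (alive E D) p ow"
      "(\<forall>i<n. happy n (alive E D) p ow i) \<or> t \<le> total p" using Gt unfolding G_def by blast
    show ?thesis
    proof (rule runs_mono[OF pass_correct[OF *(1) refl refl *(2)] order_refl], elim exE conjE)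
      fix m' p' ow'
      assume 1: "rep D p' ow' c m'" "auction n (alive E D) p' ow'" "m' (cell 0 0) = m (cell 0 0)" "m' (cell 0 1) = m (cell 0 1)"
        and cs: "p' = p \<and> ow' = ow \<and> (\<forall>i<n. happy n (alive E D) p ow i) \<or>
          (\<exists>i<n. \<not> happy n (alive E D) p ow i) \<and> total p < total p'"
      have "(\<forall>i<n. happy n (alive E D) p' ow' i) \<or> Suc t \<le> total p'" using cs *(3) by auto
      then show "G (Suc t) m' \<and> m' (cell 0 0) = m (cell 0 0) \<and> m' (cell 0 1) = m (cell 0 1)"
        unfolding G_def using 1 by blast
    qed
  qed
  \<comment> \<open>The two counters together encode the pass number \<open>a * (n + 1) + b\<close>;
    nesting two loops avoids computing the product.\<close>
  have inner: "runs (loop 1 (Plus (Load (Num 0)) (Num 1)) (loop 2 (Load (Num 0)) bid)) m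
      (loop_cost (Plus (Load (Num 0)) (Num 1)) (n + 1) pass_cost)
      (\<lambda>m'. m' (cell 0 (int 0)) = int a \<and> G (Suc a * (n + 1)) (m'(cell 0 (int 0) := int (Suc a))))"
    if "G (a * (n + 1)) m" "m (cell 0 (int 0)) = int a" for a m
  proof (rule runs_loop[where I = "\<lambda>b m'. G (a * (n + 1) + b) m' \<and> m' (cell 0 0) = int a"])
    show "G (a * (n + 1) + 0) (m(cell 0 (int 1) := 0)) \<and> (m(cell 0 (int 1) := 0)) (cell 0 0) = int a"
      using that G_upd[of 1] by simp
    show "expr_val (Plus (Load (Num 0)) (Num 1)) m = int (n + 1)" if "G (a * (n + 1) + i) m \<and> m (cell 0 0) = int a" for i m
      using bound that by blast
    show "m' (cell 0 (int 0)) = int a \<and> G (Suc a * (n + 1)) (m'(cell 0 (int 0) := int (Suc a)))"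
      if "G (a * (n + 1) + (n + 1)) m' \<and> m' (cell 0 0) = int a" for m'
      using that G_upd[of 0] by (simp add: algebra_simps)
    fix b m assume *: "G (a * (n + 1) + b) m \<and> m (cell 0 0) = int a" "m (cell 0 (int 1)) = int b"
    then show "runs (loop 2 (Load (Num 0)) bid) m pass_cost (\<lambda>m'. m' (cell 0 (int 1)) = int b \<and>
       G (a * (n + 1) + Suc b) (m'(cell 0 (int 1) := int (Suc b))) \<and> (m'(cell 0 (int 1) := int (Suc b))) (cell 0 0) = int a)"
      using G_upd[of 1] by (intro runs_mono[OF pass[of "a * (n + 1) + b" m] order_refl]) simp_all
  qed
  show ?thesis unfolding auction_prog_def auction_cost_def
  proof (rule runs_loop[where I = "\<lambda>a. G (a * (n + 1))"])
    show "G (0 * (n + 1)) (m(cell 0 (int 0) := 0))"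
      unfolding G_def using m auction_start by (intro exI[of _ "\<lambda>_. 0"]) simp
    show "expr_val (Plus (Load (Num 0)) (Num 1)) m = int (n + 1)" if "G (i * (n + 1)) m" for i m
      by (rule bound[OF that])
    show "\<exists>p ow. rep D p ow c m' \<and> auction n (alive E D) p ow \<and> (\<forall>i<n. happy n (alive E D) p ow i)"
      if Gn: "G ((n + 1) * (n + 1)) m'" for m'
    proof -
      obtain p ow where *: "rep D p ow c m'" "auction n (alive E D) p ow"
        "(\<forall>i<n. happy n (alive E D) p ow i) \<or> (n + 1) * (n + 1) \<le> total p" using Gn unfolding G_def by blast
      have "\<not> (n + 1) * (n + 1) \<le> total p" using total_le[OF *(2)] by simp
      then show ?thesis using * by blast
    qed
  qed (rule inner)
qed

definition finish_cost :: nat where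
  "finish_cost = loop_cost (Load (Num 0)) n (max_cost (guard [Load (addr 3 (var 0))] (assign 11 (Plus (var 11) (Num 1))))) +
    max_cost (Cond (Minus (Plus (Plus (Load (Num 1)) (Load (Num 1))) (Num 1)) (var 11)) (Store (Num 0) (Num 1)) (Store (Num 0) (Num 2)))"

lemma finish_correct:
  assumes m: "rep D p ow c m"
  shows "runs finish m finish_cost (\<lambda>m'. m' 0 = (if int (c + matched n p) \<le> 2 * k then 1 else 2))"
proof -
  let ?c = "\<lambda>j. c + card {j' \<in> {..<j}. 0 < p j'}"
  have step: "?c (Suc j) = ?c j + (if 0 < p j then 1 else 0)" for j
  proof -
    have "{j' \<in> {..<Suc j}. 0 < p j'} = (if 0 < p j then insert j {j' \<in> {..<j}. 0 < p j'} else {j' \<in> {..<j}. 0 < p j'})"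
      by (auto simp: less_Suc_eq)
    then show ?thesis by simp
  qed
  have "runs (loop 0 (Load (Num 0)) (guard [Load (addr 3 (var 0))] (assign 11 (Plus (var 11) (Num 1))))) m
      (loop_cost (Load (Num 0)) n (max_cost (guard [Load (addr 3 (var 0))] (assign 11 (Plus (var 11) (Num 1))))))
      (rep D p ow (c + matched n p))"
  proof (rule runs_loop[where I = "\<lambda>j. rep D p ow (?c j)"])
    show "rep D p ow (?c 0) (m(cell 0 (int 0) := 0))" using m by simp
    show "expr_val (Load (Num 0)) m = int n" if "rep D p ow (?c i) m" for i m using repD(1)[OF that] by simp
    show "rep D p ow (c + matched n p) m" if "rep D p ow (?c n) m" for m using that by (simp add: matched_def)
    fix j m assume j: "j < n" and r: "rep D p ow (?c j) m" and mj: "m (cell 0 (int 0)) = int j"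
    show "runs (guard [Load (addr 3 (var 0))] (assign 11 (Plus (var 11) (Num 1)))) m
      (max_cost (guard [Load (addr 3 (var 0))] (assign 11 (Plus (var 11) (Num 1)))))
      (\<lambda>m'. m' (cell 0 (int 0)) = int j \<and> rep D p ow (?c (Suc j)) (m'(cell 0 (int 0) := int (Suc j))))"
    proof (rule runs_straight)
      let ?m = "effect (guard [Load (addr 3 (var 0))] (assign 11 (Plus (var 11) (Num 1)))) m"
      have eff: "?m = (if 0 < p j then m(cell 0 11 := m (cell 0 11) + 1) else m)"
        using repD(6)[OF r j] mj by simp
      have "rep D p ow (?c (Suc j)) ?m"
      proof (cases "0 < p j")
        case True
        have "m (cell 0 11) + 1 = int (?c j + 1)" using repD(8)[OF r] by simp
        from rep_count[OF r this] show ?thesis unfolding eff step if_P[OF True] .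
      next
        case False
        then show ?thesis unfolding eff step using r by simp
      qed
      moreover have "?m (cell 0 (int 0)) = int j" unfolding eff using mj by simp
      ultimately show "?m (cell 0 (int 0)) = int j \<and> rep D p ow (?c (Suc j)) (?m(cell 0 (int 0) := int (Suc j)))" by simp
    qed simp
  qed
  moreover have "runs (Cond (Minus (Plus (Plus (Load (Num 1)) (Load (Num 1))) (Num 1)) (var 11)) (Store (Num 0) (Num 1)) (Store (Num 0) (Num 2))) m'
     (max_cost (Cond (Minus (Plus (Plus (Load (Num 1)) (Load (Num 1))) (Num 1)) (var 11)) (Store (Num 0) (Num 1)) (Store (Num 0) (Num 2))))
     (\<lambda>m'. m' 0 = (if int (c + matched n p) \<le> 2 * k then 1 else 2))" if r: "rep D p ow (c + matched n p) m'" for m'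
    by (rule runs_straight) (use repD(2)[OF r] repD(8)[OF r] in auto)
  ultimately show ?thesis unfolding finish_def finish_cost_def by (rule runs_Seq)
qed

definition init_cost :: nat where
  "init_cost = max_cost (assign 12 (Num 2)) +
    loop_cost (Load (Num 0)) n (max_cost (Seq (Store (addr 1 (var 0)) (var 12)) (assign 12 (Plus (var 12) (Load (Num 0))))))"

lemma init_correct:
  assumes m: "m 0 = int n" "m 1 = k" "\<And>a. a < 0 \<Longrightarrow> m a = 0"
    and adj: "\<And>u v. u < n \<Longrightarrow> v < n \<Longrightarrow> m (2 + int u * int n + int v) = of_bool ((u, v) \<in> E)"
  shows "runs init m init_cost (rep {} (\<lambda>_. 0) (\<lambda>_. 0) 0)"
proof -
  \<comment> \<open>Variable 12 runs through the row addresses by repeated addition of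
    \<open>n\<close>: before round \<open>i\<close> it holds the address of row
    \<open>i\<close>.\<close>
  define I where "I i m' \<longleftrightarrow> m' 0 = int n \<and> m' 1 = k \<and>
     (\<forall>u<n. \<forall>v<n. m' (2 + int u * int n + int v) = of_bool ((u, v) \<in> E)) \<and>
     (\<forall>u<i. m' (cell 1 (int u)) = 2 + int u * int n) \<and>
     (\<forall>v<n. m' (cell 2 (int v)) = 0 \<and> m' (cell 3 (int v)) = 0 \<and> m' (cell 4 (int v)) = 0) \<and>
     m' (cell 0 11) = 0 \<and> m' (cell 0 12) = 2 + int i * int n" for i and m' :: memory
  have z: "m (cell q x) = 0" if "0 \<le> q" "0 \<le> x" for q x using m(3) cell_neg[OF that] by simp
  have "runs (assign 12 (Num 2)) m (max_cost (assign 12 (Num 2))) (\<lambda>m'. I 0 (m'(cell 0 0 := 0)))"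
    by (rule runs_straight) (use m adj z in \<open>simp_all add: I_def\<close>)
  moreover have "runs (loop 0 (Load (Num 0)) (Seq (Store (addr 1 (var 0)) (var 12)) (assign 12 (Plus (var 12) (Load (Num 0)))))) m'
     (loop_cost (Load (Num 0)) n (max_cost (Seq (Store (addr 1 (var 0)) (var 12)) (assign 12 (Plus (var 12) (Load (Num 0)))))))
     (rep {} (\<lambda>_. 0) (\<lambda>_. 0) 0)" if "I 0 (m'(cell 0 0 := 0))" for m'
  proof (rule runs_loop[where I = I])
    show "I 0 (m'(cell 0 (int 0) := 0))" using that by simp
    show "expr_val (Load (Num 0)) m = int n" if "I i m" for i m using that by (simp add: I_def)
    show "rep {} (\<lambda>_. 0) (\<lambda>_. 0) 0 m" if "I n m" for m using that by (simp add: I_def rep_def)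
    fix i m assume i: "i < n" and Im: "I i m" and mi: "m (cell 0 (int 0)) = int i"
    show "runs (Seq (Store (addr 1 (var 0)) (var 12)) (assign 12 (Plus (var 12) (Load (Num 0))))) m
      (max_cost (Seq (Store (addr 1 (var 0)) (var 12)) (assign 12 (Plus (var 12) (Load (Num 0))))))
      (\<lambda>m'. m' (cell 0 (int 0)) = int i \<and> I (Suc i) (m'(cell 0 (int 0) := int (Suc i))))"
    proof (rule runs_straight)
      let ?m = "m(cell 1 (int i) := 2 + int i * int n, cell 0 12 := 2 + int (Suc i) * int n)"
      have eff: "effect (Seq (Store (addr 1 (var 0)) (var 12)) (assign 12 (Plus (var 12) (Load (Num 0))))) m = ?m"
        using Im mi by (simp add: I_def algebra_simps)
      have "I (Suc i) (?m(cell 0 (int 0) := int (Suc i)))"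
        using Im unfolding I_def by (simp add: less_Suc_eq)
      then show "effect (Seq (Store (addr 1 (var 0)) (var 12)) (assign 12 (Plus (var 12) (Load (Num 0))))) m (cell 0 (int 0)) = int i \<and>
        I (Suc i) ((effect (Seq (Store (addr 1 (var 0)) (var 12)) (assign 12 (Plus (var 12) (Load (Num 0))))) m)(cell 0 (int 0) := int (Suc i)))"
        unfolding eff using mi by simp
    qed simp
  qed
  ultimately show ?thesis unfolding init_def init_cost_def by (rule runs_Seq)
qed

definition main_cost :: nat where
  "main_cost = init_cost + (stage_cost 3 + (stage_cost 5 + (stage_cost 7 + (stage_cost 9 + (stage_cost 11 +
     (auction_cost + finish_cost))))))"

lemma main_correct:
  assumes m: "m 0 = int n" "m 1 = k" "\<And>a. a < 0 \<Longrightarrow> m a = 0"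
    and adj: "\<And>u v. u < n \<Longrightarrow> v < n \<Longrightarrow> m (2 + int u * int n + int v) = of_bool ((u, v) \<in> E)"
  shows "runs main m main_cost (\<lambda>m'. \<exists>D c p ow. packed n E D c \<and> no_short_odd 11 (alive E D) \<and>
     auction n (alive E D) p ow \<and> (\<forall>i<n. happy n (alive E D) p ow i) \<and>
     m' 0 = (if int (c + matched n p) \<le> 2 * k then 1 else 2))"
proof -
  \<comment> \<open>At the start the only odd length in question is 1, that is, loops, which a
    simple graph does not have. Each stage raises the bound by two.\<close>
  define S where "S L m' \<longleftrightarrow> (\<exists>D c. rep D (\<lambda>_. 0) (\<lambda>_. 0) c m' \<and> packed n E D c \<and> no_short_odd L (alive E D))"
    for L m'
  have aE: "alive E {} = E" by (auto simp: alive_def)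
  have S1: "S 1 m'" if "rep {} (\<lambda>_. 0) (\<lambda>_. 0) 0 m'" for m'
    unfolding S_def using that packed_empty irrefl
    by (intro exI[of _ "{}"] exI[of _ "0 :: nat"]) (simp only: aE simp_thms)
  have start: "runs init m init_cost (S 1)"
    by (rule runs_mono[OF init_correct[OF m adj] order_refl S1])
  have stage: "runs (stage L) m (stage_cost L) (S L)" if SN: "S N m" "N = L - 2" and L: "odd L" "L \<le> 11" "2 \<le> L" for L N m
  proof -
    obtain D c where *: "rep D (\<lambda>_. 0) (\<lambda>_. 0) c m" "packed n E D c" "no_short_odd (L - 2) (alive E D)"
      using SN by (auto simp: S_def)
    show ?thesis by (rule runs_mono[OF stage_correct[OF L *] order_refl]) (auto simp: S_def)
  qed
  define Q where "Q = (\<lambda>m' :: memory. \<exists>D c p ow. packed n E D c \<and> no_short_odd 11 (alive E D) \<and>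
     auction n (alive E D) p ow \<and> (\<forall>i<n. happy n (alive E D) p ow i) \<and>
     m' 0 = (if int (c + matched n p) \<le> 2 * k then 1 else 2))"
  have tail: "runs (Seq auction_prog finish) m' (auction_cost + finish_cost) Q" if S11: "S 11 m'" for m'
  proof -
    obtain D c where *: "rep D (\<lambda>_. 0) (\<lambda>_. 0) c m'" "packed n E D c" "no_short_odd 11 (alive E D)"
      using S11 by (auto simp: S_def)
    show ?thesis
    proof (rule runs_Seq[OF auction_correct[OF *(1)]], elim exE conjE)
      fix m1 p ow assume 1: "rep D p ow c m1" "auction n (alive E D) p ow" "\<forall>i<n. happy n (alive E D) p ow i"
      show "runs finish m1 finish_cost Q"
      proof (rule runs_mono[OF finish_correct[OF 1(1)] order_refl])
        fix m' :: memory assume "m' 0 = (if int (c + matched n p) \<le> 2 * k then 1 else 2)"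
        then show "Q m'" unfolding Q_def using *(2,3) 1(2,3)
          by (intro exI[of _ D] exI[of _ c] exI[of _ p] exI[of _ ow] conjI)
      qed
    qed
  qed
  have tail: "runs (Seq (stage 11) (Seq auction_prog finish)) m' (stage_cost 11 + (auction_cost + finish_cost)) Q"
    if "S 9 m'" for m'
    by (rule runs_Seq[OF stage[OF that] tail]) simp_all
  have tail: "runs (Seq (stage 9) (Seq (stage 11) (Seq auction_prog finish))) m'
      (stage_cost 9 + (stage_cost 11 + (auction_cost + finish_cost))) Q" if "S 7 m'" for m'
    by (rule runs_Seq[OF stage[OF that] tail]) simp_all
  have tail: "runs (Seq (stage 7) (Seq (stage 9) (Seq (stage 11) (Seq auction_prog finish)))) m'
      (stage_cost 7 + (stage_cost 9 + (stage_cost 11 + (auction_cost + finish_cost)))) Q" if "S 5 m'" for m'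
    by (rule runs_Seq[OF stage[OF that] tail]) simp_all
  have tail: "runs (Seq (stage 5) (Seq (stage 7) (Seq (stage 9) (Seq (stage 11) (Seq auction_prog finish))))) m'
      (stage_cost 5 + (stage_cost 7 + (stage_cost 9 + (stage_cost 11 + (auction_cost + finish_cost))))) Q" if "S 3 m'" for m'
    by (rule runs_Seq[OF stage[OF that] tail]) simp_all
  have tail: "runs (Seq (stage 3) (Seq (stage 5) (Seq (stage 7) (Seq (stage 9) (Seq (stage 11) (Seq auction_prog finish)))))) m'
      (stage_cost 3 + (stage_cost 5 + (stage_cost 7 + (stage_cost 9 + (stage_cost 11 + (auction_cost + finish_cost)))))) Q"
    if "S 1 m'" for m'
    by (rule runs_Seq[OF stage[OF that] tail]) simp_all
  have "runs main m main_cost Q" unfolding main_def main_cost_def by (rule runs_Seq[OF start tail])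
  then show ?thesis unfolding Q_def .
qed

end

section \<open>Polynomial time bounds\<close>

definition polybd :: "(nat \<Rightarrow> nat) \<Rightarrow> bool" where
  "polybd f \<longleftrightarrow> (\<exists>q :: nat poly. \<forall>n. f n = poly q n)"

lemma polybd_const: "polybd (\<lambda>_. c)"
  unfolding polybd_def by (intro exI[of _ "[:c:]"]) simp

lemma polybd_id: "polybd (\<lambda>n. n)"
  unfolding polybd_def by (intro exI[of _ "[:0, 1:]"]) simp

lemma polybd_add: "polybd f \<Longrightarrow> polybd g \<Longrightarrow> polybd (\<lambda>n. f n + g n)"
  unfolding polybd_def by (metis poly_add)

lemma polybd_mult: "polybd f \<Longrightarrow> polybd g \<Longrightarrow> polybd (\<lambda>n. f n * g n)"
  unfolding polybd_def by (metis poly_mult)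

lemma polybd_loop_cost: "polybd N \<Longrightarrow> polybd T \<Longrightarrow> polybd (\<lambda>n. loop_cost e (N n) (T n))"
  unfolding loop_cost_def by (intro polybd_add polybd_mult polybd_const)

lemma polybd_nest_cost: "polybd (\<lambda>n. nest_cost n d T)"
  by (induction d) (simp_all add: polybd_const polybd_loop_cost polybd_id)

text \<open>The cost constants of the locale depend on \<open>n\<close> alone, but their defining
  equations carry the locale assumptions. The edgeless graph satisfies these for every
  \<open>n\<close>, so the equations become available uniformly in \<open>n\<close>.\<close>

lemma machine_empty: "machine n {}"
proof
  have "({} :: (nat \<times> nat) set) ^^ j = {}" if "odd j" for j using that by (cases j) auto
  then show "no_short_odd 1 ({} :: (nat \<times> nat) set)"
    unfolding no_short_odd_def by (metis empty_iff)
qed simp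

lemma polybd_main_cost: "polybd (\<lambda>n. machine.main_cost n)"
proof -
  note defs = machine.main_cost_def machine.init_cost_def machine.stage_cost_def machine.auction_cost_def
    machine.pass_cost_def machine.bid_cost_def machine.finish_cost_def
  show ?thesis unfolding defs[OF machine_empty, abs_def]
    by (intro polybd_add polybd_loop_cost polybd_nest_cost polybd_const polybd_id)
qed

section \<open>Translation to string graphs and vertex covers\<close>

lemma linked_of_connected:
  assumes H: "pair_graph H" and c: "Digraph_Component.connected (with_proj H \<restriction> S)"
  shows "linked (parcs H) S"
proof -
  let ?K = "mk_symmetric (with_proj H \<restriction> S)"
  have sc: "strongly_connected (with_proj ?K)" using c by (simp add: Digraph_Component.connected_def)
  \<comment> \<open>\<open>H\<close> is symmetric already, so symmetrising the induced subgraph adds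
    no arcs outside of \<open>H\<close>.\<close>
  have sub: "parcs ?K \<subseteq> parcs H \<inter> S \<times> S"
    using pair_graphD(5)[OF H] by (auto simp: parcs_mk_symmetric)
  have ne: "S \<noteq> {}" using sc by (simp add: strongly_connected_def)
  have "(u, v) \<in> (parcs H \<inter> S \<times> S)\<^sup>*" if "u \<in> S" "v \<in> S" for u v
  proof -
    have "u \<rightarrow>\<^sup>*\<^bsub>with_proj ?K\<^esub> v" using sc that by (simp add: strongly_connected_def)
    then have "(u, v) \<in> rtrancl_on S (parcs ?K)" by (simp add: reachable_def)
    then have "(u, v) \<in> (parcs ?K)\<^sup>*" by (rule rtrancl_on_rtranclI)
    then show ?thesis using rtrancl_mono[OF sub] by blast
  qed
  then show ?thesis using ne by (simp add: linked_def)
qed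

text \<open>Induced subgraphs of string graphs are string graphs with the same host: the strings are
  restricted to \<open>X\<close>.\<close>

lemma thick_twelve_of_string_graph:
  assumes G: "pair_graph G" "string_graph G" and X: "X \<subseteq> pverts G"
    and odd: "no_short_odd 11 (parcs G \<inter> X \<times> X)"
  shows "thick (parcs G \<inter> X \<times> X) 12 X"
proof -
  from G(2) obtain H :: "nat pair_pre_digraph" and S where HS: "pair_graph H \<and> planar H \<and>
     (\<forall>v \<in> pverts G. S v \<subseteq> pverts H \<and> Digraph_Component.connected (with_proj H \<restriction> S v)) \<and>
     (\<forall>u \<in> pverts G. \<forall>v \<in> pverts G. u \<noteq> v \<longrightarrow> ((u, v) \<in> parcs G \<longleftrightarrow> S u \<inter> S v \<noteq> {}))"
    unfolding string_graph_def by (elim exE)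
  note H = HS[THEN conjunct1] HS[THEN conjunct2, THEN conjunct1]
    HS[THEN conjunct2, THEN conjunct2, THEN conjunct1, rule_format]
    HS[THEN conjunct2, THEN conjunct2, THEN conjunct2, rule_format]
  show ?thesis
  proof (rule thick_twelve_of_strings[OF H(1,2), where S = S])
    show "finite X" using X pair_graphD(1)[OF G(1)] finite_subset by blast
    show "S v \<subseteq> pverts H" "linked (parcs H) (S v)" if "v \<in> X" for v
      using H(3)[of v] that X linked_of_connected[OF H(1)] by blast+
    show "parcs G \<inter> X \<times> X = {(u, v). u \<in> X \<and> v \<in> X \<and> u \<noteq> v \<and> S u \<inter> S v \<noteq> {}}"
      using H(4) X pair_graphD(6)[OF G(1)] by blast
  qed (rule odd)
qed

lemma vertex_cover_iff:
  assumes "pair_graph G" "pverts G = {..<n}"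
  shows "vertex_cover G S \<longleftrightarrow> cover n (parcs G) S"
  using pair_graphD(3,4)[OF assms(1)] assms(2) unfolding vertex_cover_def cover_def
  by (auto simp: case_prod_beta) (metis lessThan_iff)+

lemma vc_props:
  assumes G: "pair_graph G" "pverts G = {..<n}"
  shows "\<exists>S. cover n (parcs G) S \<and> card S = vc G" "cover n (parcs G) S \<Longrightarrow> vc G \<le> card S"
proof -
  have "cover n (parcs G) {..<n}"
    using pair_graphD(3)[OF G(1)] G(2) by (auto simp: cover_def)
  then have ex: "\<exists>m S. vertex_cover G S \<and> card S = m" using vertex_cover_iff[OF G] by blast
  show "\<exists>S. cover n (parcs G) S \<and> card S = vc G"
    using LeastI_ex[OF ex] vertex_cover_iff[OF G] unfolding vc_def by simp
  show "cover n (parcs G) S \<Longrightarrow> vc G \<le> card S"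
    unfolding vc_def vertex_cover_iff[OF G] by (rule Least_le) blast
qed

lemma input_memory_cells:
  assumes G: "pverts G = {..<n}"
  shows "input_memory G k 0 = int n" "input_memory G k 1 = k" "a < 0 \<Longrightarrow> input_memory G k a = 0"
    "u < n \<Longrightarrow> v < n \<Longrightarrow> input_memory G k (2 + int u * int n + int v) = of_bool ((u, v) \<in> parcs G)"
proof -
  show "input_memory G k 0 = int n" "input_memory G k 1 = k" "a < 0 \<Longrightarrow> input_memory G k a = 0"
    using G by (simp_all add: input_memory_def Let_def)
  assume uv: "u < n" "v < n"
  define a where "a = 2 + int u * int n + int v"
  have "int u * int n + int v < int n * int n"
  proof -
    have "int u * int n + int v < int u * int n + int n" using uv by simp
    also have "\<dots> = (int u + 1) * int n" by (simp add: distrib_right)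
    also have "\<dots> \<le> int n * int n" using uv by (intro mult_right_mono) auto
    finally show ?thesis .
  qed
  moreover have "0 \<le> int u * int n + int v" by simp
  ultimately have "a \<noteq> 0" "a \<noteq> 1" "2 \<le> a" "a < 2 + int n * int n"
    unfolding a_def by linarith+
  moreover have "(a - 2) div int n = int u" "(a - 2) mod int n = int v" using uv by (simp_all add: a_def)
  ultimately have "input_memory G k a = of_bool ((u, v) \<in> parcs G)"
    using G unfolding input_memory_def Let_def by simp
  then show "input_memory G k (2 + int u * int n + int v) = of_bool ((u, v) \<in> parcs G)"
    unfolding a_def .
qed

text \<open>The inequality \<open>c + matched n p \<le> 2 * vc G\<close> holds for every graph and
  settles the first case. Only the opposite estimate
  \<open>12 * vc G \<le> 11 * (c + matched n p)\<close> depends on a string representation; with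
  \<open>12 * vc G > 22 * k\<close> it forces \<open>c + matched n p > 2 * k\<close> and settles the
  second.\<close>

theorem theorem3:
  shows "\<exists>(P :: prog) (p :: nat poly). \<forall>(n :: nat) (G :: nat pair_pre_digraph) (k :: int).
    pair_graph G \<and> pverts G = {..<n} \<longrightarrow>
      (\<exists>t m. exec P (input_memory G k) t m \<and> t \<le> poly p n \<and>
        (string_graph G \<and> int (vc G) \<le> k \<longrightarrow> reports_first m) \<and>
        (string_graph G \<and> real (vc G) > 11 * real_of_int k / 6 \<longrightarrow> reports_second m))"
proof -
  obtain q :: "nat poly" where q: "\<And>n. machine.main_cost n = poly q n"
    using polybd_main_cost unfolding polybd_def by blast
  have "\<exists>t m. exec main (input_memory G k) t m \<and> t \<le> poly q n \<and>
        (string_graph G \<and> int (vc G) \<le> k \<longrightarrow> reports_first m) \<and>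
        (string_graph G \<and> real (vc G) > 11 * real_of_int k / 6 \<longrightarrow> reports_second m)"
    if G: "pair_graph G" "pverts G = {..<n}" for n G k
  proof -
    let ?E = "parcs G"
    note GD = pair_graphD[OF G(1)]
    have E: "?E \<subseteq> {..<n} \<times> {..<n}" using GD(3,4) G(2) by auto
    have sym: "sym ?E" using GD(5) by (auto simp: sym_def)
    have irr: "no_short_odd 1 ?E"
      unfolding no_short_odd_def
    proof (intro allI impI)
      fix j x assume "odd j" "j \<le> (1::nat)"
      then have "j = 1" by (cases j) auto
      then show "(x, x) \<notin> ?E ^^ j" using GD(6) by auto
    qed
    interpret machine n ?E k by unfold_locales (fact E irr)+
    obtain t m D c p ow where run: "exec main (input_memory G k) t m" "t \<le> main_cost"
      and D: "packed n ?E D c" "no_short_odd 11 (alive ?E D)"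
      and au: "auction n (alive ?E D) p ow" "\<And>i. i < n \<Longrightarrow> happy n (alive ?E D) p ow i"
      and out: "m 0 = (if int (c + matched n p) \<le> 2 * k then 1 else 2)"
      using main_correct[OF input_memory_cells[OF G(2)]] unfolding runs_def by blast
    have lower: "c + matched n p \<le> 2 * vc G"
    proof -
      obtain S where S: "cover n ?E S" "card S = vc G" using vc_props(1)[OF G] by blast
      have "finite S" using S(1) finite_subset by (auto simp: cover_def)
      then have "card S = card (S \<inter> D) + card (S - D)"
        by (subst card_Un_disjoint[symmetric]) (auto intro: arg_cong[where f = card])
      moreover have "c \<le> 2 * card (S \<inter> D)" using D(1) S(1) by (simp add: packed_def)
      moreover have "matched n p \<le> 2 * card (S - D)" by (rule auction_lower[OF au(1) S(1)])
      ultimately show ?thesis using S(2) by linarith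
    qed
    have upper: "12 * vc G \<le> 11 * (c + matched n p)" if sg: "string_graph G"
    proof -
      have "thick (?E \<inter> X \<times> X) 12 X" if X: "X \<subseteq> {..<n} - D" for X
      proof (rule thick_twelve_of_string_graph[OF G(1) sg])
        show "X \<subseteq> pverts G" using X G(2) by blast
        show "no_short_odd 11 (?E \<inter> X \<times> X)"
          by (rule no_short_odd_mono[OF D(2)]) (use X in \<open>auto simp: alive_def\<close>)
      qed
      then obtain S where "cover n ?E S" "12 * card S \<le> 11 * (c + matched n p)"
        using half_integral_cover[OF D(1) sym E au] by blast
      then show ?thesis using vc_props(2)[OF G, of S] by linarith
    qed
    show ?thesis
    proof (intro exI conjI impI)
      show "exec main (input_memory G k) t m" "t \<le> poly q n" using run q by simp_all
      show "reports_first m" if "string_graph G \<and> int (vc G) \<le> k"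
        using out lower that by (simp add: reports_first_def)
      show "reports_second m" if s: "string_graph G \<and> real (vc G) > 11 * real_of_int k / 6"
      proof -
        have "\<not> int (c + matched n p) \<le> 2 * k"
        proof
          assume 1: "int (c + matched n p) \<le> 2 * k"
          have 2: "12 * int (vc G) \<le> 11 * int (c + matched n p)"
            using upper[OF conjunct1[OF s]] by (metis of_nat_le_iff of_nat_mult of_nat_numeral)
          have arith: "x \<le> 2 * k \<Longrightarrow> 12 * y \<le> 11 * x \<Longrightarrow> 12 * y \<le> 22 * k" for x y :: int by linarith
          have "12 * int (vc G) \<le> 22 * k" by (rule arith[OF 1 2])
          then have "12 * real (vc G) \<le> 22 * real_of_int k" by linarith
          then show False using s by simp
        qed
        then show ?thesis using out by (simp add: reports_second_def)
      qed
    qed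
  qed
  then show ?thesis by blast
qed

end
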